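(* Every Fraser graph (every graph $\mathcal F(T)$, $T\in\mathrm{SYT}(r\times 2)$, for any choice of triangulation) is a fully reduced $r$-hourglass plabic graph.
   Context: $r$-hourglass plabic graph: bipartite planar graph $\widehat G$ in a disk with fixed black–white coloring and positive integer edge multiplicities (an edge of multiplicity $m$ drawn as $m$ strands twisted so the clockwise order of strands agrees at both ends), internal vertices of degree $r$ counted with multiplicity, boundary vertices of simple degree one labeled $b_1,\dots,b_n$ clockwise. Trip segments: for $1\le i\le r-1$, a $\mathrm{trip}_i$-segment is a walk along strands taking the $i$-th leftmost turn at white vertices and the $i$-th rightmost turn at black vertices (starting at a boundary vertex or in the interior); segments looping inside one hourglass are trivial and ignored. Fully reduced: no connected component without boundary vertices; no trip segment visits a vertex more than once; and (defining intersections of two distinct segments by drawing them on $\widehat G$ and contracting edges traversed by both, an intersection being essential if the segments cross there, inessential if they bounce; segments sharing a boundary endpoint $b_k$ have an essential intersection at the internal neighbor of $b_k$) no two $\mathrm{trip}_i$-segments and no $\mathrm{trip}_i$- and $\mathrm{trip}_{i+1}$-segment have an oriented double crossing, i.e. an essential intersection followed forward along both segments by another essential intersection. Fraser's map: for $T$ a standard Young tableau of $r\times2$ rectangular shape, $\mathfrak M(T)$ is the noncrossing perfect matching of $[2r]$ in which each first-column entry is the smaller of its pair. Let $i_1,\dots,i_s$ (cyclic order) be those $i$ with $i,i+1\pmod{2r}$ matched; claw sets $C_j=(i_j,i_{j+1}]$ (cyclic intervals). Form an $s$-gon on vertices $\delta_1,\dots,\delta_s$ with an edge between $\delta_j,\delta_k$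 of weight equal to the number of arcs between $C_j$ and $C_k$ (if positive); complete to a weighted triangulation by arbitrary weight-0 diagonals. $\mathcal F(T)$: black boundary vertices $b_1,\dots,b_{2r}$; white vertex $w(\delta_j)$ joined by simple edges to $b_k$, $k\in C_j$; for each triangle $\Delta$ a black vertex $b(\Delta)$ joined to the white vertex of each corner $\delta$ of $\Delta$ with multiplicity equal to the total weight of the triangulation's edges in the part cut off by the side of $\Delta$ opposite $\delta$ (away from $\Delta$), including that side; multiplicity-0 edges omitted. A Fraser graph is any graph so obtained. *)

theory Defs
  imports "HOL-Combinatorics.Combinatorics"
begin

section \<open>Hourglass plabic graphs\<close>

text \<open>
  A graph drawn in an oriented surface is encoded as a combinatorial map.  Each edge of the
  underlying graph consists of two half-edges (darts) exchanged by \<open>opp\<close>; a dart \<open>d\<close> is read as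
  the edge directed away from \<open>tail d\<close>; \<open>cw d\<close> is the next dart clockwise around \<open>tail d\<close>;
  \<open>emult\<close> is the edge multiplicity; \<open>bdry\<close> lists the boundary vertices in clockwise order along
  the boundary circle of the disk.  Parallel edges are allowed.
\<close>

record ('v, 'd) hourglass =
  verts :: "'v set"
  darts :: "'d set"
  opp :: "'d \<Rightarrow> 'd"
  tail :: "'d \<Rightarrow> 'v"
  cw :: "'d \<Rightarrow> 'd"
  emult :: "'d \<Rightarrow> nat"
  black :: "'v \<Rightarrow> bool"
  bdry :: "'v list"

definition head :: "('v, 'd) hourglass \<Rightarrow> 'd \<Rightarrow> 'v" where
  "head G d = tail G (opp G d)"

definition wf_hourglass :: "('v, 'd) hourglass \<Rightarrow> bool" where
  "wf_hourglass G \<longleftrightarrow>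
     finite (verts G) \<and> finite (darts G) \<and> tail G ` darts G \<subseteq> verts G \<and>
     (\<forall>d\<in>darts G. opp G d \<in> darts G \<and> opp G d \<noteq> d \<and> opp G (opp G d) = d) \<and>
     bij_betw (cw G) (darts G) (darts G) \<and>
     (\<forall>d\<in>darts G. orbit (cw G) d = {e \<in> darts G. tail G e = tail G d}) \<and>
     (\<forall>d\<in>darts G. emult G d \<ge> 1 \<and> emult G (opp G d) = emult G d) \<and>
     distinct (bdry G) \<and> set (bdry G) \<subseteq> verts G"

definition simple_degree :: "('v, 'd) hourglass \<Rightarrow> 'v \<Rightarrow> nat" where
  "simple_degree G v = card {d \<in> darts G. tail G d = v}"

definition degree :: "('v, 'd) hourglass \<Rightarrow> 'v \<Rightarrow> nat" where
  "degree G v = (\<Sum>d | d \<in> darts G \<and> tail G d = v. emult G d)"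

definition properly_coloured :: "('v, 'd) hourglass \<Rightarrow> bool" where
  "properly_coloured G \<longleftrightarrow> (\<forall>d\<in>darts G. black G (head G d) \<noteq> black G (tail G d))"

text \<open>
  Collapsing the boundary circle turns the disk into a sphere and merges the boundary vertices
  \<open>b\<^sub>1, \<dots>, b\<^sub>n\<close>, each of simple degree one, into a single vertex.  Seen from that vertex the
  clockwise order is reversed: the dart at \<open>b\<^sub>k\<close> is followed by the dart at \<open>b\<^sub>k\<^sub>-\<^sub>1\<close>
  (and the dart at \<open>b\<^sub>1\<close> by the one at \<open>b\<^sub>n\<close>).  The combinatorial map is drawn in the disk, with
  the boundary vertices in the given clockwise order, iff the collapsed map is spherical, that
  is, satisfies Euler's formula V - E + F = 2C with faces counted separately in each of the C
  components.
\<close>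

definition collapsed_cw :: "('v, 'd) hourglass \<Rightarrow> 'd \<Rightarrow> 'd" where
  "collapsed_cw G d =
     (if tail G d \<in> set (bdry G)
      then (THE e. e \<in> darts G \<and> tail G e = cycle_of_list (rev (bdry G)) (tail G d))
      else cw G d)"

definition map_components :: "('d \<Rightarrow> 'd) \<Rightarrow> ('d \<Rightarrow> 'd) \<Rightarrow> 'd set \<Rightarrow> 'd set set" where
  "map_components f g D = (\<lambda>d. {(x, y). x \<in> D \<and> (y = f x \<or> y = g x)}\<^sup>* `` {d}) ` D"

definition drawn_in_disk :: "('v, 'd) hourglass \<Rightarrow> bool" where
  "drawn_in_disk G \<longleftrightarrow>
     (let D = darts G; s = collapsed_cw G;
          V = card (orbit s ` D);
          E = card (orbit (opp G) ` D);
          F = card (orbit (s \<circ> opp G) ` D);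
          C = card (map_components s (opp G) D)
      in V + F = E + 2 * C)"

definition hourglass_plabic :: "nat \<Rightarrow> ('v, 'd) hourglass \<Rightarrow> bool" where
  "hourglass_plabic r G \<longleftrightarrow>
     wf_hourglass G \<and> properly_coloured G \<and>
     (\<forall>v \<in> set (bdry G). simple_degree G v = 1) \<and>
     (\<forall>v \<in> verts G - set (bdry G). degree G v = r) \<and>
     drawn_in_disk G"


section \<open>Trip segments\<close>

text \<open>
  The strand \<open>(d, k)\<close> is the \<open>k\<close>-th strand, in clockwise order around \<open>tail d\<close>, of the edge \<open>d\<close>,
  directed away from \<open>tail d\<close>.  Since hourglasses are twisted, the clockwise order is the same at
  the other end, so the reversed strand keeps its number.
\<close>

type_synonym 'd strand = "'d \<times> nat"

definition strands :: "('v, 'd) hourglass \<Rightarrow> 'd strand set" where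
  "strands G = {(d, k). d \<in> darts G \<and> k < emult G d}"

definition strand_opp :: "('v, 'd) hourglass \<Rightarrow> 'd strand \<Rightarrow> 'd strand" where
  "strand_opp G s = (opp G (fst s), snd s)"

definition strand_cw :: "('v, 'd) hourglass \<Rightarrow> 'd strand \<Rightarrow> 'd strand" where
  "strand_cw G s =
     (if snd s + 1 < emult G (fst s) then (fst s, snd s + 1) else (cw G (fst s), 0))"

text \<open>
  Arriving at a vertex, the \<open>i\<close>-th leftmost turn leaves along the \<open>i\<close>-th strand clockwise from the
  arriving one, the \<open>i\<close>-th rightmost turn along the \<open>i\<close>-th strand counterclockwise from it.
\<close>

definition turn :: "('v, 'd) hourglass \<Rightarrow> nat \<Rightarrow> 'd strand \<Rightarrow> 'd strand \<Rightarrow> bool" where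
  "turn G i s t \<longleftrightarrow>
     head G (fst s) \<notin> set (bdry G) \<and>
     (if black G (head G (fst s))
      then (strand_cw G ^^ i) t = strand_opp G s
      else t = (strand_cw G ^^ i) (strand_opp G s))"

definition trivial_walk :: "('v, 'd) hourglass \<Rightarrow> 'd strand list \<Rightarrow> bool" where
  "trivial_walk G S \<longleftrightarrow> length S \<ge> 2 \<and> (\<exists>d. fst ` set S \<subseteq> {d, opp G d})"

definition trip_segment :: "('v, 'd) hourglass \<Rightarrow> nat \<Rightarrow> 'd strand list \<Rightarrow> bool" where
  "trip_segment G i S \<longleftrightarrow>
     S \<noteq> [] \<and> set S \<subseteq> strands G \<and> successively (turn G i) S \<and> \<not> trivial_walk G S"

definition visited :: "('v, 'd) hourglass \<Rightarrow> 'd strand list \<Rightarrow> 'v list" where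
  "visited G S = map (tail G \<circ> fst) S @ [head G (fst (last S))]"


section \<open>Intersections and double crossings\<close>

definition traversed :: "('v, 'd) hourglass \<Rightarrow> 'd strand list \<Rightarrow> 'd set" where
  "traversed G S = fst ` set S \<union> opp G ` fst ` set S"

definition shared :: "('v, 'd) hourglass \<Rightarrow> 'd strand list \<Rightarrow> 'd strand list \<Rightarrow> 'd set" where
  "shared G S T = traversed G S \<inter> traversed G T"

text \<open>
  The clockwise successor of a dart \<open>d \<notin> X\<close> once all edges with darts in \<open>X\<close> have been contracted:
  whenever the next dart \<open>e\<close> is contracted, go on with the dart following \<open>opp e\<close> at the other end.
\<close>

definition contracted_cw :: "('v, 'd) hourglass \<Rightarrow> 'd set \<Rightarrow> 'd \<Rightarrow> 'd" where
  "contracted_cw G X d =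
     (let skip = (\<lambda>e. cw G (opp G e))
      in (skip ^^ (LEAST k. (skip ^^ k) (cw G d) \<notin> X)) (cw G d))"

text \<open>The elements \<open>x, y, x', y'\<close> are distinct and met in this order along one cycle of \<open>f\<close>.\<close>

definition in_cyclic_order :: "('d \<Rightarrow> 'd) \<Rightarrow> 'd \<Rightarrow> 'd \<Rightarrow> 'd \<Rightarrow> 'd \<Rightarrow> bool" where
  "in_cyclic_order f x y x' y' \<longleftrightarrow>
     (\<exists>i j k. 0 < i \<and> i < j \<and> j < k \<and> (f ^^ i) x = y \<and> (f ^^ j) x = x' \<and> (f ^^ k) x = y' \<and>
        (\<forall>l. 0 < l \<and> l \<le> k \<longrightarrow> (f ^^ l) x \<noteq> x))"

text \<open>
  After contraction of \<open>X\<close>, the walk \<open>S\<close> stays at one point precisely along a maximal stretch of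
  consecutive edges in \<open>X\<close>.  Positions \<open>0, \<dots>, length S\<close> refer to \<^term>\<open>visited G S\<close>; the strand
  \<open>S ! m\<close> leads from position \<open>m\<close> to position \<open>m + 1\<close>.  A stretch may have no edge (\<open>a = b\<close>).
\<close>

definition stretch :: "'d set \<Rightarrow> 'd strand list \<Rightarrow> nat \<Rightarrow> nat \<Rightarrow> bool" where
  "stretch X S a b \<longleftrightarrow>
     a \<le> b \<and> b \<le> length S \<and> (\<forall>m. a \<le> m \<and> m < b \<longrightarrow> fst (S ! m) \<in> X) \<and>
     (a = 0 \<or> fst (S ! (a - 1)) \<notin> X) \<and> (b = length S \<or> fst (S ! b) \<notin> X)"

text \<open>
  The segments cross at the point to which the stretches \<open>a..b\<close> of \<open>S\<close> and \<open>c..d\<close> of \<open>T\<close> are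
  contracted: both pass through it, and around it the two darts of \<open>S\<close> alternate with the two
  of \<open>T\<close>.  If they do not alternate, the segments bounce.
\<close>

definition cross_at ::
  "('v, 'd) hourglass \<Rightarrow> 'd strand list \<Rightarrow> 'd strand list \<Rightarrow> nat \<Rightarrow> nat \<Rightarrow> nat \<Rightarrow> nat \<Rightarrow> bool" where
  "cross_at G S T a b c d \<longleftrightarrow>
     0 < a \<and> b < length S \<and> 0 < c \<and> d < length T \<and>
     (let f = contracted_cw G (shared G S T);
          x = opp G (fst (S ! (a - 1))); x' = fst (S ! b);
          y = opp G (fst (T ! (c - 1))); y' = fst (T ! d)
      in in_cyclic_order f x y x' y' \<or> in_cyclic_order f x y' x' y)"

definition endpoints_in :: "('v, 'd) hourglass \<Rightarrow> 'd strand list \<Rightarrow> nat \<Rightarrow> nat \<Rightarrow> 'v set" where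
  "endpoints_in G S a b = {visited G S ! m | m. m \<in> {0, length S} \<and> a \<le> m \<and> m \<le> b}"

text \<open>
  If the segments share a boundary endpoint \<open>b\<^sub>k\<close>, they share its only edge, so the stretch
  containing \<open>b\<^sub>k\<close> also contains the neighbour of \<open>b\<^sub>k\<close>, where the essential intersection lies.
\<close>

definition essential_at ::
  "('v, 'd) hourglass \<Rightarrow> 'd strand list \<Rightarrow> 'd strand list \<Rightarrow> nat \<Rightarrow> nat \<Rightarrow> nat \<Rightarrow> nat \<Rightarrow> bool" where
  "essential_at G S T a b c d \<longleftrightarrow>
     stretch (shared G S T) S a b \<and> stretch (shared G S T) T c d \<and>
     (cross_at G S T a b c d \<or>
      endpoints_in G S a b \<inter> endpoints_in G T c d \<inter> set (bdry G) \<noteq> {})"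

definition oriented_double_crossing ::
  "('v, 'd) hourglass \<Rightarrow> 'd strand list \<Rightarrow> 'd strand list \<Rightarrow> bool" where
  "oriented_double_crossing G S T \<longleftrightarrow>
     (\<exists>a b c d a' b' c' d'. essential_at G S T a b c d \<and> essential_at G S T a' b' c' d' \<and>
        b < a' \<and> d < c')"

definition fully_reduced :: "nat \<Rightarrow> ('v, 'd) hourglass \<Rightarrow> bool" where
  "fully_reduced r G \<longleftrightarrow>
     (\<forall>v \<in> verts G. \<exists>b \<in> set (bdry G). (v, b) \<in> {(tail G d, head G d) | d. d \<in> darts G}\<^sup>*) \<and>
     (\<forall>i \<in> {1..<r}. \<forall>S. trip_segment G i S \<longrightarrow> distinct (visited G S)) \<and>
     (\<forall>i \<in> {1..<r}. \<forall>j \<in> {1..<r}. \<forall>S T.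
        (j = i \<or> j = i + 1) \<and> trip_segment G i S \<and> trip_segment G j T \<and> S \<noteq> T
        \<longrightarrow> \<not> oriented_double_crossing G S T)"


section \<open>Two-column tableaux and their noncrossing matchings\<close>

text \<open>\<open>T (p, q)\<close> is the entry in row \<open>p\<close> and column \<open>q\<close>; values off the shape are irrelevant.\<close>

definition standard_tableau :: "nat \<Rightarrow> (nat \<times> nat \<Rightarrow> nat) \<Rightarrow> bool" where
  "standard_tableau r T \<longleftrightarrow>
     bij_betw T ({1..r} \<times> {1..2}) {1..2 * r} \<and>
     (\<forall>p \<in> {1..r}. T (p, 1) < T (p, 2)) \<and>
     (\<forall>p \<in> {1..<r}. \<forall>q \<in> {1..2}. T (p, q) < T (p + 1, q))"

text \<open>Arcs and chords are pairs \<open>(a, b)\<close> with \<open>a < b\<close>.\<close>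

definition chords :: "nat \<Rightarrow> (nat \<times> nat) set" where
  "chords n = {(a, b). 1 \<le> a \<and> a < b \<and> b \<le> n}"

fun crossing :: "nat \<times> nat \<Rightarrow> nat \<times> nat \<Rightarrow> bool" where
  "crossing (a, b) (c, d) \<longleftrightarrow> a < c \<and> c < b \<and> b < d \<or> c < a \<and> a < d \<and> d < b"

definition noncrossing :: "(nat \<times> nat) set \<Rightarrow> bool" where
  "noncrossing A \<longleftrightarrow> (\<forall>e\<in>A. \<forall>f\<in>A. \<not> crossing e f)"

definition perfect_matching :: "nat \<Rightarrow> (nat \<times> nat) set \<Rightarrow> bool" where
  "perfect_matching n M \<longleftrightarrow> M \<subseteq> chords n \<and> (\<forall>k\<in>{1..n}. \<exists>!e. e \<in> M \<and> (k = fst e \<or> k = snd e))"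

definition matching_of_tableau :: "nat \<Rightarrow> (nat \<times> nat \<Rightarrow> nat) \<Rightarrow> (nat \<times> nat) set \<Rightarrow> bool" where
  "matching_of_tableau r T M \<longleftrightarrow>
     perfect_matching (2 * r) M \<and> noncrossing M \<and> (\<forall>p\<in>{1..r}. T (p, 1) \<in> fst ` M)"


section \<open>Fraser graphs\<close>

definition joined :: "(nat \<times> nat) set \<Rightarrow> nat \<Rightarrow> nat \<Rightarrow> bool" where
  "joined A a b \<longleftrightarrow> (a, b) \<in> A \<or> (b, a) \<in> A"

definition short_starts :: "nat \<Rightarrow> (nat \<times> nat) set \<Rightarrow> nat list" where
  "short_starts r M =
     filter (\<lambda>i. joined M i (if i = 2 * r then 1 else i + 1)) [1..<2 * r + 1]"

definition num_claws :: "nat \<Rightarrow> (nat \<times> nat) set \<Rightarrow> nat" where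
  "num_claws r M = length (short_starts r M)"

text \<open>The cyclic interval \<open>(a, b]\<close> of \<open>{1..n}\<close>, listed in cyclic order.\<close>

definition cyclic_interval :: "nat \<Rightarrow> nat \<Rightarrow> nat \<Rightarrow> nat list" where
  "cyclic_interval n a b =
     (if a < b then [a + 1..<b + 1] else [a + 1..<n + 1] @ [1..<b + 1])"

text \<open>Claws are numbered from 1, list positions from 0.\<close>

definition claw :: "nat \<Rightarrow> (nat \<times> nat) set \<Rightarrow> nat \<Rightarrow> nat list" where
  "claw r M j =
     (let I = short_starts r M in cyclic_interval (2 * r) (I ! (j - 1)) (I ! (j mod length I)))"

definition weight :: "nat \<Rightarrow> (nat \<times> nat) set \<Rightarrow> nat \<Rightarrow> nat \<Rightarrow> nat" where
  "weight r M j k =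
     card {(a, b) \<in> M. a \<in> set (claw r M j) \<and> b \<in> set (claw r M k) \<or>
                       a \<in> set (claw r M k) \<and> b \<in> set (claw r M j)}"

text \<open>
  The vertices of the \<open>s\<close>-gon are \<open>1, \<dots>, s\<close> in clockwise order.  A triangulation is a maximal
  noncrossing set of chords; it contains all sides.
\<close>

definition triangulation :: "nat \<Rightarrow> (nat \<times> nat) set \<Rightarrow> bool" where
  "triangulation s D \<longleftrightarrow>
     D \<subseteq> chords s \<and> noncrossing D \<and>
     (\<forall>e \<in> chords s. (\<forall>f\<in>D. \<not> crossing e f) \<longrightarrow> e \<in> D)"

definition fraser_triangulation :: "nat \<Rightarrow> (nat \<times> nat) set \<Rightarrow> (nat \<times> nat) set \<Rightarrow> bool" where
  "fraser_triangulation r M D \<longleftrightarrow>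
     triangulation (num_claws r M) D \<and>
     (\<forall>(j, k) \<in> chords (num_claws r M). weight r M j k > 0 \<longrightarrow> (j, k) \<in> D)"

text \<open>
  Since the polygon is convex, three pairwise joined vertices always span a triangle of the
  triangulation.
\<close>

definition triangles :: "(nat \<times> nat) set \<Rightarrow> nat set set" where
  "triangles D = {{a, b, c} | a b c. (a, b) \<in> D \<and> (b, c) \<in> D \<and> (a, c) \<in> D}"

text \<open>
  The polygon vertices lying on the chord with endpoints \<open>x < y\<close> or beyond it, as seen from the
  polygon vertex \<open>\<delta>\<close>.
\<close>

definition cut_off :: "nat \<Rightarrow> nat \<Rightarrow> nat \<Rightarrow> nat \<Rightarrow> nat set" where
  "cut_off s \<delta> x y = (if x < \<delta> \<and> \<delta> < y then {1..x} \<union> {y..s} else {x..y})"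

definition corner_mult ::
  "nat \<Rightarrow> (nat \<times> nat) set \<Rightarrow> (nat \<times> nat) set \<Rightarrow> nat set \<Rightarrow> nat \<Rightarrow> nat" where
  "corner_mult r M D \<Delta> \<delta> =
     (let P = cut_off (num_claws r M) \<delta> (Min (\<Delta> - {\<delta>})) (Max (\<Delta> - {\<delta>}))
      in \<Sum>(a, b) \<in> D \<inter> P \<times> P. weight r M a b)"

datatype fraser_vertex = Bd nat | Wh nat | Tri "nat set"

text \<open>A dart of a Fraser graph is the pair of its tail and its head.\<close>

type_synonym fraser_dart = "fraser_vertex \<times> fraser_vertex"

definition fraser_verts :: "nat \<Rightarrow> (nat \<times> nat) set \<Rightarrow> (nat \<times> nat) set \<Rightarrow> fraser_vertex set" where
  "fraser_verts r M D = Bd ` {1..2 * r} \<union> Wh ` {1..num_claws r M} \<union> Tri ` triangles D"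

definition fraser_darts :: "nat \<Rightarrow> (nat \<times> nat) set \<Rightarrow> (nat \<times> nat) set \<Rightarrow> fraser_dart set" where
  "fraser_darts r M D =
     (let E = {(Wh j, Bd k) | j k. j \<in> {1..num_claws r M} \<and> k \<in> set (claw r M j)} \<union>
              {(Wh \<delta>, Tri \<Delta>) | \<delta> \<Delta>. \<Delta> \<in> triangles D \<and> \<delta> \<in> \<Delta> \<and> corner_mult r M D \<Delta> \<delta> > 0}
      in E \<union> E\<inverse>)"

fun fraser_mult :: "nat \<Rightarrow> (nat \<times> nat) set \<Rightarrow> (nat \<times> nat) set \<Rightarrow> fraser_dart \<Rightarrow> nat" where
  "fraser_mult r M D (Wh \<delta>, Tri \<Delta>) = corner_mult r M D \<Delta> \<delta>"
| "fraser_mult r M D (Tri \<Delta>, Wh \<delta>) = corner_mult r M D \<Delta> \<delta>"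
| "fraser_mult r M D _ = 1"

text \<open>
  The triangles at the polygon vertex \<open>j\<close>, in clockwise order around it: if the chords at \<open>j\<close>,
  in this order, end in \<open>x\<^sub>1, \<dots>, x\<^sub>m\<close> (so \<open>x\<^sub>1\<close> follows and \<open>x\<^sub>m\<close> precedes \<open>j\<close> on the polygon), the
  triangles are the \<open>{j, x\<^sub>t, x\<^sub>t\<^sub>+\<^sub>1}\<close>.
\<close>

definition fan :: "nat \<Rightarrow> (nat \<times> nat) set \<Rightarrow> nat \<Rightarrow> nat set list" where
  "fan s D j =
     (let X = filter (joined D j) ([j + 1..<s + 1] @ [1..<j])
      in map (\<lambda>(x, y). {j, x, y}) (zip X (tl X)))"

text \<open>
  The neighbours of a vertex in clockwise order.  At a white vertex \<open>Wh j\<close>, drawn at the polygon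
  vertex \<open>j\<close>, the boundary vertices of the claw (outside the polygon) come first, then the
  triangles (inside the polygon).
\<close>

fun neighbours :: "nat \<Rightarrow> (nat \<times> nat) set \<Rightarrow> (nat \<times> nat) set \<Rightarrow> fraser_vertex \<Rightarrow> fraser_vertex list" where
  "neighbours r M D (Bd k) =
     map Wh (filter (\<lambda>j. k \<in> set (claw r M j)) [1..<num_claws r M + 1])"
| "neighbours r M D (Wh j) =
     map Bd (claw r M j) @
     map Tri (filter (\<lambda>\<Delta>. corner_mult r M D \<Delta> j > 0) (fan (num_claws r M) D j))"
| "neighbours r M D (Tri \<Delta>) =
     map Wh (filter (\<lambda>\<delta>. corner_mult r M D \<Delta> \<delta> > 0) (sorted_list_of_set \<Delta>))"

definition fraser_graph ::
  "nat \<Rightarrow> (nat \<times> nat) set \<Rightarrow> (nat \<times> nat) set \<Rightarrow> (fraser_vertex, fraser_dart) hourglass" where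
  "fraser_graph r M D =
     \<lparr> verts = fraser_verts r M D,
       darts = fraser_darts r M D,
       opp = prod.swap,
       tail = fst,
       cw = (\<lambda>(u, v). (u, cycle_of_list (neighbours r M D u) v)),
       emult = fraser_mult r M D,
       black = (\<lambda>v. case v of Wh _ \<Rightarrow> False | _ \<Rightarrow> True),
       bdry = map Bd [1..<2 * r + 1] \<rparr>"

definition fraser_graph_of ::
  "nat \<Rightarrow> (nat \<times> nat \<Rightarrow> nat) \<Rightarrow> (fraser_vertex, fraser_dart) hourglass \<Rightarrow> bool" where
  "fraser_graph_of r T G \<longleftrightarrow>
     (\<exists>M D. matching_of_tableau r T M \<and> fraser_triangulation r M D \<and> G = fraser_graph r M D)"

end

theory Submission
  imports Defs
begin

text \<open>
  Number the \<open>r\<close> strands around every internal vertex in clockwise order.  Counting arcs of the matching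
  locates each hourglass, because the strands towards a triangle correspond to the arcs beyond the
  side opposite to the corner.  It follows that a trip segment which has passed a triangle stays in the part
  of the polygon beyond the side it has crossed, and that it always turns to the same side of
  the triangles; so its white vertices move monotonically around the polygon and it visits no
  vertex twice.  Two segments that separate enter regions with at most one common vertex: if they
  separate at a white vertex, they can only meet once more, where they bounce; if they separate
  at a triangle, the order of their strands keeps them apart for good.  Hence two essential
  intersections never follow each other.  Planarity is Euler's formula: the faces are the gaps inside
  the claws and the chords of the triangulation.
\<close>

section \<open>Weighted triangulated polygons\<close>

text \<open>The matching has \<open>r\<close> arcs, and every internal vertex sorts all of them: a
  white vertex into the arcs at its claw and those in each wedge of its fan, a triangle into those
  beyond each of its sides. So a strand number modulo \<open>r\<close> is at the same time a
  position inside a region of the polygon. On its way from one white vertex to the next, a segment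
  turns by \<open>-i\<close> at the triangle and by \<open>+i\<close> at the white vertex after it.
  The two cancel, so its offset in the region ahead is free of \<open>i\<close>; the index only
  decides, by comparison with the offset, which of the two corners is passed. This makes trips of
  different index comparable. One corner is taken under a strict inequality and the other under a
  weak one, which leaves room for the indices \<open>i\<close> and \<open>i + 1\<close>. A second
  obstacle is that essential intersections live in a contracted graph, while the argument follows
  visited vertices. The bridge is that both stretches of an essential intersection contain a common
  white vertex, since two segments passing through one triangle share one of its three
  edges.\<close>

locale weighted_polygon =
  fixes s :: nat and D :: "(nat \<times> nat) set" and A :: "'a set" and c1 c2 :: "'a \<Rightarrow> nat"
  assumes s2: "2 \<le> s"
    and tri: "triangulation s D"
    and finA: "finite A"
    and ends: "e \<in> A \<Longrightarrow> c1 e \<in> {1..s}" "e \<in> A \<Longrightarrow> c2 e \<in> {1..s}"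
    and arcD: "e \<in> A \<Longrightarrow> joined D (c1 e) (c2 e)"
    and sides: "j \<in> {1..s} \<Longrightarrow> \<exists>e\<in>A. {c1 e, c2 e} = {j, j mod s + 1}"
begin

text \<open>
  Polygon vertices are lifted to the integers, \<open>vtx\<close> being the reduction modulo \<open>s\<close>, so that
  clockwise order becomes the order of \<open>int\<close> within a window of length \<open>s\<close>.  The elements of \<open>A\<close> are
  the arcs of the matching, and \<open>c1\<close>, \<open>c2\<close> the claws of their ends: \<open>E a b\<close> is a chord, \<open>N a b\<close> the
  weight cut off by it on the side of \<open>a, a + 1, \<dots>, b\<close>, and \<open>Tr j k l\<close> a triangle with corners in clockwise
  order.
\<close>

definition vtx :: "int \<Rightarrow> nat" where
  "vtx z = nat ((z - 1) mod int s) + 1"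

definition E :: "int \<Rightarrow> int \<Rightarrow> bool" where
  "E a b \<longleftrightarrow> a < b \<and> b < a + int s \<and> joined D (vtx a) (vtx b)"

definition arcs :: "int \<Rightarrow> int \<Rightarrow> 'a set" where
  "arcs a b = {e \<in> A. c1 e \<in> vtx ` {a..b} \<and> c2 e \<in> vtx ` {a..b}}"

definition N :: "int \<Rightarrow> int \<Rightarrow> int" where
  "N a b = int (card (arcs a b))"

definition deg :: "int \<Rightarrow> int" where
  "deg v = int (card {e \<in> A. c1 e = vtx v \<or> c2 e = vtx v})"

definition Tr :: "int \<Rightarrow> int \<Rightarrow> int \<Rightarrow> bool" where
  "Tr j k l \<longleftrightarrow> E j k \<and> E k l \<and> E l (j + int s)"

lemma Dchords: "D \<subseteq> chords s" and Dnc: "noncrossing D"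
  and Dmax: "e \<in> chords s \<Longrightarrow> (\<forall>f\<in>D. \<not> crossing e f) \<Longrightarrow> e \<in> D"
  using tri unfolding triangulation_def by auto

lemma joined_sym: "joined D a b \<longleftrightarrow> joined D b a"
  by (auto simp: joined_def)

lemma joined_neq: "joined D a b \<Longrightarrow> a \<noteq> b \<and> a \<in> {1..s} \<and> b \<in> {1..s}"
  using Dchords by (auto simp: joined_def chords_def)

lemma joined_less: "joined D a b \<Longrightarrow> a < b \<Longrightarrow> (a, b) \<in> D"
  using Dchords by (auto simp: joined_def chords_def)

section \<open>Lifting polygon vertices to the integers\<close>

lemma vtx_range: "vtx z \<in> {1..s}"
proof -
  have "0 \<le> (z - 1) mod int s" "(z - 1) mod int s < int s"
    using s2 by auto
  thus ?thesis unfolding vtx_def by auto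
qed

lemma vtx_ge [simp]: "Suc 0 \<le> vtx z" and vtx_le [simp]: "vtx z \<le> s"
  using vtx_range[of z] by auto

lemma vtx_shift_mult [simp]: "vtx (z + k * int s) = vtx z"
proof -
  have "z + k * int s - 1 = (z - 1) + k * int s" by simp
  thus ?thesis unfolding vtx_def by (metis mod_mult_self1)
qed

lemma vtx_shift [simp]: "vtx (z + int s) = vtx z" "vtx (z - int s) = vtx z"
  using vtx_shift_mult[of z 1] vtx_shift_mult[of z "-1"] by simp_all

lemma vtx_eq_iff: "vtx a = vtx b \<longleftrightarrow> int s dvd a - b"
proof -
  have "vtx a = vtx b \<longleftrightarrow> (a - 1) mod int s = (b - 1) mod int s"
    unfolding vtx_def using s2 by (simp add: nat_eq_iff)
  also have "\<dots> \<longleftrightarrow> int s dvd (a - 1) - (b - 1)" by (rule mod_eq_dvd_iff)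
  finally show ?thesis by simp
qed

lemma vtx_close: "a < b + int s \<Longrightarrow> b < a + int s \<Longrightarrow> vtx a = vtx b \<longleftrightarrow> a = b"
  unfolding vtx_eq_iff using zdvd_not_zless[of "\<bar>a - b\<bar>" "int s"] by (cases "a = b") auto

lemma vtx_small: "1 \<le> z \<Longrightarrow> z \<le> int s \<Longrightarrow> vtx z = nat z"
  unfolding vtx_def by (simp add: nat_eq_iff)

lemma vtx_small2: "int s < z \<Longrightarrow> z \<le> 2 * int s \<Longrightarrow> vtx z = nat (z - int s)"
  using vtx_small[of "z - int s"] by simp

lemma vtx_of_nat: "v \<in> {1..s} \<Longrightarrow> vtx (int v) = v"
  by (simp add: vtx_small)

text \<open>Vertices are compared inside a window of length \<open>s\<close>, where
  \<open>vtx\<close> is injective; this lemma brings a vertex into the window that starts at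
  \<open>a\<close>.\<close>

lemma lift_ex:
  assumes "v \<in> {1..s}" obtains z where "a \<le> z" "z < a + int s" "vtx z = v"
proof -
  define z where "z = a + (int v - a) mod int s"
  have "int s dvd z - int v" unfolding z_def
    by (metis add_diff_eq diff_diff_eq2 dvd_minus_mod dvd_diff_commute add.commute)
  hence "vtx z = v" using vtx_eq_iff[of z "int v"] vtx_of_nat[OF assms] by simp
  thus ?thesis using that[of z] s2 unfolding z_def by auto
qed

lemma in_vtx_image:
  assumes "a \<le> p" "q < a + int s" "a \<le> z" "z < a + int s"
  shows "vtx z \<in> vtx ` {p..q} \<longleftrightarrow> p \<le> z \<and> z \<le> q"
proof -
  have "z = y" if "vtx z = vtx y" "p \<le> y" "y \<le> q" for y
    using vtx_close[of z y] that assms by auto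
  thus ?thesis by auto
qed

section \<open>Lifted chords and the maximality of the triangulation\<close>

lemma E_shift [simp]: "E (a + int s) (b + int s) \<longleftrightarrow> E a b" "E (a - int s) (b - int s) \<longleftrightarrow> E a b"
  unfolding E_def by auto

lemma E_less: "E a b \<Longrightarrow> a < b \<and> b < a + int s"
  unfolding E_def by auto

lemma E_rev: "E a b \<Longrightarrow> E b (a + int s)" "E a b \<Longrightarrow> E (b - int s) a"
  unfolding E_def by (auto simp: joined_sym)

lemma E_shift_mult: "E (a + k * int s) (b + k * int s) \<longleftrightarrow> E a b"
  unfolding E_def by auto

lemma E_of_joined:
  assumes "joined D (vtx a) (vtx b)" "a \<le> b" "b < a + int s" shows "E a b"
proof -
  have "a \<noteq> b" using assms(1) joined_neq by blast
  thus ?thesis using assms unfolding E_def by auto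
qed

text \<open>Once the first point of a window lies in \<open>1..s\<close>, the other points lie below
  \<open>2 * s\<close>, so each is reduced by subtracting \<open>s\<close> at most once.\<close>

lemma base_shift: obtains k where "1 \<le> a + k * int s" "a + k * int s \<le> int s"
proof -
  have "a + (- ((a - 1) div int s)) * int s = (a - 1) mod int s + 1"
    by (simp add: minus_div_mult_eq_mod [symmetric])
  moreover have "0 \<le> (a - 1) mod int s" "(a - 1) mod int s < int s" using s2 by auto
  ultimately show ?thesis using that[of "- ((a - 1) div int s)"] by linarith
qed

text \<open>After a shift the points past \<open>s\<close> form a final part of the sequence
  \<open>a, b, c, d\<close>. Each possible final part is a case, and in each case reduction gives
  two crossing chords of \<open>D\<close>.\<close>

lemma E_noncrossing:
  assumes "E a c" "E b d" "a < b" "b < c" "c < d" "d < a + int s"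
  shows False
proof -
  obtain k where k: "1 \<le> a + k * int s" "a + k * int s \<le> int s" by (rule base_shift)
  define a' b' c' d' where defs: "a' = a + k * int s" "b' = b + k * int s" "c' = c + k * int s"
      "d' = d + k * int s"
  have E: "E a' c'" "E b' d'" using assms unfolding defs by (auto simp: E_shift_mult)
  have ord: "1 \<le> a'" "a' \<le> int s" "a' < b'" "b' < c'" "c' < d'" "d' < a' + int s" using assms k
      unfolding defs by auto
  have red: "vtx z = nat (if z \<le> int s then z else z - int s)" if "1 \<le> z" "z \<le> 2 * int s" for z
    using vtx_small[of z] vtx_small2[of z] that by auto
  have v: "vtx a' = nat a'" "vtx b' = nat (if b' \<le> int s then b' else b' - int s)"
    "vtx c' = nat (if c' \<le> int s then c' else c' - int s)"
        "vtx d' = nat (if d' \<le> int s then d' else d' - int s)"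
    using red[of a'] red[of b'] red[of c'] red[of d'] ord by auto
  have J: "joined D (vtx a') (vtx c')" "joined D (vtx b') (vtx d')" using E unfolding E_def by auto
  have nc: "\<not> crossing (p, q) (x, y)" if "joined D p q" "joined D x y" "p < q" "x < y" for p q x y
    using Dnc joined_less[OF that(1,3)] joined_less[OF that(2,4)] unfolding noncrossing_def by blast
  show False
  proof (cases "c' \<le> int s")
    case True
    have "vtx a' < vtx c'" using v ord True by auto
    show ?thesis
    proof (cases "d' \<le> int s")
      case T2: True
      show ?thesis using nc[OF J] v ord True T2 by auto
    next
      case False
      show ?thesis using nc[OF J(1), of "vtx d'" "vtx b'"] J(2) joined_sym v ord True False by auto
    qed
  next
    case False
    show ?thesis
    proof (cases "b' \<le> int s")
      case T2: True
      show ?thesis using nc[of "vtx c'" "vtx a'" "vtx d'" "vtx b'"] J joined_sym v ord T2 False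
          by auto
    next
      case F2: False
      show ?thesis using nc[of "vtx c'" "vtx a'" "vtx b'" "vtx d'"] J joined_sym v ord F2 False
          by auto
    qed
  qed
qed

text \<open>Lifted maximality of \<open>D\<close>. A single crossing pattern suffices as hypothesis:
  a chord crossing \<open>a c\<close> has exactly one end strictly between \<open>a\<close> and
  \<open>c\<close>, and taking it as \<open>p\<close> puts a lift of the other end between
  \<open>c\<close> and \<open>a + s\<close>.\<close>

lemma E_max:
  assumes ac: "a < c" "c < a + int s"
    and nc: "\<And>p q. E p q \<Longrightarrow> a < p \<Longrightarrow> p < c \<Longrightarrow> c < q \<Longrightarrow> q < a + int s \<Longrightarrow> False"
  shows "E a c"
proof -
  define x y where xy: "x = min (vtx a) (vtx c)" "y = max (vtx a) (vtx c)"
  have ne: "vtx a \<noteq> vtx c" using vtx_close[of a c] ac by auto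
  have ch: "(x, y) \<in> chords s" unfolding xy chords_def using ne by (auto simp: min_def max_def)
  have "(x, y) \<in> D"
  proof (rule Dmax[OF ch], intro ballI notI)
    fix f assume f: "f \<in> D" "crossing (x, y) f"
    obtain p q where pq: "f = (p, q)" by (cases f)
    have pqD: "(p, q) \<in> D" "p < q" "p \<in> {1..s}" "q \<in> {1..s}"
      using f Dchords pq by (auto simp: chords_def)
    have sep: "(x < p \<and> p < y \<and> (q < x \<or> y < q)) \<or> (x < q \<and> q < y \<and> (p < x \<or> y < p))"
      using f(2) pq by auto
    \<comment> \<open>By symmetry \<open>p\<close> is the end strictly between \<open>x\<close> and
      \<open>y\<close>. Whether \<open>c'\<close> exceeds \<open>s\<close> decides if
      \<open>vtx\<close> keeps or reverses the order of \<open>a\<close> and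
      \<open>c\<close>.\<close>
    have *: False if pq: "joined D p q" "p \<in> {1..s}" "q \<in> {1..s}" "x < p" "p < y"
        "q < x \<or> y < q" for p q
    proof -
      obtain k where k: "1 \<le> a + k * int s" "a + k * int s \<le> int s" by (rule base_shift)
      define a' c' where defs: "a' = a + k * int s" "c' = c + k * int s"
      have o: "1 \<le> a'" "a' \<le> int s" "a' < c'" "c' < a' + int s" using k ac unfolding defs by auto
      have va: "int (vtx a) = a'" using vtx_small[of a'] o unfolding defs by auto
      have vc: "int (vtx c) = (if c' \<le> int s then c' else c' - int s)"
        using vtx_small[of c'] vtx_small2[of c'] o unfolding defs by auto
      have main: "False" if "E p' q'" "a' < p'" "p' < c'" "c' < q'" "q' < a' + int s" for p' q'
        using nc[of "p' - k * int s" "q' - k * int s"] E_shift_mult[of "p' - k * int s" k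
            "q' - k * int s"] that
        unfolding defs by auto
      have J: "joined D (vtx (int p)) (vtx (int q))" "joined D (vtx (int q)) (vtx (int p))"
        using pq vtx_of_nat joined_sym by auto
      have J2: "joined D (vtx (int p)) (vtx (int q + int s))"
          "joined D (vtx (int q)) (vtx (int p + int s))"
        "joined D (vtx (int p + int s)) (vtx (int q + int s))"
            "joined D (vtx (int p)) (vtx (int q))" using J by auto
      show False
      proof (cases "c' \<le> int s")
        case True
        hence x: "int x = a'" "int y = c'" using va vc o xy by (auto simp: min_def max_def)
        from pq(6) show False
        proof
          assume "q < x"
          have "E (int p) (int q + int s)" using J2 pq x o \<open>q < x\<close> by (intro E_of_joined) auto
          thus False using main[of "int p" "int q + int s"] pq x o True \<open>q < x\<close> by auto
        next
          assume "y < q"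
          have "E (int p) (int q)" using J2 pq x o \<open>y < q\<close> by (intro E_of_joined) auto
          thus False using main[of "int p" "int q"] pq x o \<open>y < q\<close> joined_neq[of p q] by auto
        qed
      next
        case False
        hence x: "int x = c' - int s" "int y = a'" using va vc o xy by (auto simp: min_def max_def)
        from pq(6) show False
        proof
          assume "q < x"
          have "E (int q + int s) (int p + int s)" using J2 joined_sym pq x o \<open>q < x\<close>
              by (intro E_of_joined) auto
          thus False using main[of "int q + int s" "int p + int s"] pq x o False \<open>q < x\<close> by auto
        next
          assume "y < q"
          have "E (int q) (int p + int s)" using J2 pq x o \<open>y < q\<close> by (intro E_of_joined) auto
          thus False using main[of "int q" "int p + int s"]
              False pq x o \<open>y < q\<close> joined_neq[of p q] by auto
        qed
      qed
    qed
    show False using sep *[of p q] *[of q p] pqD joined_sym unfolding joined_def by blast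
  qed
  hence "joined D (vtx a) (vtx c)" unfolding xy joined_def
      by (auto simp: min_def max_def split: if_splits)
  thus ?thesis using ac unfolding E_def by auto
qed

text \<open>A crossing chord would need an end strictly between \<open>a\<close> and
  \<open>a + 1\<close>.\<close>

lemma E_side: "E a (a + 1)"
  by (rule E_max) (use s2 in auto)

text \<open>The apex is the last neighbour \<open>b\<close> of \<open>a\<close> before
  \<open>c\<close>. A chord separating \<open>b\<close> from \<open>c\<close> would cross
  \<open>a c\<close> or \<open>a b\<close>, or it would end at \<open>a\<close> and yield a later
  neighbour; so \<open>b c\<close> is a chord by maximality.\<close>

lemma E_apex:
  assumes "E a c" "a + 1 < c"
  obtains b where "a < b" "b < c" "E a b" "E b c"
proof -
  define B where "B = {b. a < b \<and> b < c \<and> E a b}"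
  have fin: "finite B" unfolding B_def by (rule finite_subset[of _ "{a..c}"]) auto
  have ne: "B \<noteq> {}" using E_side[of a] assms unfolding B_def by auto
  define b where "b = Max B"
  have bB: "b \<in> B" and bmax: "\<And>b'. b' \<in> B \<Longrightarrow> b' \<le> b" unfolding b_def using fin ne by auto
  have b: "a < b" "b < c" "E a b" using bB unfolding B_def by auto
  have "E b c"
  proof (rule E_max)
    show "b < c" "c < b + int s" using b E_less[OF assms(1)] by auto
    fix p q assume pq: "E p q" "b < p" "p < c" "c < q" "q < b + int s"
    consider "q < a + int s" | "q = a + int s" | "q > a + int s" by linarith
    thus False
    proof cases
      case 1 thus ?thesis using E_noncrossing[OF assms(1) pq(1)] pq b by auto
    next
      case 2
      hence "E a p" using E_rev(2)[OF pq(1)] by auto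
      hence "p \<in> B" using pq b unfolding B_def by auto
      thus False using bmax pq by force
    next
      case 3
      have "E (q - int s) p" using E_rev(2)[OF pq(1)] .
      thus ?thesis using E_noncrossing[OF b(3) \<open>E (q - int s) p\<close>] 3 pq b E_less[OF assms(1)] by auto
    qed
  qed
  thus ?thesis using that b by auto
qed

lemma apex_unique:
  assumes "E a b" "E b c" "E a b'" "E b' c" "c < a + int s"
  shows "b = b'"
  using E_noncrossing[of a b' b c] E_noncrossing[of a b b' c] E_less assms
  by (metis linorder_neqE)

section \<open>Triangles with their corners in clockwise order\<close>

lemma Tr_less: "Tr j k l \<Longrightarrow> j < k \<and> k < l \<and> l < j + int s"
  unfolding Tr_def using E_less by force

lemma Tr_E: "Tr j k l \<Longrightarrow> E j k" "Tr j k l \<Longrightarrow> E k l" "Tr j k l \<Longrightarrow> E j l"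
  unfolding Tr_def using E_rev(2)[of l "j + int s"] by auto

lemma TrI: "E j k \<Longrightarrow> E k l \<Longrightarrow> E j l \<Longrightarrow> Tr j k l"
  unfolding Tr_def using E_rev by auto

lemma Tr_rot: "Tr j k l \<Longrightarrow> Tr k l (j + int s)" "Tr j k l \<Longrightarrow> Tr (l - int s) j k"
  unfolding Tr_def using E_shift(2)[of l "j + int s"] by auto

lemma triangleI:
  assumes "joined D a b" "joined D b c" "joined D a c" shows "{a, b, c} \<in> triangles D"
proof -
  have *: "{a, b, c} \<in> triangles D" if "joined D a b" "joined D b c" "joined D a c" "a < b"
      "b < c" for a b c
    using joined_less[OF that(1,4)] joined_less[OF that(2,5)] joined_less[OF that(3)] that
        unfolding triangles_def by force
  have ne: "a \<noteq> b" "b \<noteq> c" "a \<noteq> c" using assms joined_neq by blast+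
  consider "a < b \<and> b < c" | "a < c \<and> c < b" | "b < a \<and> a < c" | "b < c \<and> c < a" |
      "c < a \<and> a < b" | "c < b \<and> b < a"
    using ne by linarith
  thus ?thesis
    using *[of a b c] *[of a c b] *[of b a c] *[of b c a] *[of c a b] *[of c b a] assms joined_sym
    by cases (simp_all add: insert_commute)
qed

lemma Tr_triangle: "Tr j k l \<Longrightarrow> {vtx j, vtx k, vtx l} \<in> triangles D"
  by (rule triangleI) (use Tr_E[of j k l] in \<open>auto simp: E_def\<close>)

text \<open>The triangle is seen from one corner: with the lift \<open>j\<close> of this corner
  fixed, the other two are lifted into the window after \<open>j\<close> and sorted.\<close>

lemma triangle_lift:
  assumes "\<Delta> \<in> triangles D" "vtx j \<in> \<Delta>"
  obtains k l where "Tr j k l" "\<Delta> = {vtx j, vtx k, vtx l}"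
proof -
  obtain a b c where abc: "\<Delta> = {a, b, c}" "(a, b) \<in> D" "(b, c) \<in> D" "(a, c) \<in> D"
    using assms(1) unfolding triangles_def by auto
  obtain y z where yz: "\<Delta> = {vtx j, y, z}" "joined D (vtx j) y" "joined D (vtx j) z" "joined D y z"
    using assms(2) abc unfolding joined_def by blast
  obtain y' z' where l: "j \<le> y'" "y' < j + int s" "vtx y' = y" "j \<le> z'" "z' < j + int s"
      "vtx z' = z"
    using lift_ex[of y j] lift_ex[of z j] joined_neq yz by metis
  have Ej: "E j y'" "E j z'" using l yz by (auto intro!: E_of_joined)
  show ?thesis
  proof (cases "y' \<le> z'")
    case True
    have "E y' z'" by (rule E_of_joined) (use l yz True Ej E_less[OF Ej(1)] in auto)
    thus ?thesis using that[of y' z'] TrI Ej yz l by auto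
  next
    case False
    have "E z' y'" by (rule E_of_joined) (use l yz False Ej joined_sym in auto)
    thus ?thesis using that[of z' y'] TrI Ej yz l by (auto simp: insert_commute)
  qed
qed

lemma Tr_vtx_distinct: "Tr j k l \<Longrightarrow> vtx j \<noteq> vtx k \<and> vtx k \<noteq> vtx l \<and> vtx j \<noteq> vtx l"
  using Tr_less[of j k l] vtx_close by auto

lemma Tr_unique:
  assumes "Tr j k l" "Tr j k' l'" "{vtx j, vtx k, vtx l} = {vtx j, vtx k', vtx l'}"
  shows "k = k' \<and> l = l'"
proof -
  note d = Tr_vtx_distinct[OF assms(1)] Tr_vtx_distinct[OF assms(2)]
  note o = Tr_less[OF assms(1)] Tr_less[OF assms(2)]
  have "vtx k \<in> {vtx j, vtx k', vtx l'}" "vtx l \<in> {vtx j, vtx k', vtx l'}"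
    unfolding assms(3)[symmetric] by auto
  hence "vtx k = vtx k' \<or> vtx k = vtx l'" "vtx l = vtx k' \<or> vtx l = vtx l'" using d by auto
  moreover have "vtx k = vtx k' \<longleftrightarrow> k = k'" "vtx k = vtx l' \<longleftrightarrow> k = l'" "vtx l = vtx k' \<longleftrightarrow> l = k'"
      "vtx l = vtx l' \<longleftrightarrow> l = l'"
    using o by (auto intro!: vtx_close)
  ultimately show ?thesis using o by auto
qed

lemma arc_lifts:
  assumes "e \<in> A"
  obtains u v where "a \<le> u" "u < v" "v < a + int s" "{c1 e, c2 e} = {vtx u, vtx v}" "E u v"
proof -
  obtain u v where uv: "a \<le> u" "u < a + int s" "vtx u = c1 e" "a \<le> v" "v < a + int s" "vtx v = c2 e"
    using lift_ex[OF ends(1)[OF assms], of a] lift_ex[OF ends(2)[OF assms], of a] by metis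
  have J: "joined D (vtx u) (vtx v)" "joined D (vtx v) (vtx u)" using arcD[OF assms]
      uv joined_sym by auto
  hence "u \<noteq> v" using joined_neq by blast
  then consider "u < v" | "v < u" by linarith
  thus ?thesis
  proof cases
    case 1
    thus ?thesis using that[of u v] uv J E_of_joined[of u v] by auto
  next
    case 2
    thus ?thesis using that[of v u] uv J E_of_joined[of v u] by (auto simp: insert_commute)
  qed
qed

lemma finite_arcs [simp]: "finite (arcs a b)"
  unfolding arcs_def using finA by auto

lemma N_nonneg [simp]: "0 \<le> N a b"
  unfolding N_def by simp

lemma arcs_shift [simp]: "arcs (a + int s) (b + int s) = arcs a b"
    "arcs (a - int s) (b - int s) = arcs a b"
proof -
  have "vtx ` {x + int s..y + int s} = vtx ` {x..y}" for x y
  proof -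
    have "vtx ` (\<lambda>z. z + int s) ` {x..y} = vtx ` {x..y}" by (simp only: image_image vtx_shift)
    thus ?thesis by simp
  qed
  from this[of a b] this[of "a - int s" "b - int s"]
  show "arcs (a + int s) (b + int s) = arcs a b" "arcs (a - int s) (b - int s) = arcs a b"
      unfolding arcs_def by simp_all
qed

lemma N_shift [simp]: "N (a + int s) (b + int s) = N a b" "N (a - int s) (b - int s) = N a b"
  unfolding N_def by simp_all

lemma deg_shift [simp]: "deg (a + int s) = deg a" "deg (a - int s) = deg a"
  unfolding deg_def by simp_all

lemma arcs_mono: "a' \<le> a \<Longrightarrow> b \<le> b' \<Longrightarrow> arcs a b \<subseteq> arcs a' b'"
  unfolding arcs_def by auto

lemma N_mono: "a' \<le> a \<Longrightarrow> b \<le> b' \<Longrightarrow> N a b \<le> N a' b'"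
  unfolding N_def by (simp add: card_mono arcs_mono)

text \<open>With arc and interval in one window, membership is a comparison of integers; the
  counting lemmas reduce to this.\<close>

lemma in_arcs:
  assumes "e \<in> A" "{c1 e, c2 e} = {vtx u, vtx v}" "a \<le> u" "u < v" "v < a + int s" "a \<le> p"
      "q < a + int s"
  shows "e \<in> arcs p q \<longleftrightarrow> p \<le> u \<and> v \<le> q"
proof -
  have "e \<in> arcs p q \<longleftrightarrow> {c1 e, c2 e} \<subseteq> vtx ` {p..q}" using assms(1) unfolding arcs_def by auto
  also have "\<dots> \<longleftrightarrow> p \<le> u \<and> u \<le> q \<and> p \<le> v \<and> v \<le> q"
    using in_vtx_image[of a p q u] in_vtx_image[of a p q v] assms(3-7) unfolding assms(2) by auto
  finally show ?thesis using assms(4) by auto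
qed

lemma N_degenerate [simp]: "b \<le> a \<Longrightarrow> N a b = 0"
proof -
  assume ba: "b \<le> a"
  have "arcs a b = {}"
  proof (rule ccontr)
    assume "arcs a b \<noteq> {}"
    then obtain e where e: "e \<in> A" "c1 e \<in> vtx ` {a..b}" "c2 e \<in> vtx ` {a..b}"
        unfolding arcs_def by auto
    have "c1 e = c2 e" using e ba by (cases "a = b") auto
    thus False using joined_neq[OF arcD[OF e(1)]] by auto
  qed
  thus ?thesis unfolding N_def by simp
qed

lemma arcs_Int:
  assumes "a \<le> b" "b \<le> c" "c < a + int s" shows "arcs a b \<inter> arcs b c = {}"
proof (rule ccontr)
  assume "arcs a b \<inter> arcs b c \<noteq> {}"
  then obtain e where e: "e \<in> arcs a b" "e \<in> arcs b c" by auto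
  hence "e \<in> A" unfolding arcs_def by auto
  then obtain u v where uv: "a \<le> u" "u < v" "v < a + int s" "{c1 e, c2 e} = {vtx u, vtx v}"
    using arc_lifts[of e a] by metis
  thus False using in_arcs[of e u v a a b] in_arcs[of e u v a b c] e \<open>e \<in> A\<close> assms by auto
qed

text \<open>An inequality, because an arc may pass over \<open>b\<close>.\<close>

lemma N_add_le:
  assumes "a \<le> b" "b \<le> c" "c < a + int s" shows "N a b + N b c \<le> N a c"
proof -
  have "card (arcs a b) + card (arcs b c) = card (arcs a b \<union> arcs b c)"
    by (simp add: card_Un_disjoint arcs_Int assms)
  also have "\<dots> \<le> card (arcs a c)"
    using arcs_mono[of a a b c] arcs_mono[of a b c c] assms by (intro card_mono) auto
  finally show ?thesis unfolding N_def by simp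
qed

text \<open>Here equality holds, because an arc passing over \<open>k\<close> would cross the chord
  from \<open>k\<close> to \<open>l\<close>, and \<open>l\<close> lies outside the interval. This
  makes weights add up along the fan of a vertex.\<close>

lemma N_split:
  assumes "E l k" "l < a" "a \<le> k" "k \<le> x" "x < l + int s"
  shows "N a x = N a k + N k x"
proof -
  have "arcs a x \<subseteq> arcs a k \<union> arcs k x"
  proof
    fix e assume e: "e \<in> arcs a x"
    hence eA: "e \<in> A" unfolding arcs_def by auto
    obtain u v where uv: "l \<le> u" "u < v" "v < l + int s" "{c1 e, c2 e} = {vtx u, vtx v}" "E u v"
      using arc_lifts[OF eA, of l] by metis
    note i = in_arcs[OF eA uv(4,1-3)]
    have b: "a \<le> u" "v \<le> x" using e i[of a x] assms by auto
    have "\<not> (u < k \<and> k < v)"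
      using E_noncrossing[OF assms(1) uv(5)] b assms by auto
    thus "e \<in> arcs a k \<union> arcs k x" using i[of a k] i[of k x] b assms by auto
  qed
  moreover have "arcs a k \<subseteq> arcs a x" "arcs k x \<subseteq> arcs a x" using arcs_mono assms by auto
  ultimately have "arcs a x = arcs a k \<union> arcs k x" by blast
  moreover have "arcs a k \<inter> arcs k x = {}" by (rule arcs_Int) (use assms in auto)
  ultimately show ?thesis unfolding N_def by (simp add: card_Un_disjoint)
qed

definition star :: "int \<Rightarrow> 'a set" where
  "star v = {e \<in> A. c1 e = vtx v \<or> c2 e = vtx v}"

lemma finite_star [simp]: "finite (star v)"
  unfolding star_def using finA by auto

lemma deg_star: "deg v = int (card (star v))"
  unfolding deg_def star_def by simp

lemma in_star:
  assumes "e \<in> A" "{c1 e, c2 e} = {vtx u, vtx v}" "a \<le> u" "u < v" "v < a + int s" "a \<le> p"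
      "p < a + int s"
  shows "e \<in> star p \<longleftrightarrow> u = p \<or> v = p"
proof -
  have "e \<in> star p \<longleftrightarrow> vtx p \<in> {c1 e, c2 e}" using assms(1) unfolding star_def by auto
  also have "\<dots> \<longleftrightarrow> u = p \<or> v = p"
    using vtx_close[of p u] vtx_close[of p v] assms(3-7) unfolding assms(2) by auto
  finally show ?thesis .
qed

text \<open>An arc either ends at \<open>l\<close> or avoids it. With \<open>r\<close> arcs in total
  this becomes the degree condition at a white vertex.\<close>

lemma deg_N: "deg l + N (l + 1) (l + int s - 1) = int (card A)"
proof -
  have *: "e \<in> star l \<union> arcs (l + 1) (l + int s - 1)" "e \<notin> star l \<inter> arcs (l + 1) (l + int s -
      1)" if eA: "e \<in> A" for e
  proof -
    obtain u v where uv: "l \<le> u" "u < v" "v < l + int s" "{c1 e, c2 e} = {vtx u, vtx v}"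
      using arc_lifts[OF eA, of l] by metis
    show "e \<in> star l \<union> arcs (l + 1) (l + int s - 1)" "e \<notin> star l \<inter> arcs (l + 1) (l + int s - 1)"
      using in_arcs[OF eA uv(4,1-3), of "l+1" "l + int s - 1"] in_star[OF eA uv(4,1-3), of l]
          s2 uv by auto
  qed
  have "A = star l \<union> arcs (l + 1) (l + int s - 1)" using * unfolding star_def arcs_def by blast
  moreover have "star l \<inter> arcs (l + 1) (l + int s - 1) = {}" using * unfolding star_def arcs_def
      by blast
  ultimately have "card A = card (star l) + card (arcs (l + 1) (l + int s - 1))"
    using card_Un_disjoint[of "star l" "arcs (l + 1) (l + int s - 1)"] by simp
  thus ?thesis unfolding deg_star N_def by simp
qed

lemma N_drop_end:
  assumes "k \<le> l" "l < k + int s" shows "N k l \<le> N k (l - 1) + deg l"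
proof -
  have "arcs k l \<subseteq> arcs k (l - 1) \<union> star l"
  proof
    fix e assume e: "e \<in> arcs k l"
    hence eA: "e \<in> A" unfolding arcs_def by auto
    obtain u v where uv: "k \<le> u" "u < v" "v < k + int s" "{c1 e, c2 e} = {vtx u, vtx v}"
      using arc_lifts[OF eA, of k] by metis
    show "e \<in> arcs k (l - 1) \<union> star l"
      using in_arcs[OF eA uv(4,1-3)] in_star[OF eA uv(4,1-3), of l] e assms by auto
  qed
  hence "card (arcs k l) \<le> card (arcs k (l - 1) \<union> star l)" by (intro card_mono) auto
  also have "\<dots> \<le> card (arcs k (l - 1)) + card (star l)" by (rule card_Un_le)
  finally show ?thesis unfolding deg_star N_def by simp
qed

lemma N_drop_start:
  assumes "k \<le> l" "l < k + int s" shows "N k l \<le> deg k + N (k + 1) l"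
proof -
  have "arcs k l \<subseteq> star k \<union> arcs (k + 1) l"
  proof
    fix e assume e: "e \<in> arcs k l"
    hence eA: "e \<in> A" unfolding arcs_def by auto
    obtain u v where uv: "k \<le> u" "u < v" "v < k + int s" "{c1 e, c2 e} = {vtx u, vtx v}"
      using arc_lifts[OF eA, of k] by metis
    show "e \<in> star k \<union> arcs (k + 1) l"
      using in_arcs[OF eA uv(4,1-3)] in_star[OF eA uv(4,1-3), of k] e assms by auto
  qed
  hence "card (arcs k l) \<le> card (star k \<union> arcs (k + 1) l)" by (intro card_mono) auto
  also have "\<dots> \<le> card (star k) + card (arcs (k + 1) l)" by (rule card_Un_le)
  finally show ?thesis unfolding deg_star N_def by simp
qed

text \<open>The differences count the arcs that reach \<open>y\<close> from the interval before it
  and from the interval after it. No arc is counted twice because everything fits into one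
  window.\<close>

lemma N_two_sides:
  assumes "x \<le> y" "y \<le> z" "z < x + int s"
  shows "(N x y - N x (y - 1)) + (N y z - N (y + 1) z) \<le> deg y"
proof -
  have *: "(arcs x y - arcs x (y - 1)) \<union> (arcs y z - arcs (y + 1) z) \<subseteq> star y
     \<and> (arcs x y - arcs x (y - 1)) \<inter> (arcs y z - arcs (y + 1) z) = {}"
  proof -
    have "(e \<in> arcs x y - arcs x (y - 1) \<longrightarrow> e \<in> star y) \<and> (e \<in> arcs y z - arcs (y + 1) z \<longrightarrow> e \<in>
        star y) \<and>
      \<not> (e \<in> arcs x y - arcs x (y - 1) \<and> e \<in> arcs y z - arcs (y + 1) z)" if eA: "e \<in> A" for e
    proof -
      obtain u v where uv: "x \<le> u" "u < v" "v < x + int s" "{c1 e, c2 e} = {vtx u, vtx v}"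
        using arc_lifts[OF eA, of x] by metis
      show ?thesis using in_arcs[OF eA uv(4,1-3), of x y] in_arcs[OF eA uv(4,1-3), of x "y - 1"]
        in_arcs[OF eA uv(4,1-3), of y z] in_arcs[OF eA uv(4,1-3), of "y + 1" z]
        in_star[OF eA uv(4,1-3), of y] assms uv(2) by auto
    qed
    thus ?thesis unfolding arcs_def by blast
  qed
  have sub: "arcs x (y - 1) \<subseteq> arcs x y" "arcs (y + 1) z \<subseteq> arcs y z" by (intro arcs_mono, simp_all)+
  have "card (arcs x y - arcs x (y - 1)) + card (arcs y z - arcs (y + 1) z)
      = card ((arcs x y - arcs x (y - 1)) \<union> (arcs y z - arcs (y + 1) z))"
    using * by (subst card_Un_disjoint) auto
  also have "\<dots> \<le> card (star y)" using * by (intro card_mono) auto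
  finally have "card (arcs x y - arcs x (y - 1)) + card (arcs y z - arcs (y + 1) z) \<le> card (star
      y)" .
  moreover have "card (arcs x y - arcs x (y - 1)) = card (arcs x y) - card (arcs x (y - 1))"
    "card (arcs y z - arcs (y + 1) z) = card (arcs y z) - card (arcs (y + 1) z)"
    using sub by (auto intro: card_Diff_subset)
  moreover have "card (arcs x (y - 1)) \<le> card (arcs x y)" "card (arcs (y + 1) z) \<le> card (arcs y z)"
    using sub by (auto intro: card_mono)
  ultimately show ?thesis unfolding deg_star N_def by linarith
qed

text \<open>Arcs run along chords of \<open>D\<close>, so none crosses a side of the triangle, and
  each belongs to exactly one side, beyond it or along it. This becomes the degree condition at a
  triangle.\<close>

lemma N_Tr:
  assumes "Tr j k l" shows "N j k + N k l + N l (j + int s) = int (card A)"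
proof -
  note o = Tr_less[OF assms] and EE = Tr_E[OF assms]
  have d: "deg j + N (j + 1) (j + int s - 1) = int (card A)" by (rule deg_N)
  have *: "(e \<in> arcs j k \<or> e \<in> arcs k l \<or> e \<in> arcs l (j + int s)) \<and> \<not> (e \<in> arcs j k \<and> e \<in> arcs k
      l) \<and>
     \<not> (e \<in> arcs j k \<and> e \<in> arcs l (j + int s)) \<and> \<not> (e \<in> arcs k l \<and> e \<in> arcs l (j + int s))"
         if eA: "e \<in> A" for e
  proof -
    obtain u v where uv: "j \<le> u" "u < v" "v < j + int s" "{c1 e, c2 e} = {vtx u, vtx v}" "E u v"
      using arc_lifts[OF eA, of j] by metis
    note i = in_arcs[OF eA uv(4,1-3), of j k] in_arcs[OF eA uv(4,1-3), of k l]
    \<comment> \<open>The third interval reaches \<open>j + s\<close>, which lies outside the window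
      starting at \<open>j\<close>; an arc at \<open>j\<close> is therefore lifted to end at
      \<open>j + s\<close> instead.\<close>
    have i3: "e \<in> arcs l (j + int s) \<longleftrightarrow> l \<le> u \<or> (u = j \<and> l \<le> v)"
    proof (cases "u = j")
      case True
      have "{c1 e, c2 e} = {vtx v, vtx (j + int s)}" using uv(4) True by auto
      from in_arcs[OF eA this, of "j + 1" l "j + int s"] show ?thesis using True uv o by auto
    next
      case False
      from in_arcs[OF eA uv(4), of "j + 1" l "j + int s"] show ?thesis using False uv o by auto
    qed
    have "\<not> (u < k \<and> k < v \<and> j < u)" "\<not> (u < l \<and> l < v \<and> j < u)"
      using E_noncrossing[OF EE(1) uv(5)] E_noncrossing[OF EE(3) uv(5)] uv(3) by blast+
    moreover have "\<not> (u < k \<and> k < v \<and> v < l)" using E_noncrossing[OF uv(5) EE(2)] uv o by auto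
    moreover have "u = j \<or> j < u" using uv(1) by auto
    ultimately show ?thesis using i i3 uv(1-3) o by (elim disjE) auto
  qed
  have sub: "arcs a b \<subseteq> A" for a b unfolding arcs_def by auto
  have "A = arcs j k \<union> (arcs k l \<union> arcs l (j + int s))" using * sub by blast
  moreover have "arcs j k \<inter> (arcs k l \<union> arcs l (j + int s)) = {}"
      "arcs k l \<inter> arcs l (j + int s) = {}"
    using * sub by blast+
  ultimately have "card A = card (arcs j k) + (card (arcs k l) + card (arcs l (j + int s)))"
    by (metis card_Un_disjoint finite_Un finite_arcs)
  thus ?thesis unfolding N_def by simp
qed

lemma vtx_Suc: "vtx (a + 1) = vtx a mod s + 1"
proof -
  have "vtx (int (vtx a)) = vtx a" using vtx_of_nat[OF vtx_range] .
  hence "vtx (int (vtx a) + 1) = vtx (a + 1)" unfolding vtx_eq_iff by (simp add: vtx_eq_iff)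
  moreover have "vtx (int w + 1) = w mod s + 1" if "1 \<le> w" "w \<le> s" for w
    using vtx_small[of "int w + 1"] vtx_small2[of "int w + 1"] that s2
    by (cases "w = s") (auto simp: nat_add_distrib)
  hence "vtx (int (vtx a) + 1) = vtx a mod s + 1" by simp
  ultimately show ?thesis by simp
qed

text \<open>Neighbouring claws are joined by a short arc, so two consecutive polygon vertices
  already contribute.\<close>

lemma N_pos:
  assumes "a < b" shows "1 \<le> N a b"
proof -
  obtain e where e: "e \<in> A" "{c1 e, c2 e} = {vtx a, vtx a mod s + 1}"
      using sides[OF vtx_range[of a]] by auto
  note vtx_Suc[of a]
  moreover have "vtx a \<in> vtx ` {a..b}" "vtx (a + 1) \<in> vtx ` {a..b}" using assms by auto
  ultimately have "e \<in> arcs a b" using e unfolding arcs_def by (auto simp: doubleton_eq_iff)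
  hence "card (arcs a b) \<noteq> 0" by (metis card_0_eq empty_iff finite_arcs)
  hence "0 < card (arcs a b)" by blast
  thus ?thesis unfolding N_def by linarith
qed

text \<open>Every arc lies on one side of the chord; arcs along the chord itself count twice, hence
  only an inequality.\<close>

lemma N_complement:
  assumes "E x v" shows "int (card A) \<le> N (v - int s) x + N x v"
proof -
  have *: "e \<in> arcs x v \<or> e \<in> arcs v (x + int s)" if eA: "e \<in> A" for e
  proof -
    obtain u w where uv: "x \<le> u" "u < w" "w < x + int s" "{c1 e, c2 e} = {vtx u, vtx w}" "E u w"
      using arc_lifts[OF eA, of x] by metis
    have o: "x < v" "v < x + int s" using E_less[OF assms] by auto
    have i3: "e \<in> arcs v (x + int s) \<longleftrightarrow> v \<le> u \<or> (u = x \<and> v \<le> w)"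
    proof (cases "u = x")
      case True
      have "{c1 e, c2 e} = {vtx w, vtx (x + int s)}" using uv(4) True by auto
      from in_arcs[OF eA this, of "x + 1" v "x + int s"] show ?thesis using True uv o by auto
    next
      case False
      from in_arcs[OF eA uv(4), of "x + 1" v "x + int s"] show ?thesis using False uv o by auto
    qed
    have "\<not> (x < u \<and> u < v \<and> v < w)" using E_noncrossing[OF assms uv(5)] uv by auto
    thus ?thesis using in_arcs[OF eA uv(4,1-3), of x v] i3 o uv(1-3) by auto
  qed
  have "A \<subseteq> arcs x v \<union> arcs v (x + int s)" using * by auto
  hence "card A \<le> card (arcs x v \<union> arcs v (x + int s))" by (intro card_mono) auto
  also have "\<dots> \<le> card (arcs x v) + card (arcs v (x + int s))" by (rule card_Un_le)
  finally have "int (card A) \<le> N x v + N v (x + int s)" unfolding N_def by simp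
  thus ?thesis using N_shift(2)[of v "x + int s"] by simp
qed

section \<open>The fan of triangles at a vertex\<close>

definition nbrs :: "int \<Rightarrow> int list" where
  "nbrs v = filter (E v) [v + 1..v + int s - 1]"

definition wedges :: "int \<Rightarrow> (int \<times> int) list" where
  "wedges v = zip (nbrs v) (tl (nbrs v))"

text \<open>Turns the wrapped list in the definition of \<open>fan\<close> into a single integer
  interval.\<close>

lemma map_vtx_upto: "map vtx [v + 1..v + int s - 1] = [vtx v + 1..<s + 1] @ [1..<vtx v]"
proof (rule nth_equalityI)
  have "length ([w + 1..<s + 1] @ [1..<w]) = nat (int s - 1)" if "1 \<le> w" "w \<le> s" for w
      using that by auto
  from this[of "vtx v"]
  show "length (map vtx [v + 1..v + int s - 1]) = length ([vtx v + 1..<s + 1] @ [1..<vtx v])"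
    by simp
  fix n assume "n < length (map vtx [v + 1..v + int s - 1])"
  hence n: "n < s - 1" by auto
  define w where "w = vtx v"
  have w: "1 \<le> w" "w \<le> s" unfolding w_def by simp_all
  have "int s dvd v - int w" using vtx_eq_iff[of v "int w"] vtx_of_nat[of w] w unfolding w_def
      by auto
  hence "vtx (v + 1 + int n) = vtx (int w + 1 + int n)" unfolding vtx_eq_iff
      by (simp add: algebra_simps)
  also have "\<dots> = (if w + 1 + n \<le> s then w + 1 + n else w + 1 + n - s)"
    using vtx_small[of "int w + 1 + int n"] vtx_small2[of "int w + 1 + int n"] w n by auto
  also have "\<dots> = ([w + 1..<s + 1] @ [1..<w]) ! n"
    using w n by (auto simp: nth_append)
  finally show "map vtx [v + 1..v + int s - 1] ! n = ([vtx v + 1..<s + 1] @ [1..<vtx v]) ! n"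
    using n s2 unfolding w_def by (simp add: nth_upto)
qed

lemma map_vtx_nbrs: "filter (joined D (vtx v)) ([vtx v + 1..<s + 1]
    @ [1..<vtx v]) = map vtx (nbrs v)"
proof -
  have "filter (joined D (vtx v)) (map vtx [v + 1..v + int s - 1]) = map vtx (filter (E v) [v +
      1..v + int s - 1])"
    unfolding filter_map o_def by (intro arg_cong[where f = "map vtx"]
        filter_cong) (auto simp: E_def)
  thus ?thesis unfolding map_vtx_upto nbrs_def .
qed

lemma fan_eq: "fan s D (vtx v) = map (\<lambda>(x, y). {vtx v, vtx x, vtx y}) (wedges v)"
  unfolding fan_def wedges_def Let_def map_vtx_nbrs map_tl[symmetric] zip_map_map
      by (simp add: case_prod_beta')

lemma set_nbrs: "set (nbrs v) = {x. E v x}"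
  unfolding nbrs_def using E_less by fastforce

lemma nbrs_sorted: "sorted_wrt (<) (nbrs v)"
  unfolding nbrs_def by (intro sorted_wrt_filter) (simp add: sorted_wrt_upto)

lemma nbrs_nth_mono: "i < j \<Longrightarrow> j < length (nbrs v) \<Longrightarrow> nbrs v ! i < nbrs v ! j"
  using nbrs_sorted sorted_wrt_nth_less by blast

lemma nbrs_nth_E: "i < length (nbrs v) \<Longrightarrow> E v (nbrs v ! i)"
  using set_nbrs nth_mem by blast

lemma nbrs_ends: "nbrs v \<noteq> []" "nbrs v ! 0 = v + 1" "last (nbrs v) = v + int s - 1"
proof -
  have 1: "v + 1 \<in> set (nbrs v)" "v + int s - 1 \<in> set (nbrs v)"
    using E_side[of v] E_rev(1)[OF E_side[of "v - 1"]] unfolding set_nbrs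
        by (auto simp: algebra_simps)
  thus ne: "nbrs v \<noteq> []" by auto
  have b: "v + 1 \<le> x \<and> x \<le> v + int s - 1" if "x \<in> set (nbrs v)" for x
    using E_less that unfolding set_nbrs by force
  obtain i where i: "i < length (nbrs v)" "nbrs v ! i = v + 1" using 1
      by (auto simp: in_set_conv_nth)
  have "v + 1 \<le> nbrs v ! 0" using b nth_mem ne by blast
  thus "nbrs v ! 0 = v + 1" using nbrs_nth_mono[of 0 i v] i by (cases "i = 0") auto
  obtain k where k: "k < length (nbrs v)" "nbrs v ! k = v + int s - 1" using 1
      by (auto simp: in_set_conv_nth)
  have "last (nbrs v) \<le> v + int s - 1" using b last_in_set ne by blast
  moreover have "last (nbrs v) = nbrs v ! (length (nbrs v) - 1)" using ne
      by (simp add: last_conv_nth)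
  moreover have "k = length (nbrs v) - 1 \<or> k < length (nbrs v) - 1"
      "length (nbrs v) - 1 < length (nbrs v)" using k by linarith+
  hence "nbrs v ! k \<le> nbrs v ! (length (nbrs v) - 1)"
    using nbrs_nth_mono[of k "length (nbrs v) - 1" v] k by auto
  ultimately show "last (nbrs v) = v + int s - 1" using k by linarith
qed

lemma length_wedges: "length (wedges v) = length (nbrs v) - 1"
  unfolding wedges_def by simp

lemma wedges_nth: "t < length (wedges v) \<Longrightarrow> wedges v ! t = (nbrs v ! t, nbrs v ! Suc t)"
  unfolding wedges_def by (simp add: nth_tl)

text \<open>The apex of \<open>v y\<close> is a neighbour of \<open>v\<close> before
  \<open>y\<close>, hence at most \<open>x\<close>; it is not before \<open>x\<close>, as its chord
  to \<open>y\<close> would then cross \<open>v x\<close>. Conversely, a neighbour of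
  \<open>v\<close> between \<open>x\<close> and \<open>y\<close> would give a chord crossing
  \<open>x y\<close>.\<close>

lemma set_wedges: "(x, y) \<in> set (wedges v) \<longleftrightarrow> Tr v x y"
proof
  assume "(x, y) \<in> set (wedges v)"
  then obtain t where t: "t < length (wedges v)" "wedges v ! t = (x, y)"
      by (auto simp: in_set_conv_nth)
  hence xy: "x = nbrs v ! t" "y = nbrs v ! Suc t" "Suc t < length (nbrs v)"
      using wedges_nth length_wedges by auto
  have E: "E v x" "E v y" "x < y" using nbrs_nth_E[of t v] nbrs_nth_E[of "Suc t" v]
      nbrs_nth_mono[of t "Suc t" v] xy by auto
  have "v + 1 < y" using E E_less[OF E(1)] by auto
  then obtain b where b: "v < b" "b < y" "E v b" "E b y" using E_apex[OF E(2)] by metis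
  obtain i where i: "i < length (nbrs v)" "nbrs v ! i = b" using b set_nbrs in_set_conv_nth
      by (metis mem_Collect_eq)
  have "\<not> Suc t < i" "i \<noteq> Suc t" using nbrs_nth_mono[of "Suc t" i v] i xy b by auto
  hence "i \<le> t" by linarith
  hence "b \<le> x" using nbrs_nth_mono[of i t v] i xy by (cases "i = t") auto
  moreover have "\<not> b < x" using E_noncrossing[OF E(1) b(4)] b E E_less[OF E(2)] by auto
  ultimately have "E x y" using b by auto
  thus "Tr v x y" using TrI E by auto
next
  assume T: "Tr v x y"
  note E = Tr_E[OF T] and o = Tr_less[OF T]
  obtain i where i: "i < length (nbrs v)" "nbrs v ! i = x" using E set_nbrs in_set_conv_nth
      by (metis mem_Collect_eq)
  obtain j where j: "j < length (nbrs v)" "nbrs v ! j = y" using E set_nbrs in_set_conv_nth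
      by (metis mem_Collect_eq)
  have "\<not> j < i" "i \<noteq> j" using nbrs_nth_mono[of j i v] i j o by auto
  hence "i < j" by linarith
  moreover have "\<not> Suc i < j"
  proof
    assume s: "Suc i < j"
    have "x < nbrs v ! Suc i" "nbrs v ! Suc i < y" using nbrs_nth_mono[of i "Suc i" v]
        nbrs_nth_mono[of "Suc i" j v] s i j by auto
    moreover have "E v (nbrs v ! Suc i)" using nbrs_nth_E s j by auto
    ultimately show False using E_noncrossing[of v "nbrs v ! Suc i" x y] E o by auto
  qed
  ultimately have "j = Suc i" by auto
  hence "wedges v ! i = (x, y)" "i < length (wedges v)" using wedges_nth[of i v]
      length_wedges[of v] i j by auto
  thus "(x, y) \<in> set (wedges v)" by (metis nth_mem)
qed

text \<open>The weights telescope: every neighbour is joined to \<open>v\<close>, which precedes the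
  interval, so \<open>N_split\<close> applies at each of them.\<close>

lemma sum_wedges_take:
  "t < length (nbrs v) \<Longrightarrow> sum_list (map (\<lambda>(x, y). N x y) (take t (wedges v))) = N (v + 1) (nbrs v
      ! t)"
proof (induction t)
  case 0
  thus ?case using nbrs_ends(2) by simp
next
  case (Suc t)
  hence t: "t < length (wedges v)" using length_wedges by auto
  have "nbrs v ! t < nbrs v ! Suc t" "E v (nbrs v ! t)" "E v (nbrs v ! Suc t)"
    using nbrs_nth_mono[of t "Suc t" v] nbrs_nth_E Suc by auto
  hence "N (v + 1) (nbrs v ! Suc t) = N (v + 1) (nbrs v ! t) + N (nbrs v ! t) (nbrs v ! Suc t)"
    using N_split[of v "nbrs v ! t" "v + 1" "nbrs v ! Suc t"] E_less[of v "nbrs v ! t"]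
        E_less[of v "nbrs v ! Suc t"] by auto
  thus ?case using Suc t by (simp add: take_Suc_conv_app_nth wedges_nth)
qed

lemma sum_wedges: "sum_list (map (\<lambda>(x, y). N x y) (wedges v)) = N (v + 1) (v + int s - 1)"
proof -
  have "length (nbrs v) - 1 < length (nbrs v)" using nbrs_ends(1) by simp
  from sum_wedges_take[OF this] show ?thesis
    using nbrs_ends(1,3)[of v] by (simp add: last_conv_nth length_wedges)
qed

lemma distinct_wedges: "distinct (wedges v)"
proof -
  have "distinct (nbrs v)" unfolding nbrs_def by simp
  thus ?thesis unfolding wedges_def by (simp add: distinct_zipI1)
qed

lemma distinct_fan: "distinct (fan s D (vtx v))"
  unfolding fan_eq distinct_map
proof (intro conjI distinct_wedges inj_onI)
  fix p q assume "p \<in> set (wedges v)" "q \<in> set (wedges v)"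
    "(case p of (x, y) \<Rightarrow> {vtx v, vtx x, vtx y}) = (case q of (x, y) \<Rightarrow> {vtx v, vtx x, vtx y})"
  moreover obtain x y x' y' where "p = (x, y)" "q = (x', y')" by (cases p; cases q) auto
  ultimately have "Tr v x y" "Tr v x' y'" "{vtx v, vtx x, vtx y} = {vtx v, vtx x', vtx y'}"
      "p = (x, y)" "q = (x', y')"
    using set_wedges by auto
  thus "p = q" using Tr_unique[of v x y x' y'] by simp
qed

lemma set_fan: "set (fan s D (vtx v)) = {\<Delta> \<in> triangles D. vtx v \<in> \<Delta>}"
proof -
  have "\<Delta> \<in> set (fan s D (vtx v)) \<longleftrightarrow> \<Delta> \<in> triangles D \<and> vtx v \<in> \<Delta>" for \<Delta>
  proof
    assume "\<Delta> \<in> set (fan s D (vtx v))"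
    then obtain x y where "\<Delta> = {vtx v, vtx x, vtx y}" "Tr v x y" unfolding fan_eq
        using set_wedges by auto
    thus "\<Delta> \<in> triangles D \<and> vtx v \<in> \<Delta>" using Tr_triangle by auto
  next
    assume "\<Delta> \<in> triangles D \<and> vtx v \<in> \<Delta>"
    then obtain x y where "Tr v x y" "\<Delta> = {vtx v, vtx x, vtx y}" using triangle_lift by metis
    thus "\<Delta> \<in> set (fan s D (vtx v))" unfolding fan_eq using set_wedges by force
  qed
  thus ?thesis by auto
qed

text \<open>In natural numbers the region beyond the side \<open>x y\<close> may wrap around
  \<open>s\<close>, whence the case distinction in \<open>cut_off\<close>. The three cases here say
  how many of \<open>x\<close>, \<open>y\<close> lie past \<open>s\<close> after a shift.\<close>

lemma cut_off_Tr:
  assumes "Tr v x y"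
  shows "cut_off s (vtx v) (Min ({vtx v, vtx x, vtx y} - {vtx v})) (Max ({vtx v, vtx x, vtx y} -
      {vtx v})) = vtx ` {x..y}"
proof -
  obtain k where k: "1 \<le> v + k * int s" "v + k * int s \<le> int s" by (rule base_shift)
  define v' x' y' where d: "v' = v + k * int s" "x' = x + k * int s" "y' = y + k * int s"
  have o: "1 \<le> v'" "v' \<le> int s" "v' < x'" "x' < y'" "y' < v' + int s" using Tr_less[OF assms] k
      unfolding d by auto
  have e: "vtx v = vtx v'" "vtx x = vtx x'" "vtx y = vtx y'" unfolding d by auto
  have "{x'..y'} = (\<lambda>z. z + k * int s) ` {x..y}" unfolding d by simp
  hence e2: "vtx ` {x..y} = vtx ` {x'..y'}" by (simp only: image_image vtx_shift_mult)
  have ne: "vtx x' \<noteq> vtx v'" "vtx y' \<noteq> vtx v'" using Tr_vtx_distinct[OF assms] e by auto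
  hence "{vtx v', vtx x', vtx y'} - {vtx v'} = {vtx x', vtx y'}" by auto
  hence mm: "Min ({vtx v', vtx x', vtx y'} - {vtx v'}) = min (vtx x') (vtx y')"
      "Max ({vtx v', vtx x', vtx y'} - {vtx v'}) = max (vtx x') (vtx y')"
    by simp_all
  have red: "int (vtx z) = (if z \<le> int s then z else z - int s)" if "1 \<le> z" "z \<le> 2 * int s" for z
    using vtx_small[of z] vtx_small2[of z] that by auto
  have r: "int (vtx v') = v'" "int (vtx x') = (if x' \<le> int s then x' else x' - int s)"
      "int (vtx y') = (if y' \<le> int s then y' else y' - int s)"
    using red[of v'] red[of x'] red[of y'] o by auto
  have mem: "u \<in> vtx ` {x'..y'} \<longleftrightarrow> (x' \<le> int u \<and> int u \<le> y') \<or> (x' \<le> int u + int s \<and> int u + int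
      s \<le> y')" if u: "u \<in> {1..s}" for u
  proof
    assume "u \<in> vtx ` {x'..y'}"
    then obtain z where z: "u = vtx z" "x' \<le> z" "z \<le> y'" by auto
    thus "(x' \<le> int u \<and> int u \<le> y') \<or> (x' \<le> int u + int s \<and> int u + int s \<le> y')"
      using red[of z] o by (auto split: if_splits)
  next
    assume "(x' \<le> int u \<and> int u \<le> y') \<or> (x' \<le> int u + int s \<and> int u + int s \<le> y')"
    moreover have "u = vtx (int u)" "u = vtx (int u + int s)" using vtx_of_nat[OF u] by auto
    ultimately show "u \<in> vtx ` {x'..y'}" by (metis atLeastAtMost_iff imageI)
  qed
  have "u \<in> cut_off s (vtx v') (min (vtx x') (vtx y')) (max (vtx x') (vtx y')) \<longleftrightarrow> u \<in> vtx `
      {x'..y'}" for u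
  proof (cases "u \<in> {1..s}")
    case True
    have "u \<in> cut_off s (vtx v') p q \<longleftrightarrow> (if p < vtx v' \<and> vtx v' < q then u \<le> p \<or> q \<le> u else p \<le> u
        \<and> u \<le> q)" for p q
      using True unfolding cut_off_def by auto
    moreover consider "y' \<le> int s" | "x' \<le> int s" "int s < y'" | "int s < x'" by linarith
    hence "(if min (vtx x') (vtx y') < vtx v' \<and> vtx v' < max (vtx x') (vtx y') then u \<le> min (vtx
        x') (vtx y') \<or> max (vtx x') (vtx y') \<le> u
        else min (vtx x') (vtx y') \<le> u \<and> u \<le> max (vtx x') (vtx y'))
       \<longleftrightarrow> (x' \<le> int u \<and> int u \<le> y') \<or> (x' \<le> int u + int s \<and> int u + int s \<le> y')"
    proof cases
      case 1
      have "int (vtx v') < int (vtx x')" "int (vtx x') < int (vtx y')" using r o 1 by auto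
      moreover have "x' = int (vtx x')" "y' = int (vtx y')" using r o 1 by auto
      ultimately show ?thesis using True o 1 by auto
    next
      case 2
      have "int (vtx y') < int (vtx v')" "int (vtx v') < int (vtx x')" using r o 2 by auto
      moreover have "x' = int (vtx x')" "y' = int (vtx y') + int s" using r o 2 by auto
      ultimately show ?thesis using True o 2 by auto
    next
      case 3
      have "int (vtx y') < int (vtx v')" "int (vtx x') < int (vtx y')" using r o 3 by auto
      moreover have "x' = int (vtx x') + int s" "y' = int (vtx y') + int s" using r o 3 by auto
      ultimately show ?thesis using True o 3 by auto
    qed
    ultimately show ?thesis unfolding mem[OF True] by blast
  next
    case False
    have "vtx x' \<in> {1..s}" "vtx y' \<in> {1..s}" using vtx_range by blast+
    hence "min (vtx x') (vtx y') \<in> {1..s}" "max (vtx x') (vtx y') \<in> {1..s}"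
        by (auto simp: min_def max_def)
    hence "cut_off s (vtx v') (min (vtx x') (vtx y')) (max (vtx x') (vtx y')) \<subseteq> {1..s}"
        unfolding cut_off_def by auto
    moreover have "vtx ` {x'..y'} \<subseteq> {1..s}" using vtx_range by blast
    ultimately show ?thesis using False by blast
  qed
  thus ?thesis unfolding e e2 mm by blast
qed

section \<open>Counting chords and triangles\<close>

lemma finite_D: "finite D"
  by (rule finite_subset[of _ "{1..s} \<times> {1..s}"]) (use Dchords in \<open>auto simp: chords_def\<close>)

lemma E_int: "a \<in> {1..s} \<Longrightarrow> b \<in> {1..s} \<Longrightarrow> E (int a) (int b) \<longleftrightarrow> (a, b) \<in> D"
  using vtx_of_nat Dchords unfolding E_def joined_def chords_def by auto

lemma triangles_3: "triangles D = (\<lambda>(a, b, c). {a, b, c}) ` {(a, b, c). (a, b) \<in> D \<and> (b, c) \<in> D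
    \<and> (a, c) \<in> D}"
  unfolding triangles_def by (auto simp: image_iff)

lemma finite_triangles: "finite (triangles D)"
proof -
  have "{(a, b, c). (a, b) \<in> D \<and> (b, c) \<in> D \<and> (a, c) \<in> D} \<subseteq> {1..s} \<times> {1..s} \<times> {1..s}"
    using Dchords by (auto simp: chords_def)
  from finite_subset[OF this] show ?thesis unfolding triangles_3 by (intro finite_imageI) simp
qed

text \<open>Every chord but \<open>(1, s)\<close> is one of the two short sides of a unique triangle.\<close>

lemma card_chords: "card D = 2 * card (triangles D) + 1"
proof -
  define T where "T = {(a, b, c). (a, b) \<in> D \<and> (b, c) \<in> D \<and> (a, c) \<in> D}"
  have lt: "a < b \<and> a \<in> {1..s} \<and> b \<in> {1..s}" if "(a, b) \<in> D" for a b using that Dchords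
      by (auto simp: chords_def)
  have nc: False if "(a, c) \<in> D" "(b, d) \<in> D" "a < b" "b < c" "c < d" for a b c d
    using that Dnc unfolding noncrossing_def by fastforce
  have finT: "finite T" unfolding T_def
    by (rule finite_subset[of _ "{1..s} \<times> {1..s} \<times> {1..s}"]) (auto dest: lt)
  have inj0: "inj_on (\<lambda>(a, b, c). {a, b, c}) T"
  proof (rule inj_onI)
    fix p q assume pq: "p \<in> T" "q \<in> T" "(case p of (a, b, c) \<Rightarrow> {a, b, c}) = (case q of (a, b, c)
        \<Rightarrow> {a, b, c})"
    obtain a b c a' b' c' where e: "p = (a, b, c)" "q = (a', b', c')" by (cases p; cases q) auto
    hence h: "(a, b, c) \<in> T" "(a', b', c') \<in> T" "{a, b, c} = {a', b', c'}" using pq by auto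
    have "a < b" "b < c" "a' < b'" "b' < c'" using h lt unfolding T_def by auto
    hence "sorted_wrt (<) [a, b, c]" "sorted_wrt (<) [a', b', c']" "set [a', b', c']
        = set [a, b, c]" using h(3) by auto
    hence "[a', b', c'] = [a, b, c]" by (rule strict_sorted_equal)
    thus "p = q" using e by simp
  qed
  have 0: "card (triangles D) = card T" unfolding triangles_3 T_def[symmetric]
      by (rule card_image[OF inj0])
  have inj1: "inj_on (\<lambda>(a, b, c). (a, b)) T"
  proof (rule inj_onI, clarsimp)
    fix a b c c' assume h: "(a, b, c) \<in> T" "(a, b, c') \<in> T"
    hence "(a, c) \<in> D" "(b, c') \<in> D" "(a, c') \<in> D" "(b, c) \<in> D" "a < b" "b < c" "b < c'"
        using lt unfolding T_def by auto
    hence "\<not> c < c'" "\<not> c' < c" using nc[of a c b c'] nc[of a c' b c] by blast+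
    thus "c = c'" by simp
  qed
  have inj2: "inj_on (\<lambda>(a, b, c). (b, c)) T"
  proof (rule inj_onI, clarsimp)
    fix a a' b c assume h: "(a, b, c) \<in> T" "(a', b, c) \<in> T"
    hence "(a, c) \<in> D" "(a', b) \<in> D" "(a, b) \<in> D" "(a', c) \<in> D" "a < b" "b < c" "a' < b"
        using lt unfolding T_def by auto
    hence "\<not> a < a'" "\<not> a' < a" using nc[of a b a' c] nc[of a' b a c] by blast+
    thus "a = a'" by simp
  qed
  \<comment> \<open>If \<open>(a, b)\<close> were a short side both of \<open>a < b < c\<close> and
    of \<open>d < a < b\<close>, then \<open>(d, b)\<close> would cross
    \<open>(a, c)\<close>.\<close>
  have disj: "(\<lambda>(a, b, c). (a, b)) ` T \<inter> (\<lambda>(a, b, c). (b, c)) ` T = {}"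
  proof (rule ccontr)
    assume "\<not> ?thesis"
    then obtain a b c d where h: "(a, b, c) \<in> T" "(d, a, b) \<in> T" by auto
    hence "(d, b) \<in> D" "(a, c) \<in> D" "d < a" "a < b" "b < c" using lt unfolding T_def by auto
    thus False using nc[of d b a c] by blast
  qed
  have 1: "(1, s) \<in> D"
  proof -
    have "E (int s - int s) (1 + int s - int s)" by (rule E_shift(2)[THEN iffD2]) (use E_side[of
        "int s"] in \<open>simp add: add.commute\<close>)
    hence "E (1 + int s - int s) (int s - int s + int s)" by (rule E_rev(1))
    thus ?thesis using E_int[of 1 s] s2 by auto
  qed
  have "(\<lambda>(a, b, c). (a, b)) ` T \<union> (\<lambda>(a, b, c). (b, c)) ` T = D - {(1, s)}"
  proof
    show "(\<lambda>(a, b, c). (a, b)) ` T \<union> (\<lambda>(a, b, c). (b, c)) ` T \<subseteq> D - {(1, s)}"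
      unfolding T_def using lt by fastforce
    show "D - {(1, s)} \<subseteq> (\<lambda>(a, b, c). (a, b)) ` T \<union> (\<lambda>(a, b, c). (b, c)) ` T"
    proof
      fix e assume "e \<in> D - {(1, s)}"
      then obtain a b where e: "e = (a, b)" "(a, b) \<in> D" "(a, b) \<noteq> (1, s)" by (cases e) auto
      have ab: "a < b" "1 \<le> a" "b \<le> s" using lt[OF e(2)] by auto
      have "E (int a) (int b)" using E_int lt[OF e(2)] e by auto
      \<comment> \<open>The apex is sought on the other side of the chord, between \<open>b\<close>
        and \<open>a + s\<close>. It is the third corner, which comes after \<open>b\<close> if it
        does not wrap and before \<open>a\<close> if it does. Only for \<open>(1, s)\<close> is
        there no vertex on this side.\<close>
      hence "E (int b) (int a + int s)" by (rule E_rev)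
      moreover have "int b + 1 < int a + int s" using e ab by auto
      ultimately obtain z where z: "int b < z" "z < int a + int s" "E (int b) z"
          "E z (int a + int s)" by (rule E_apex)
      show "e \<in> (\<lambda>(a, b, c). (a, b)) ` T \<union> (\<lambda>(a, b, c). (b, c)) ` T"
      proof (cases "z \<le> int s")
        case True
        define c where "c = nat z"
        have c: "z = int c" "c \<in> {1..s}" "b < c" using z True ab unfolding c_def by auto
        have "(b, c) \<in> D" using z(3) E_int c lt[OF e(2)] by auto
        moreover have "(a, c) \<in> D" using E_rev(2)[OF z(4)] E_int c lt[OF e(2)] by auto
        ultimately have "(a, b, c) \<in> T" using e unfolding T_def by auto
        thus ?thesis using e by force
      next
        case False
        define c where "c = nat (z - int s)"
        have c: "z = int c + int s" "c \<in> {1..s}" "c < a" using z False ab unfolding c_def by auto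
        have "(c, b) \<in> D" using E_rev(2)[OF z(3)] E_int c lt[OF e(2)] by auto
        moreover have "(c, a) \<in> D" using z(4) E_int c lt[OF e(2)] by auto
        ultimately have "(c, a, b) \<in> T" using e unfolding T_def by auto
        thus ?thesis using e by force
      qed
    qed
  qed
  hence "card (D - {(1, s)}) = card T + card T"
    using card_Un_disjoint[OF finite_imageI[OF finT] finite_imageI[OF finT] disj]
        card_image[OF inj1] card_image[OF inj2] by simp
  moreover have "card D = card (D - {(1, s)}) + 1" using card_Suc_Diff1[OF finite_D 1] by simp
  ultimately show ?thesis using 0 by simp
qed

end

section \<open>Claws of a noncrossing matching\<close>

locale noncrossing_matching =
  fixes r :: nat and M :: "(nat \<times> nat) set"
  assumes r1: "1 \<le> r" and pm: "perfect_matching (2 * r) M" and ncM: "noncrossing M"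
begin

abbreviation "n \<equiv> 2 * r"
abbreviation "I \<equiv> short_starts r M"
abbreviation "s \<equiv> num_claws r M"

definition sc :: "nat \<Rightarrow> nat" where
  "sc i = (if i = 2 * r then 1 else i + 1)"

text \<open>Counts the short starts below \<open>k\<close>. The count 0 is read as \<open>s\<close>,
  because the last claw wraps around the end of the boundary.\<close>

definition cl :: "nat \<Rightarrow> nat" where
  "cl k = (let j = length (filter (\<lambda>i. i < k) I) in if j = 0 then s else j)"

lemma M_bounds: "(a, b) \<in> M \<Longrightarrow> 1 \<le> a \<and> a < b \<and> b \<le> n"
  using pm unfolding perfect_matching_def chords_def by auto

lemma finite_M: "finite M"
proof -
  have "M \<subseteq> {1..n} \<times> {1..n}" using M_bounds by fastforce
  thus ?thesis by (rule finite_subset) simp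
qed

lemma M_ex: assumes "k \<in> {1..n}" obtains a b where "(a, b) \<in> M" "k = a \<or> k = b"
proof -
  have "\<exists>!e. e \<in> M \<and> (k = fst e \<or> k = snd e)" using pm assms unfolding perfect_matching_def by blast
  thus ?thesis using that by (metis prod.collapse)
qed

lemma M_ex1: obtains a b where "(a, b) \<in> M"
proof -
  have "(1::nat) \<in> {1..n}" using r1 by auto
  thus ?thesis using M_ex that by metis
qed

lemma M_unique:
  assumes "(a, b) \<in> M" "(c, d) \<in> M" "k = a \<or> k = b" "k = c \<or> k = d"
  shows "a = c \<and> b = d"
proof -
  have "k \<in> {1..n}" using M_bounds[OF assms(1)] assms(3) by auto
  hence "\<exists>!e. e \<in> M \<and> (k = fst e \<or> k = snd e)" using pm unfolding perfect_matching_def by blast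
  thus ?thesis using assms by (metis fst_conv snd_conv prod.inject)
qed

lemma M_noncrossing: "(a, b) \<in> M \<Longrightarrow> (c, d) \<in> M \<Longrightarrow> a < c \<Longrightarrow> c < b \<Longrightarrow> b < d \<Longrightarrow> False"
  using ncM unfolding noncrossing_def by fastforce

text \<open>Descent: unless the arc is short, noncrossing forces \<open>a + 1\<close> to be matched
  to the right and inside the arc, which gives a shorter arc.\<close>

lemma inner_short_arc: "(a, b) \<in> M \<Longrightarrow> \<exists>i. a \<le> i \<and> i < b \<and> (i, i + 1) \<in> M"
proof (induction "b - a" arbitrary: a b rule: less_induct)
  case less
  note ab = M_bounds[OF less.prems]
  show ?case
  proof (cases "b = a + 1")
    case True
    thus ?thesis using less.prems ab by (intro exI[of _ a]) auto
  next
    case False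
    hence "a + 1 \<in> {1..n}" using ab by auto
    then obtain c d where cd: "(c, d) \<in> M" "a + 1 = c \<or> a + 1 = d" by (rule M_ex)
    note cdb = M_bounds[OF cd(1)]
    have ne: "\<not> (c = a \<or> c = b \<or> d = a \<or> d = b)"
    proof
      assume "c = a \<or> c = b \<or> d = a \<or> d = b"
      hence "a = c \<and> b = d" using M_unique[OF less.prems cd(1), of a]
          M_unique[OF less.prems cd(1), of b] by blast
      thus False using cd(2) False by auto
    qed
    have "a + 1 \<noteq> d"
    proof
      assume "a + 1 = d"
      thus False using M_noncrossing[OF cd(1) less.prems] cdb ab ne False by auto
    qed
    hence c: "c = a + 1" using cd by auto
    have "\<not> b < d" using M_noncrossing[OF less.prems cd(1)] c ab False by auto
    hence "d < b" using ne by linarith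
    hence "d - c < b - a" using c cdb by linarith
    from less.hyps[OF this cd(1)] obtain i where "c \<le> i" "i < d" "(i, i + 1) \<in> M" by blast
    thus ?thesis using c \<open>d < b\<close> by (intro exI[of _ i]) auto
  qed
qed

section \<open>Claws as cyclic intervals\<close>

lemma sorted_I: "sorted_wrt (<) I"
  unfolding short_starts_def by (intro sorted_wrt_filter) (rule sorted_wrt_upt)

lemma set_I: "set I = {i \<in> {1..n}. joined M i (sc i)}"
  unfolding short_starts_def sc_def by auto

lemma I_mono: "i < j \<Longrightarrow> j < s \<Longrightarrow> I ! i < I ! j"
  using sorted_I sorted_wrt_nth_less unfolding num_claws_def by blast

lemma I_mono_le: "i \<le> j \<Longrightarrow> j < s \<Longrightarrow> I ! i \<le> I ! j"
  using I_mono[of i j] by (cases "i = j") auto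

lemma I_less_iff: "i < s \<Longrightarrow> j < s \<Longrightarrow> I ! i < I ! j \<longleftrightarrow> i < j"
  using I_mono[of i j] I_mono_le[of j i] by (metis leD not_le)

lemma I_in: "i < s \<Longrightarrow> I ! i \<in> {1..n} \<and> joined M (I ! i) (sc (I ! i))"
  using set_I nth_mem unfolding num_claws_def by blast

lemma I_nth: assumes "(i, i + 1) \<in> M" obtains j where "j < s" "I ! j = i"
proof -
  have "i \<in> set I" unfolding set_I sc_def joined_def using assms M_bounds[OF assms] by auto
  thus ?thesis using that unfolding in_set_conv_nth num_claws_def by auto
qed

lemma s1: "1 \<le> s"
proof -
  obtain a b where "(a, b) \<in> M" using M_ex1 by blast
  then obtain i where "(i, i + 1) \<in> M" using inner_short_arc by blast
  then obtain j where "j < s" by (rule I_nth)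
  thus ?thesis by simp
qed

lemma claw_less: "1 \<le> j \<Longrightarrow> j < s \<Longrightarrow> claw r M j = [I ! (j - 1) + 1..<I ! j + 1]"
  using I_mono[of "j - 1" j] unfolding claw_def Let_def cyclic_interval_def num_claws_def
      by (auto simp del: upt_Suc)

lemma claw_last: "claw r M s = [I ! (s - 1) + 1..<n + 1] @ [1..<I ! 0 + 1]"
proof -
  have "\<not> I ! (s - 1) < I ! 0" using I_mono_le[of 0 "s - 1"] s1 by auto
  thus ?thesis unfolding claw_def Let_def cyclic_interval_def num_claws_def by (simp del: upt_Suc)
qed

lemma set_claw_less: "1 \<le> j \<Longrightarrow> j < s \<Longrightarrow> set (claw r M j) = {I ! (j - 1)<..I ! j}"
  by (auto simp: claw_less)

lemma set_claw_last: "set (claw r M s) = {I ! (s - 1)<..n} \<union> {1..I ! 0}"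
  by (auto simp: claw_last)

text \<open>An arc covers a short arc, whose start is the last element of a claw, so the arc leaves
  its claw. The exception to treat is the last claw with \<open>a\<close> and \<open>b\<close> on
  different sides of the cut. With \<open>c\<close> the partner of 1, noncrossing then puts
  \<open>b\<close> at or before \<open>c\<close>, while a short arc after \<open>c\<close> starts
  beyond \<open>b\<close>, against the choice of the last short start.\<close>

lemma no_arc_in_claw:
  assumes "(a, b) \<in> M" "j \<in> {1..s}" "a \<in> set (claw r M j)" "b \<in> set (claw r M j)"
  shows False
proof -
  note ab = M_bounds[OF assms(1)]
  obtain i where i: "a \<le> i" "i < b" "(i, i + 1) \<in> M" using inner_short_arc[OF assms(1)] by auto
  obtain t where t: "t < s" "I ! t = i" using i(3) by (rule I_nth)
  have lo: "I ! 0 \<le> I ! u" "I ! u \<le> I ! (s - 1)" if "u < s" for u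
    using I_mono_le[of 0 u] I_mono_le[of u "s - 1"] that by auto
  show False
  proof (cases "j < s")
    case True
    hence "I ! (j - 1) < I ! t" "I ! t < I ! j" using assms set_claw_less[of j] i t by auto
    hence "j - 1 < t" "t < j" using I_less_iff[of "j - 1" t] I_less_iff[of t j] True t assms(2)
        by auto
    thus False by simp
  next
    case False
    hence js: "j = s" using assms(2) by auto
    consider "a > I ! (s - 1)" | "b \<le> I ! 0" | "a \<le> I ! 0" "b > I ! (s - 1)"
      using assms(3,4) unfolding js set_claw_last by auto
    thus False
    proof cases
      case 1 thus False using lo[OF t(1)] t i by auto
    next
      case 2 thus False using lo[OF t(1)] t i by auto
    next
      case 3
      have "(1::nat) \<in> {1..n}" using r1 by auto
      then obtain c0 c where c: "(c0, c) \<in> M" "1 = c0 \<or> 1 = c" by (rule M_ex)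
      have c1: "(1, c) \<in> M" "1 < c" "c \<le> n" using c M_bounds[OF c(1)] by auto
      \<comment> \<open>An arc from 1 to \<open>n\<close> would make \<open>n\<close> a short start,
        since 1 is the cyclic successor of \<open>n\<close>.\<close>
      have "c \<noteq> n"
      proof
        assume "c = n"
        hence "n \<in> set I" using c1 r1 unfolding set_I sc_def joined_def by auto
        then obtain u where "u < s" "I ! u = n" unfolding in_set_conv_nth num_claws_def by auto
        thus False using lo[of u] 3 ab by auto
      qed
      obtain i' where i': "i' < c" "(i', i' + 1) \<in> M" using inner_short_arc[OF c1(1)] by auto
      obtain t' where t': "t' < s" "I ! t' = i'" using i'(2) by (rule I_nth)
      have ac: "a < c" using 3 lo[OF t'(1)] t' i' by auto
      have "b \<le> c"
      proof (cases "a = 1")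
        case True thus ?thesis using M_unique[OF assms(1) c1(1), of 1] by auto
      next
        case False
        hence "1 < a" using ab by auto
        hence "\<not> c < b" using M_noncrossing[OF c1(1) assms(1)] ac by blast
        thus ?thesis by simp
      qed
      have "c + 1 \<in> {1..n}" using c1 \<open>c \<noteq> n\<close> by auto
      then obtain x y where xy: "(x, y) \<in> M" "c + 1 = x \<or> c + 1 = y" by (rule M_ex)
      note xyb = M_bounds[OF xy(1)]
      have "c + 1 \<noteq> y"
      proof
        assume y: "c + 1 = y"
        have "x \<noteq> c" "x \<noteq> 1" using M_unique[OF xy(1) c1(1), of c] M_unique[OF xy(1) c1(1), of 1]
            y by auto
        thus False using M_noncrossing[OF c1(1) xy(1)] y xyb by auto
      qed
      hence "x = c + 1" using xy by auto
      obtain i2 where i2: "x \<le> i2" "(i2, i2 + 1) \<in> M" using inner_short_arc[OF xy(1)] by auto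
      obtain t2 where t2: "t2 < s" "I ! t2 = i2" using i2(2) by (rule I_nth)
      show False using lo[OF t2(1)] t2 i2 \<open>x = c + 1\<close> \<open>b \<le> c\<close> 3 by auto
    qed
  qed
qed

text \<open>A single claw would contain both ends of an arc.\<close>

lemma s2: "2 \<le> s"
proof (rule ccontr)
  assume "\<not> 2 \<le> s"
  hence s: "s = 1" using s1 by auto
  obtain a b where ab: "(a, b) \<in> M" using M_ex1 by blast
  have "set (claw r M s) = {1..n}" unfolding set_claw_last using I_in[of 0] s by auto
  thus False using no_arc_in_claw[OF ab, of s] M_bounds[OF ab] s by auto
qed

section \<open>The claw of a boundary vertex\<close>

lemma cl_range: "cl k \<in> {1..s}"
proof -
  have "length (filter (\<lambda>i. i < k) I) \<le> s" unfolding num_claws_def by simp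
  moreover have "1 \<le> s" using s1 .
  ultimately show ?thesis unfolding cl_def Let_def by (auto simp del: length_0_conv simp: Suc_le_eq)
qed

lemma filter_I:
  assumes "j \<le> s" "\<And>i. i < j \<Longrightarrow> I ! i < k" "\<And>i. j \<le> i \<Longrightarrow> i < s \<Longrightarrow> k \<le> I ! i"
  shows "length (filter (\<lambda>i. i < k) I) = j"
proof -
  have "{i. i < length I \<and> I ! i < k} = {..<j}"
    using assms unfolding num_claws_def by (auto simp: not_less) (meson leD not_less)+
  thus ?thesis by (simp add: length_filter_conv_card)
qed

lemma in_claw_imp: assumes "j \<in> {1..s}" "k \<in> set (claw r M j)" shows "cl k = j"
proof (cases "j < s")
  case True
  hence k: "I ! (j - 1) < k" "k \<le> I ! j" using assms set_claw_less[of j] by auto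
  have "length (filter (\<lambda>i. i < k) I) = j"
  proof (rule filter_I)
    show "j \<le> s" using True by simp
    show "I ! i < k" if "i < j" for i using I_mono_le[of i "j - 1"] that k True by fastforce
    show "k \<le> I ! i" if "j \<le> i" "i < s" for i using I_mono_le[of j i] that k by auto
  qed
  thus ?thesis using assms unfolding cl_def Let_def by auto
next
  case False
  hence j: "j = s" using assms by auto
  consider "I ! (s - 1) < k" | "k \<le> I ! 0" using assms unfolding j set_claw_last by auto
  thus ?thesis
  proof cases
    case 1
    have "length (filter (\<lambda>i. i < k) I) = s"
    proof (rule filter_I)
      show "I ! i < k" if "i < s" for i using I_mono_le[of i "s - 1"] that 1 s1 by fastforce
    qed auto
    thus ?thesis using s1 j unfolding cl_def Let_def by auto
  next
    case 2
    have "length (filter (\<lambda>i. i < k) I) = 0"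
    proof (rule filter_I)
      show "k \<le> I ! i" if "i < s" for i using I_mono_le[of 0 i] that 2 by simp
    qed auto
    thus ?thesis using j unfolding cl_def Let_def by auto
  qed
qed

lemma claw_subset: "j \<in> {1..s} \<Longrightarrow> set (claw r M j) \<subseteq> {1..n}"
proof -
  assume j: "j \<in> {1..s}"
  show ?thesis
  proof (cases "j < s")
    case True
    thus ?thesis using set_claw_less[of j] I_in[of j] j by auto
  next
    case False
    hence "j = s" using j by auto
    thus ?thesis using set_claw_last I_in[of 0] s1 by auto
  qed
qed

lemma in_claw: assumes "j \<in> {1..s}" "k \<in> {1..n}" shows "k \<in> set (claw r M j) \<longleftrightarrow> cl k = j"
proof -
  have "\<exists>j'\<in>{1..s}. k \<in> set (claw r M j')"
  proof (cases "k \<le> I ! 0 \<or> I ! (s - 1) < k")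
    case True
    hence "k \<in> set (claw r M s)" using assms unfolding set_claw_last by auto
    thus ?thesis using s1 by force
  next
    case False
    define j' where "j' = (LEAST j. k \<le> I ! j)"
    have l: "k \<le> I ! j'" unfolding j'_def by (rule LeastI[of _ "s - 1"]) (use False in auto)
    have l2: "\<not> k \<le> I ! u" if "u < j'" for u using not_less_Least that unfolding j'_def by blast
    have "j' \<le> s - 1" unfolding j'_def by (rule Least_le) (use False in auto)
    hence "j' < s" using s1 by auto
    have "j' \<noteq> 0" using l False by (intro notI) auto
    hence "k \<in> set (claw r M j')" using set_claw_less[of j'] \<open>j' < s\<close> l l2[of "j' - 1"] by auto
    thus ?thesis using \<open>j' \<noteq> 0\<close> \<open>j' < s\<close> by force
  qed
  thus ?thesis using in_claw_imp assms by blast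
qed

lemma set_claw: "j \<in> {1..s} \<Longrightarrow> set (claw r M j) = {k \<in> {1..n}. cl k = j}"
  using in_claw claw_subset by blast

lemma claw_ne: "j \<in> {1..s} \<Longrightarrow> claw r M j \<noteq> []"
  using claw_less[of j] claw_last I_mono[of "j - 1" j] I_in[of 0] s1 by (cases
      "j < s") (auto simp del: upt_Suc)

lemma distinct_claw: "j \<in> {1..s} \<Longrightarrow> distinct (claw r M j)"
  using claw_less[of j] claw_last I_mono[of 0 "s - 1"] s2 by (cases
      "j < s") (auto simp del: upt_Suc)

lemma last_claw: "j \<in> {1..s} \<Longrightarrow> last (claw r M j) = I ! (j mod s)"
  using claw_less[of j] claw_last I_mono[of "j - 1" j] I_in[of 0] s1 by (cases
      "j < s") (auto simp del: upt_Suc)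

lemma hd_claw: assumes "j \<in> {1..s}" shows "hd (claw r M j) = sc (I ! (j - 1))"
proof (cases "j < s")
  case True
  hence "I ! (j - 1) < I ! j" "I ! j \<le> n" using I_mono[of "j - 1" j] I_in[of j] assms by auto
  thus ?thesis using claw_less[of j] True assms unfolding sc_def by (simp add: upt_rec)
next
  case False
  hence j: "j = s" using assms by auto
  have "I ! (s - 1) \<le> n" "1 \<le> I ! 0" using I_in[of "s - 1"] I_in[of 0] s1 by auto
  thus ?thesis unfolding j claw_last sc_def by (cases "I ! (s - 1) = n") (simp_all add: upt_rec
      hd_append)
qed

lemma claw_Suc:
  assumes "j \<in> {1..s}" "Suc t < length (claw r M j)" shows
      "claw r M j ! Suc t = sc (claw r M j ! t)"
proof (cases "j < s")
  case True
  hence "I ! j \<le> n" using I_in[of j] by auto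
  thus ?thesis using claw_less[of j] True assms unfolding sc_def by (auto simp del: upt_Suc)
next
  case False
  hence j: "j = s" using assms by auto
  have "I ! (s - 1) \<le> n" "1 \<le> I ! 0" "I ! 0 < I ! (s - 1)" using I_in[of "s - 1"] I_in[of 0]
      I_mono[of 0 "s - 1"] s2 by auto
  moreover from this have "claw r M s ! k = (if k < n - I ! (s - 1) then I ! (s - 1) + 1 + k
      else k - (n - I ! (s - 1)) + 1)"
    if "k < length (claw r M s)" for k
    using that unfolding claw_last by (simp add: nth_append del: upt_Suc)
  from this[of t] this[of "Suc t"] have "claw r M s ! Suc t = sc (claw r M s ! t)"
    if "Suc t < n - I ! (s - 1) + I ! 0" "I ! (s - 1) \<le> n" "I ! 0 < I ! (s - 1)"
    using that assms(2) unfolding j sc_def by (auto split: if_splits) arith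
  moreover have "length (claw r M s) = n - I ! (s - 1) + I ! 0" unfolding claw_last
      by (simp del: upt_Suc)
  ultimately show ?thesis using assms(2) unfolding j by simp
qed

lemma hd_claw_next: "j \<in> {1..s} \<Longrightarrow> hd (claw r M (j mod s + 1)) = sc (last (claw r M j))"
  using hd_claw[of "j mod s + 1"] last_claw[of j] s1 by (simp add: Suc_leI)

text \<open>The last element of a claw is a short start, and its partner is the first element of the
  next claw.\<close>

lemma arc_next_claw:
  assumes "j \<in> {1..s}" shows "\<exists>e\<in>M. {cl (fst e), cl (snd e)} = {j, j mod s + 1}"
proof -
  define i where "i = I ! (j mod s)"
  have j': "j mod s + 1 \<in> {1..s}" using s1 by (auto simp: Suc_leI)
  have "i \<in> set (claw r M j)" using last_claw[OF assms] last_in_set[OF claw_ne[OF assms]]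
      unfolding i_def by simp
  hence 1: "cl i = j" using in_claw_imp assms by blast
  have "sc i \<in> set (claw r M (j mod s + 1))"
    using hd_claw[OF j'] hd_in_set[OF claw_ne[OF j']] unfolding i_def by simp
  hence 2: "cl (sc i) = j mod s + 1" using in_claw_imp j' by blast
  have "joined M i (sc i)" using I_in[of "j mod s"] s1 unfolding i_def by auto
  thus ?thesis
  proof (unfold joined_def, elim disjE)
    assume "(i, sc i) \<in> M"
    thus ?thesis using 1 2 by (intro bexI[of _ "(i, sc i)"]) simp_all
  next
    assume "(sc i, i) \<in> M"
    thus ?thesis using 1 2 by (intro bexI[of _ "(sc i, i)"]) (simp_all add: insert_commute)
  qed
qed

lemma cl_arc_neq: "(a, b) \<in> M \<Longrightarrow> cl a \<noteq> cl b"
proof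
  assume ab: "(a, b) \<in> M" "cl a = cl b"
  have "a \<in> {1..n}" "b \<in> {1..n}" using M_bounds[OF ab(1)] by auto
  hence "a \<in> set (claw r M (cl a))" "b \<in> set (claw r M (cl a))" using in_claw[OF cl_range] ab
      by auto
  thus False using no_arc_in_claw[OF ab(1) cl_range] by blast
qed

lemma card_M: "card M = r"
proof -
  have inj: "inj_on fst M" "inj_on snd M"
    by (rule inj_onI, metis M_unique prod.collapse)+
  have "fst ` M \<inter> snd ` M = {}"
  proof (rule ccontr)
    assume "fst ` M \<inter> snd ` M \<noteq> {}"
    then obtain a b c where "(a, b) \<in> M" "(c, a) \<in> M" by force
    thus False using M_unique[of a b c a a] M_bounds[of a b] by simp
  qed
  moreover have "fst ` M \<union> snd ` M = {1..n}"
  proof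
    show "fst ` M \<union> snd ` M \<subseteq> {1..n}" using M_bounds by fastforce
    show "{1..n} \<subseteq> fst ` M \<union> snd ` M"
    proof
      fix k assume "k \<in> {1..n}"
      then obtain a b where "(a, b) \<in> M" "k = a \<or> k = b" by (rule M_ex)
      thus "k \<in> fst ` M \<union> snd ` M" by force
    qed
  qed
  ultimately have "card M + card M = card {1..n}"
    using card_Un_disjoint[of "fst ` M" "snd ` M"] card_image[OF inj(1)] card_image[OF inj(2)]
        finite_M by simp
  thus ?thesis by simp
qed

text \<open>Each boundary vertex lies on one arc and no arc has both ends in one claw. This turns
  claw edges into arcs, so that they enter the same count as the hourglasses.\<close>

lemma length_claw:
  assumes "j \<in> {1..s}" shows "length (claw r M j) = card {e \<in> M. cl (fst e) = j \<or> cl (snd e) = j}"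
proof -
  define C where "C = {k \<in> {1..n}. cl k = j}"
  define X where "X = {e \<in> M. cl (fst e) = j \<or> cl (snd e) = j}"
  have "bij_betw (\<lambda>e. if cl (fst e) = j then fst e else snd e) X C"
    unfolding bij_betw_def
  proof (intro conjI inj_onI set_eqI iffI)
    fix e f assume e: "e \<in> X" "f \<in> X" and eq: "(if cl (fst e) = j then fst e else snd e) = (if
        cl (fst f) = j then fst f else snd f)"
    obtain a b c d where ab: "e = (a, b)" "f = (c, d)" by (cases e; cases f) auto
    define k where "k = (if cl a = j then a else b)"
    have k: "k = a \<or> k = b" "k = c \<or> k = d" using eq unfolding k_def ab by (auto split: if_splits)
    have "(a, b) \<in> M" "(c, d) \<in> M" using e unfolding ab X_def by auto
    from M_unique[OF this k] show "e = f" unfolding ab by simp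
  next
    fix k assume "k \<in> (\<lambda>e. if cl (fst e) = j then fst e else snd e) ` X"
    then obtain a b where "(a, b) \<in> M" "cl a = j \<or> cl b = j" "k = (if cl a = j then a else b)"
        unfolding X_def by auto
    thus "k \<in> C" unfolding C_def using M_bounds[of a b] by auto
  next
    fix k assume k: "k \<in> C"
    then obtain a b where ab: "(a, b) \<in> M" "k = a \<or> k = b" using M_ex unfolding C_def by blast
    have "k = (if cl (fst (a, b)) = j then fst (a, b) else snd (a, b))" "(a, b) \<in> X"
      using ab k cl_arc_neq[OF ab(1)] unfolding C_def X_def by auto
    thus "k \<in> (\<lambda>e. if cl (fst e) = j then fst e else snd e) ` X" by (rule image_eqI)
  qed
  hence "card X = card C" by (rule bij_betw_same_card)
  moreover have "length (claw r M j) = card C"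
    using distinct_card[OF distinct_claw[OF assms]] set_claw[OF assms] unfolding C_def by simp
  ultimately show ?thesis unfolding X_def by simp
qed

lemma weight_cl:
  assumes "j \<in> {1..s}" "k \<in> {1..s}"
  shows "weight r M j k = card {e \<in> M. {cl (fst e), cl (snd e)} = {j, k}}"
proof -
  have "{(a, b) \<in> M. a \<in> set (claw r M j) \<and> b \<in> set (claw r M k) \<or> a \<in> set (claw r M k) \<and> b \<in>
      set (claw r M j)}
    = {e \<in> M. {cl (fst e), cl (snd e)} = {j, k}}"
  proof -
    have "x \<in> set (claw r M j) \<longleftrightarrow> cl x = j" "x \<in> set (claw r M k) \<longleftrightarrow> cl x = k" if "x \<in> {1..n}" for x
      using in_claw assms that by blast+
    moreover have "a \<in> {1..n} \<and> b \<in> {1..n}" if "(a, b) \<in> M" for a b using M_bounds[OF that] by simp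
    ultimately show ?thesis by (fastforce simp: doubleton_eq_iff)
  qed
  thus ?thesis unfolding weight_def by simp
qed

end

section \<open>Cyclic lists with multiplicities\<close>

lemma cycle_of_list_nth:
  assumes "distinct L" "k < length L"
  shows "cycle_of_list L (L ! k) = L ! (Suc k mod length L)"
proof -
  have "map (cycle_of_list L ^^ 1) L = rotate 1 L" by (rule cyclic_rotation) (use assms in auto)
  hence "map (cycle_of_list L) L ! k = rotate 1 L ! k" by simp
  thus ?thesis using assms by (simp add: nth_rotate1)
qed

lemma orbit_cycle_list:
  assumes "\<And>k. k < length L \<Longrightarrow> f (L ! k) = L ! (Suc k mod length L)" "x \<in> set L"
  shows "orbit f x = set L"
proof -
  obtain k where k: "k < length L" "x = L ! k" using assms(2) by (auto simp: in_set_conv_nth)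
  have pw: "(f ^^ m) x = L ! ((k + m) mod length L)" for m
  proof (induction m)
    case (Suc m)
    have "(k + m) mod length L < length L" by (rule mod_less_divisor) (use k in auto)
    from assms(1)[OF this] show ?case using Suc by (simp add: mod_Suc_eq)
  qed (use k in auto)
  show ?thesis
  proof
    show "orbit f x \<subseteq> set L" unfolding orbit_altdef
    proof
      fix y assume "y \<in> {(f ^^ m) x | m. 0 < m}"
      then obtain m where "y = L ! ((k + m) mod length L)" using pw by auto
      moreover have "(k + m) mod length L < length L" by (rule mod_less_divisor) (use k in auto)
      ultimately show "y \<in> set L" by simp
    qed
    show "set L \<subseteq> orbit f x"
    proof
      fix y assume "y \<in> set L"
      then obtain j where j: "j < length L" "y = L ! j" by (auto simp: in_set_conv_nth)
      have "(k + (length L - k + j)) mod length L = j" using k j by (simp add: mod_add_left_eq)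
      hence "(f ^^ (length L - k + j)) x = y" using pw j by simp
      moreover have "0 < length L - k + j" using k by auto
      ultimately show "y \<in> orbit f x" unfolding orbit_altdef by blast
    qed
  qed
qed

definition offset :: "'a list \<Rightarrow> ('a \<Rightarrow> int) \<Rightarrow> 'a \<Rightarrow> int" where
  "offset L f u = sum_list (map f (takeWhile (\<lambda>z. z \<noteq> u) L))"

lemma takeWhile_neq_nth: "distinct L \<Longrightarrow> k < length L \<Longrightarrow> takeWhile (\<lambda>z. z \<noteq> L ! k) L = take k L"
  by (rule takeWhile_eq_take_P_nth) (auto simp: nth_eq_iff_index_eq)

lemma offset_nth: "distinct L \<Longrightarrow> k < length L \<Longrightarrow> offset L f (L ! k) = sum_list (map f (take k L))"
  unfolding offset_def by (simp add: takeWhile_neq_nth)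

lemma sum_take_mono:
  assumes "\<And>u. u \<in> set L \<Longrightarrow> (1::int) \<le> f u" "j < k" "k \<le> length L"
  shows "sum_list (map f (take j L)) + f (L ! j) \<le> sum_list (map f (take k L))"
  using assms(2,3)
proof (induction k)
  case (Suc k)
  show ?case
  proof (cases "j = k")
    case True
    thus ?thesis using Suc by (simp add: take_Suc_conv_app_nth)
  next
    case False
    hence "sum_list (map f (take j L)) + f (L ! j) \<le> sum_list (map f (take k L))" using Suc by auto
    moreover have "1 \<le> f (L ! k)" using assms(1) Suc by auto
    ultimately show ?thesis using Suc by (simp add: take_Suc_conv_app_nth)
  qed
qed auto

lemma offset_bounds:
  assumes "distinct L" "\<And>u. u \<in> set L \<Longrightarrow> (1::int) \<le> f u" "u \<in> set L"
  shows "0 \<le> offset L f u" "offset L f u + f u \<le> sum_list (map f L)"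
proof -
  obtain k where k: "k < length L" "u = L ! k" using assms(3) by (auto simp: in_set_conv_nth)
  have "0 \<le> sum_list (map f (take k L))"
    by (rule sum_list_nonneg) (use assms(2) in \<open>force dest: in_set_takeD\<close>)
  thus "0 \<le> offset L f u" using k assms by (simp add: offset_nth)
  show "offset L f u + f u \<le> sum_list (map f L)"
    using sum_take_mono[of L f k "length L"] k assms by (simp add: offset_nth)
qed

text \<open>The reduction takes effect only at the last entry, whose successor is the first entry
  with offset 0.\<close>

lemma offset_cycle:
  assumes "distinct L" "\<And>u. u \<in> set L \<Longrightarrow> (1::int) \<le> f u" "u \<in> set L"
  shows "offset L f (cycle_of_list L u) = (offset L f u + f u) mod sum_list (map f L)"
proof -
  obtain k where k: "k < length L" "u = L ! k" using assms(3) by (auto simp: in_set_conv_nth)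
  have c: "cycle_of_list L u = L ! (Suc k mod length L)" using k assms cycle_of_list_nth by auto
  have o: "offset L f u = sum_list (map f (take k L))" using k assms by (simp add: offset_nth)
  show ?thesis
  proof (cases "Suc k < length L")
    case True
    have "offset L f (L ! Suc k) = offset L f u + f u"
      using True k assms o by (simp add: offset_nth take_Suc_conv_app_nth)
    moreover have "offset L f (L ! Suc k) + f (L ! Suc k) \<le> sum_list (map f L)"
        "0 \<le> offset L f (L ! Suc k)"
      using offset_bounds[OF assms(1), of f "L ! Suc k"] assms(2) True by auto
    moreover have "1 \<le> f (L ! Suc k)" using assms(2) True by auto
    ultimately show ?thesis using c True by (simp add: mod_pos_pos_trivial)
  next
    case False
    hence e: "length L = Suc k" using k by auto
    hence "sum_list (map f L) = offset L f u + f u"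
      using o k take_Suc_conv_app_nth[of k L] by (metis (no_types, lifting) append_Nil2
          list.simps(8) list.simps(9) map_append sum_list.Cons sum_list.Nil sum_list_append
          take_all_iff le_refl add.right_neutral)
    moreover from k have "0 < length L" by auto
    from offset_nth[OF assms(1) this, of f] have "offset L f (L ! 0) = 0" by simp
    ultimately show ?thesis using c e by simp
  qed
qed

text \<open>Entries own disjoint blocks of positions; this is why a position determines its
  strand.\<close>

lemma offset_disjoint:
  assumes "distinct L" "\<And>u. u \<in> set L \<Longrightarrow> (1::int) \<le> f u" "u \<in> set L" "v \<in> set L" "u \<noteq> v"
  shows "offset L f u + f u \<le> offset L f v \<or> offset L f v + f v \<le> offset L f u"
proof -
  obtain j k where k: "j < length L" "u = L ! j" "k < length L" "v = L ! k" using assms(3,4)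
      by (auto simp: in_set_conv_nth)
  have "j < k \<or> k < j" using assms(5) k by (cases j k rule: linorder_cases) auto
  thus ?thesis
    using sum_take_mono[of L f j k] sum_take_mono[of L f k j] assms(1,2) k
        by (auto simp: offset_nth)
qed

section \<open>The local structure of Fraser graphs\<close>

locale fraser = noncrossing_matching r M for r M +
  fixes D :: "(nat \<times> nat) set"
  assumes fraser_tri: "fraser_triangulation r M D"
begin

lemma weight_joined:
  assumes "e \<in> M" shows "joined D (cl (fst e)) (cl (snd e))"
proof -
  define j k where "j = min (cl (fst e)) (cl (snd e))" "k = max (cl (fst e)) (cl (snd e))"
  have ne: "cl (fst e) \<noteq> cl (snd e)" using cl_arc_neq assms by (metis prod.collapse)
  have jk: "j \<in> {1..s}" "k \<in> {1..s}" "j < k" using cl_range[of "fst e"] cl_range[of "snd e"] ne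
      unfolding j_k_def by auto
  have "e \<in> {e \<in> M. {cl (fst e), cl (snd e)} = {j, k}}" using assms unfolding j_k_def
      by (auto simp: min_def max_def)
  moreover have "finite {e \<in> M. {cl (fst e), cl (snd e)} = {j, k}}" using finite_M by simp
  ultimately have "0 < weight r M j k" unfolding weight_cl[OF jk(1,2)] using card_gt_0_iff by blast
  moreover have "(j, k) \<in> chords s" using jk unfolding chords_def by auto
  ultimately have "(j, k) \<in> D" using fraser_tri unfolding fraser_triangulation_def by auto
  thus ?thesis unfolding joined_def j_k_def by (auto simp: min_def max_def split: if_splits)
qed

sublocale weighted_polygon s D M "\<lambda>e. cl (fst e)" "\<lambda>e. cl (snd e)"
proof
  show "2 \<le> s" by (rule s2)
  show "triangulation s D" using fraser_tri unfolding fraser_triangulation_def by auto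
  show "finite M" by (rule finite_M)
  show "cl (fst e) \<in> {1..s}" "cl (snd e) \<in> {1..s}" if "e \<in> M" for e by (rule cl_range)+
  show "joined D (cl (fst e)) (cl (snd e))" if "e \<in> M" for e by (rule weight_joined[OF that])
  show "\<exists>e\<in>M. {cl (fst e), cl (snd e)} = {j, j mod s + 1}" if "j \<in> {1..s}" for j
      by (rule arc_next_claw[OF that])
qed

abbreviation "G \<equiv> fraser_graph r M D"

abbreviation Tv :: "int \<Rightarrow> int \<Rightarrow> int \<Rightarrow> fraser_vertex" where
  "Tv j k l \<equiv> Tri {vtx j, vtx k, vtx l}"

abbreviation Wv :: "int \<Rightarrow> fraser_vertex" where
  "Wv j \<equiv> Wh (vtx j)"

text \<open>An arc determines the pair of claws it joins, and this pair is a chord of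
  \<open>D\<close>. Summing the weights of the chords in the region therefore counts each arc with
  both ends in the region once.\<close>

lemma corner_Tr:
  assumes "Tr v x y" shows "int (corner_mult r M D {vtx v, vtx x, vtx y} (vtx v)) = N x y"
proof -
  define P where "P = vtx ` {x..y}"
  have P: "P \<subseteq> {1..s}" unfolding P_def using vtx_range by blast
  have "corner_mult r M D {vtx v, vtx x, vtx y} (vtx v) = (\<Sum>(a, b)\<in>D \<inter> P \<times> P. weight r M a b)"
    unfolding corner_mult_def Let_def cut_off_Tr[OF assms] P_def ..
  also have "\<dots> = (\<Sum>p\<in>D \<inter> P \<times> P. card {e \<in> M. {cl (fst e), cl (snd e)} = {fst p, snd p}})"
  proof (rule sum.cong[OF refl])
    fix p assume "p \<in> D \<inter> P \<times> P"
    moreover obtain a b where "p = (a, b)" by (cases p)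
    ultimately show "(case p of (a, b) \<Rightarrow> weight r M a b) = card {e \<in> M. {cl (fst e), cl (snd e)}
        = {fst p, snd p}}"
      using weight_cl[of a b] subsetD[OF P, of a] subsetD[OF P, of b] by simp
  qed
  also have "\<dots> = card (\<Union>p\<in>D \<inter> P \<times> P. {e \<in> M. {cl (fst e), cl (snd e)} = {fst p, snd p}})"
  proof (rule card_UN_disjoint[symmetric])
    show "finite (D \<inter> P \<times> P)" using finite_D by auto
    show "\<forall>p\<in>D \<inter> P \<times> P. finite {e \<in> M. {cl (fst e), cl (snd e)} = {fst p, snd p}}"
        using finite_M by auto
    have eq: "p = q" if "p \<in> D" "q \<in> D" "{fst p, snd p} = {fst q, snd q}" for p q
      using that subsetD[OF Dchords that(1)] subsetD[OF Dchords that(2)]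
      by (cases p; cases q) (auto simp: chords_def doubleton_eq_iff)
    show "\<forall>p\<in>D \<inter> P \<times> P. \<forall>q\<in>D \<inter> P \<times> P. p \<noteq> q \<longrightarrow>
       {e \<in> M. {cl (fst e), cl (snd e)} = {fst p, snd p}} \<inter> {e \<in> M. {cl (fst e), cl (snd e)} =
           {fst q, snd q}} = {}"
    proof (intro ballI impI equals0I)
      fix p q e assume h: "p \<in> D \<inter> P \<times> P" "q \<in> D \<inter> P \<times> P" "p \<noteq> q"
        "e \<in> {e \<in> M. {cl (fst e), cl (snd e)} = {fst p, snd p}} \<inter> {e \<in> M. {cl (fst e), cl (snd
            e)} = {fst q, snd q}}"
      from h(4) have 1: "{cl (fst e), cl (snd e)} = {fst p, snd p}" by blast
      from h(4) have 2: "{cl (fst e), cl (snd e)} = {fst q, snd q}" by blast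
      have "{fst p, snd p} = {fst q, snd q}" unfolding 1[symmetric] 2[symmetric] ..
      thus False using eq[of p q] h(1-3) by simp
    qed
  qed
  also have "(\<Union>p\<in>D \<inter> P \<times> P. {e \<in> M. {cl (fst e), cl (snd e)} = {fst p, snd p}}) = arcs x y"
  proof (intro set_eqI iffI)
    fix e assume "e \<in> (\<Union>p\<in>D \<inter> P \<times> P. {e \<in> M. {cl (fst e), cl (snd e)} = {fst p, snd p}})"
    then obtain p where "e \<in> M" "fst p \<in> P" "snd p \<in> P" "{cl (fst e), cl (snd e)} = {fst p, snd
        p}" by auto
    thus "e \<in> arcs x y" unfolding arcs_def P_def by (auto simp: doubleton_eq_iff)
  next
    fix e assume e: "e \<in> arcs x y"
    hence "e \<in> M" "cl (fst e) \<in> P" "cl (snd e) \<in> P" unfolding arcs_def P_def by auto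
    moreover from this have "(cl (fst e), cl (snd e)) \<in> D \<or> (cl (snd e), cl (fst e)) \<in> D"
        using weight_joined unfolding joined_def by blast
    ultimately have "\<exists>p\<in>D \<inter> P \<times> P. {cl (fst e), cl (snd e)} = {fst p, snd p}"
      by (elim disjE) (rule bexI[of _ "(cl (fst e), cl (snd e))"], simp, simp,
        rule bexI[of _ "(cl (snd e), cl (fst e))"], simp_all add: insert_commute)
    thus "e \<in> (\<Union>p\<in>D \<inter> P \<times> P. {e \<in> M. {cl (fst e), cl (snd e)} = {fst p, snd p}})"
      using \<open>e \<in> M\<close> by blast
  qed
  finally show ?thesis unfolding N_def by simp
qed

text \<open>The opposite side has two different ends, so by \<open>N_pos\<close> at least one arc is
  cut off by it. Hence every triangle has three hourglasses.\<close>

lemma corner_pos: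
  assumes "\<Delta> \<in> triangles D" "\<delta> \<in> \<Delta>" shows "0 < corner_mult r M D \<Delta> \<delta>"
proof -
  have "\<delta> \<in> {1..s}" using assms Dchords unfolding triangles_def chords_def by auto
  then obtain v where v: "vtx v = \<delta>" using vtx_of_nat by blast
  then obtain x y where t: "Tr v x y" "\<Delta> = {vtx v, vtx x, vtx y}" using triangle_lift assms by metis
  have "1 \<le> N x y" using N_pos Tr_less[OF t(1)] by auto
  thus ?thesis using corner_Tr[OF t(1)] t v by auto
qed

lemma triangle_sub: "\<Delta> \<in> triangles D \<Longrightarrow> \<Delta> \<subseteq> {1..s} \<and> finite \<Delta>"
  using Dchords unfolding triangles_def chords_def by auto

lemma fraser_simps [simp]:
  "verts G = fraser_verts r M D" "darts G = fraser_darts r M D" "opp G = prod.swap" "tail G = fst"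
  "emult G = fraser_mult r M D" "bdry G = map Bd [1..<2 * r + 1]"
  "cw G d = (fst d, cycle_of_list (neighbours r M D (fst d)) (snd d))"
  "head G d = snd d"
  "black G (Bd k)" "\<not> black G (Wh j)" "black G (Tri \<Delta>)"
  unfolding fraser_graph_def head_def by (simp_all add: case_prod_beta)

lemma set_bdry: "set (bdry G) = Bd ` {1..n}"
  by auto

lemma claw_cl: "j \<in> {1..s} \<Longrightarrow> k \<in> set (claw r M j) \<longleftrightarrow> k \<in> {1..n} \<and> cl k = j"
  using set_claw by blast

lemma darts_iff:
  "(u, w) \<in> fraser_darts r M D \<longleftrightarrow>
     (\<exists>k\<in>{1..n}. u = Wh (cl k) \<and> w = Bd k \<or> u = Bd k \<and> w = Wh (cl k)) \<or>
     (\<exists>\<Delta>\<in>triangles D. \<exists>\<delta>\<in>\<Delta>. u = Wh \<delta> \<and> w = Tri \<Delta> \<or> u = Tri \<Delta> \<and> w = Wh \<delta>)"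
proof -
  have 1: "(u, w) \<in> {(Wh j, Bd k) | j k. j \<in> {1..s} \<and> k \<in> set (claw r M j)} \<longleftrightarrow> (\<exists>k\<in>{1..n}. u = Wh
      (cl k) \<and> w = Bd k)" for u w
    using claw_cl cl_range by auto
  have 2: "(u, w) \<in> {(Wh \<delta>, Tri \<Delta>) | \<delta> \<Delta>. \<Delta> \<in> triangles D \<and> \<delta> \<in> \<Delta> \<and> corner_mult r M D \<Delta> \<delta> > 0} \<longleftrightarrow>
      (\<exists>\<Delta>\<in>triangles D. \<exists>\<delta>\<in>\<Delta>. u = Wh \<delta> \<and> w = Tri \<Delta>)" for u w
    using corner_pos by auto
  show ?thesis unfolding fraser_darts_def Let_def Un_iff converse_Un converse_iff 1 2 by blast
qed

lemma nb_Bd: assumes "k \<in> {1..n}" shows "neighbours r M D (Bd k) = [Wh (cl k)]"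
proof -
  have "filter (\<lambda>j. k \<in> set (claw r M j)) [1..<s + 1] = filter (\<lambda>j. j = cl k) [1..<s + 1]"
    by (rule filter_cong) (use claw_cl assms in auto)
  also have "\<dots> = [cl k]"
  proof -
    have "distinct (filter (\<lambda>j. j = cl k) [1..<s + 1])" by simp
    moreover have "set (filter (\<lambda>j. j = cl k) [1..<s + 1]) = {cl k}" using cl_range[of k] by auto
    ultimately have "length (filter (\<lambda>j. j = cl k) [1..<s + 1]) = 1"
      using distinct_card[of "filter (\<lambda>j. j = cl k) [1..<s + 1]"] by simp
    then obtain y where "filter (\<lambda>j. j = cl k) [1..<s + 1] = [y]"
        by (auto simp: length_Suc_conv simp del: upt_Suc)
    moreover from this have "y \<in> set (filter (\<lambda>j. j = cl k) [1..<s + 1])"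
        by (simp del: upt_Suc set_filter)
    hence "y = cl k" by simp
    ultimately show ?thesis by simp
  qed
  finally show ?thesis by simp
qed

lemma nb_Wh: "neighbours r M D (Wv v) = map Bd (claw r M (vtx v)) @ map (\<lambda>(x, y). Tv v x y)
    (wedges v)"
proof -
  have "filter (\<lambda>\<Delta>. 0 < corner_mult r M D \<Delta> (vtx v)) (fan s D (vtx v)) = fan s D (vtx v)"
    by (rule filter_True) (use set_fan corner_pos in auto)
  thus ?thesis by (simp add: fan_eq case_prod_beta')
qed

lemma nb_Tri: assumes "\<Delta> \<in> triangles D" shows "neighbours r M D (Tri \<Delta>) = map Wh
    (sorted_list_of_set \<Delta>)"
proof -
  have "filter (\<lambda>\<delta>. 0 < corner_mult r M D \<Delta> \<delta>) (sorted_list_of_set \<Delta>) = sorted_list_of_set \<Delta>"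
    by (rule filter_True) (use corner_pos assms triangle_sub in auto)
  thus ?thesis by simp
qed

lemma vtx_ex: "j \<in> {1..s} \<Longrightarrow> \<exists>v. j = vtx v"
  using vtx_of_nat[of j] by (intro exI[of _ "int j"]) simp

lemma verts_cases:
  assumes "u \<in> fraser_verts r M D"
  obtains k where "u = Bd k" "k \<in> {1..n}" | v where "u = Wv v" | \<Delta> where "u = Tri \<Delta>"
      "\<Delta> \<in> triangles D"
  using assms vtx_ex unfolding fraser_verts_def by blast

lemma nb_props:
  assumes "u \<in> fraser_verts r M D"
  shows "distinct (neighbours r M D u)" "set (neighbours r M D u) = {w. (u, w) \<in> fraser_darts r
      M D}"
proof -
  show "distinct (neighbours r M D u)"
    using assms
  proof (cases rule: verts_cases)
    case (2 v)
    have "distinct (map (\<lambda>(x, y). Tv v x y) (wedges v))"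
      using distinct_fan[of v] unfolding fan_eq by (simp add: distinct_map inj_on_def
          case_prod_beta')
    thus ?thesis unfolding 2 nb_Wh using distinct_claw[OF vtx_range[of v]]
        by (auto simp: distinct_map inj_on_def)
  qed (auto simp: nb_Bd nb_Tri distinct_map inj_on_def)
  show "set (neighbours r M D u) = {w. (u, w) \<in> fraser_darts r M D}"
    using assms
  proof (cases rule: verts_cases)
    case (1 k)
    thus ?thesis unfolding 1 nb_Bd[OF 1(2)] darts_iff by auto
  next
    case (2 v)
    have "set (map (\<lambda>(x, y). Tv v x y) (wedges v)) = Tri ` set (fan s D (vtx v))"
      unfolding fan_eq by (auto simp: image_iff)
    thus ?thesis unfolding 2 nb_Wh darts_iff set_append set_fan
        using set_claw[OF vtx_range[of v]] by auto
  next
    case (3 \<Delta>)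
    thus ?thesis unfolding 3(1) nb_Tri[OF 3(2)] darts_iff using triangle_sub[OF 3(2)] by auto
  qed
qed

lemma darts_verts: "(u, w) \<in> fraser_darts r M D \<Longrightarrow> u \<in> fraser_verts r M D \<and> w \<in> fraser_verts r M D"
  unfolding darts_iff fraser_verts_def using cl_range triangle_sub by fast

lemma darts_swap: "(u, w) \<in> fraser_darts r M D \<longleftrightarrow> (w, u) \<in> fraser_darts r M D"
  unfolding darts_iff by blast

declare neighbours.simps [simp del]

abbreviation "nb \<equiv> neighbours r M D"

lemma mult_Tri: assumes "Tr v x y"
  shows "int (fraser_mult r M D (Wv v, Tv v x y)) = N x y"
      "int (fraser_mult r M D (Tv v x y, Wv v)) = N x y"
  using corner_Tr[OF assms] by simp_all

lemma mult_swap: "fraser_mult r M D (w, u) = fraser_mult r M D (u, w)"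
  by (cases u; cases w) simp_all

lemma mult_pos: "d \<in> fraser_darts r M D \<Longrightarrow> 1 \<le> fraser_mult r M D d"
  by (cases d) (auto simp: darts_iff Suc_le_eq corner_pos)

lemma Tr_rotate: assumes "Tr j k l"
  shows "Tv k l (j + int s) = Tv j k l" "Tv (l - int s) j k = Tv j k l" "Tr k l (j + int s)"
      "Tr (l - int s) j k"
  using Tr_rot[OF assms] by (simp_all add: insert_commute)

text \<open>Sorting by natural numbers gives the clockwise order up to rotation, and the rotation
  depends on how many corners lie past \<open>s\<close> in the lift.\<close>

lemma Tr_sorted:
  assumes "Tr j k l"
  shows "sorted_list_of_set {vtx j, vtx k, vtx l} \<in> {[vtx j, vtx k, vtx l], [vtx k, vtx l, vtx
      j], [vtx l, vtx j, vtx k]}"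
proof -
  obtain q where q: "1 \<le> j + q * int s" "j + q * int s \<le> int s" by (rule base_shift)
  define j' k' l' where d: "j' = j + q * int s" "k' = k + q * int s" "l' = l + q * int s"
  have o: "1 \<le> j'" "j' \<le> int s" "j' < k'" "k' < l'" "l' < j' + int s" using Tr_less[OF assms] q
      unfolding d by auto
  have e: "vtx j = vtx j'" "vtx k = vtx k'" "vtx l = vtx l'" unfolding d by auto
  have red: "int (vtx z) = (if z \<le> int s then z else z - int s)" if "1 \<le> z" "z \<le> 2 * int s" for z
    using vtx_small[of z] vtx_small2[of z] that by auto
  have r: "int (vtx j') = j'" "int (vtx k') = (if k' \<le> int s then k' else k' - int s)"
      "int (vtx l') = (if l' \<le> int s then l' else l' - int s)"
    using red[of j'] red[of k'] red[of l'] o by auto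
  have sl: "sorted_list_of_set {a, b, c} = [a, b, c]" if "a < b" "b < c" for a b c :: nat
    using that sorted_list_of_set.idem_if_sorted_distinct[of "[a, b, c]"] by auto
  consider "l' \<le> int s" | "k' \<le> int s" "int s < l'" | "int s < k'" by linarith
  thus ?thesis
  proof cases
    case 1
    have "int (vtx j') < int (vtx k')" "int (vtx k') < int (vtx l')" using r o 1 by auto
    thus ?thesis using sl[of "vtx j'" "vtx k'" "vtx l'"] unfolding e by simp
  next
    case 2
    have "int (vtx l') < int (vtx j')" "int (vtx j') < int (vtx k')" using r o 2 by auto
    moreover have "{vtx j', vtx k', vtx l'} = {vtx l', vtx j', vtx k'}" by auto
    ultimately show ?thesis using sl[of "vtx l'" "vtx j'" "vtx k'"] unfolding e by simp
  next
    case 3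
    have "int (vtx k') < int (vtx l')" "int (vtx l') < int (vtx j')" using r o 3 by auto
    moreover have "{vtx j', vtx k', vtx l'} = {vtx k', vtx l', vtx j'}" by auto
    ultimately show ?thesis using sl[of "vtx k'" "vtx l'" "vtx j'"] unfolding e by simp
  qed
qed

lemma nb_Tv:
  assumes "Tr j k l"
  shows "nb (Tv j k l) \<in> {[Wv j, Wv k, Wv l], [Wv k, Wv l, Wv j], [Wv l, Wv j, Wv k]}"
  unfolding nb_Tri[OF Tr_triangle[OF assms]] using Tr_sorted[OF assms] by auto

lemma cw_Tri:
  assumes "Tr j k l" shows "cw G (Tv j k l, Wv j) = (Tv j k l, Wv k)"
proof -
  have d: "vtx j \<noteq> vtx k" "vtx k \<noteq> vtx l" "vtx j \<noteq> vtx l" using Tr_vtx_distinct[OF assms] by auto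
  consider "nb (Tv j k l) = [Wv j, Wv k, Wv l]" | "nb (Tv j k l) = [Wv k, Wv l, Wv j]" |
      "nb (Tv j k l) = [Wv l, Wv j, Wv k]"
    using nb_Tv[OF assms] by blast
  hence "cycle_of_list (nb (Tv j k l)) (Wv j) = Wv k"
    using d by cases (simp_all add: transpose_def)
  thus ?thesis by simp
qed

subsection \<open>Positions of strands\<close>

definition inner :: "fraser_vertex \<Rightarrow> bool" where
  "inner u \<longleftrightarrow> (\<forall>k. u \<noteq> Bd k)"

definition off :: "fraser_dart \<Rightarrow> int" where
  "off d = offset (nb (fst d)) (\<lambda>w. int (fraser_mult r M D (fst d, w))) (snd d)"

text \<open>At a white vertex the numbering starts with the first claw edge, so positions below the
  size of the claw are claw edges.\<close>

definition pos :: "fraser_dart strand \<Rightarrow> int" where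
  "pos \<sigma> = off (fst \<sigma>) + int (snd \<sigma>)"

definition tot :: "fraser_vertex \<Rightarrow> int" where
  "tot u = sum_list (map (\<lambda>w. int (fraser_mult r M D (u, w))) (nb u))"

lemma deg_claw: "int (length (claw r M (vtx v))) = deg v"
  using length_claw[OF vtx_range[of v]] unfolding deg_def by simp

lemma map_mult_wedges: "map (\<lambda>w. int (fraser_mult r M D (Wv v, w))) (map (\<lambda>(x, y). Tv v x y)
    (take t (wedges v)))
   = map (\<lambda>(x, y). N x y) (take t (wedges v))"
proof -
  have "int (fraser_mult r M D (Wv v, Tv v x y)) = N x y" if "(x, y) \<in> set (take t (wedges v))"
      for x y
    using in_set_takeD[OF that] set_wedges mult_Tri by blast
  thus ?thesis by (auto simp del: fraser_mult.simps)
qed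

lemma map_mult_claw: "map (\<lambda>w. int (fraser_mult r M D (Wv v, w))) (map Bd ks) = replicate
    (length ks) 1"
  by (induction ks) auto

text \<open>White vertex: arcs at the claw plus arcs in the wedges. Triangle: arcs beyond the three
  sides. Either way each of the \<open>r\<close> arcs is counted once.\<close>

lemma tot_r:
  assumes "u \<in> fraser_verts r M D" "inner u" shows "tot u = int r"
  using assms(1)
proof (cases rule: verts_cases)
  case (1 k) thus ?thesis using assms(2) unfolding inner_def by auto
next
  case (2 v)
  have "tot u = deg v + N (v + 1) (v + int s - 1)"
    using map_mult_wedges[of v "length (wedges v)"] map_mult_claw[of v "claw r M (vtx v)"]
        sum_wedges[of v] deg_claw[of v]
    unfolding tot_def 2 nb_Wh map_append by (simp add: sum_list_replicate del: map_map
        fraser_mult.simps)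
  thus ?thesis using deg_N[of v] card_M by simp
next
  case (3 \<Delta>)
  obtain \<delta> where "\<delta> \<in> \<Delta>" using 3(2) unfolding triangles_def by auto
  then obtain j where j: "\<delta> = vtx j" using vtx_ex triangle_sub[OF 3(2)] by blast
  obtain k l where T: "Tr j k l" "\<Delta> = {vtx j, vtx k, vtx l}" using triangle_lift[OF 3(2)]
      \<open>\<delta> \<in> \<Delta>\<close> j by metis
  note R = Tr_rotate[OF T(1)]
  have m: "int (fraser_mult r M D (Tv j k l, Wv j)) = N k l"
      "int (fraser_mult r M D (Tv j k l, Wv k)) = N l (j + int s)"
     "int (fraser_mult r M D (Tv j k l, Wv l)) = N j k"
    using mult_Tri(2)[OF T(1)] mult_Tri(2)[OF R(3), unfolded R(1)]
        mult_Tri(2)[OF R(4), unfolded R(2), unfolded vtx_shift] by blast+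
  consider "nb (Tv j k l) = [Wv j, Wv k, Wv l]" | "nb (Tv j k l) = [Wv k, Wv l, Wv j]" |
      "nb (Tv j k l) = [Wv l, Wv j, Wv k]"
    using nb_Tv[OF T(1)] by blast
  hence "tot u = N j k + N k l + N l (j + int s)"
    using m unfolding tot_def 3 T(2) by cases (simp_all del: fraser_mult.simps)
  thus ?thesis using N_Tr[OF T(1)] card_M by simp
qed

lemma nb_mult_pos: "u \<in> fraser_verts r M D \<Longrightarrow> w \<in> set (nb u) \<Longrightarrow> 1 \<le> int (fraser_mult r M D (u, w))"
  using nb_props(2) mult_pos by fastforce

lemma dart_nb: "d \<in> fraser_darts r M D \<Longrightarrow> fst d \<in> fraser_verts r M D \<and> snd d \<in> set (nb (fst d))"
  using nb_props(2) darts_verts by (metis mem_Collect_eq prod.collapse)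

lemma off_bounds:
  assumes "d \<in> fraser_darts r M D" "inner (fst d)"
  shows "0 \<le> off d" "off d + int (fraser_mult r M D d) \<le> int r"
proof -
  note dn = dart_nb[OF assms(1)]
  note b = offset_bounds[of "nb (fst d)" "\<lambda>w. int (fraser_mult r M D (fst d, w))" "snd d"]
  show "0 \<le> off d" "off d + int (fraser_mult r M D d) \<le> int r"
    using b nb_props(1) nb_mult_pos dn tot_r[OF _ assms(2)] unfolding off_def tot_def by auto
qed

lemma cw_dart: "d \<in> fraser_darts r M D \<Longrightarrow> cw G d \<in> fraser_darts r M D"
proof -
  assume d: "d \<in> fraser_darts r M D"
  note dn = dart_nb[OF d]
  have "cycle_of_list (nb (fst d)) (snd d) \<in> set (nb (fst d))"
    using cycle_permutes[of "nb (fst d)"] dn by (simp add: permutes_in_image)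
  thus ?thesis using nb_props(2) dn by simp
qed

lemma off_cw:
  assumes "d \<in> fraser_darts r M D" "inner (fst d)"
  shows "off (cw G d) = (off d + int (fraser_mult r M D d)) mod int r"
proof -
  note dn = dart_nb[OF assms(1)]
  show ?thesis
    using offset_cycle[of "nb (fst d)" "\<lambda>w. int (fraser_mult r M D (fst d, w))" "snd d"]
        nb_props(1) nb_mult_pos dn tot_r[OF _ assms(2)]
    unfolding off_def tot_def by auto
qed

lemma strands_iff: "\<sigma> \<in> strands G \<longleftrightarrow> fst \<sigma> \<in> fraser_darts r M D \<and> snd \<sigma> < fraser_mult r M D (fst \<sigma>)"
  unfolding strands_def by (cases \<sigma>) auto

lemma pos_bounds: "\<sigma> \<in> strands G \<Longrightarrow> inner (fst (fst \<sigma>)) \<Longrightarrow> 0 \<le> pos \<sigma> \<and> pos \<sigma> < int r"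
  using off_bounds[of "fst \<sigma>"] unfolding strands_iff pos_def by auto

lemma pos_inj:
  assumes "\<sigma> \<in> strands G" "\<tau> \<in> strands G" "inner (fst (fst \<sigma>))" "fst (fst \<tau>) = fst (fst \<sigma>)"
      "pos \<sigma> = pos \<tau>"
  shows "\<sigma> = \<tau>"
proof -
  obtain u w q w' q' where e: "\<sigma> = ((u, w), q)" "\<tau> = ((u, w'), q')" using assms(4)
      by (metis prod.collapse)
  have d: "(u, w) \<in> fraser_darts r M D" "(u, w') \<in> fraser_darts r M D"
    "q < fraser_mult r M D (u, w)" "q' < fraser_mult r M D (u, w')" using assms(1,2)
        unfolding strands_iff e by auto
  have u: "u \<in> fraser_verts r M D" "w \<in> set (nb u)" "w' \<in> set (nb u)" using dart_nb[OF d(1)]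
      dart_nb[OF d(2)] by auto
  have "w = w'"
  proof (rule ccontr)
    assume ne: "w \<noteq> w'"
    have "off (u, w) + int (fraser_mult r M D (u, w)) \<le> off (u, w') \<or> off (u, w') + int
        (fraser_mult r M D (u, w')) \<le> off (u, w)"
      using offset_disjoint[OF nb_props(1)[OF u(1)] nb_mult_pos[OF u(1)] u(2,3) ne]
          unfolding off_def by simp
    thus False using assms(5) d unfolding pos_def e by auto
  qed
  thus ?thesis using assms(5) unfolding pos_def e by simp
qed

lemma strand_cw_props:
  assumes "\<sigma> \<in> strands G" "inner (fst (fst \<sigma>))"
  shows "strand_cw G \<sigma> \<in> strands G" "pos (strand_cw G \<sigma>) = (pos \<sigma> + 1) mod int r"
proof -
  have d: "fst \<sigma> \<in> fraser_darts r M D" "snd \<sigma> < fraser_mult r M D (fst \<sigma>)"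
      using assms(1) strands_iff by auto
  show "strand_cw G \<sigma> \<in> strands G"
    using d cw_dart[OF d(1)] mult_pos[OF cw_dart[OF d(1)]] unfolding strands_iff strand_cw_def
        by auto
  show "pos (strand_cw G \<sigma>) = (pos \<sigma> + 1) mod int r"
  proof (cases "snd \<sigma> + 1 < fraser_mult r M D (fst \<sigma>)")
    case True
    hence "0 \<le> off (fst \<sigma>) + int (snd \<sigma>) + 1" "off (fst \<sigma>) + int (snd \<sigma>) + 1 < int r"
        using off_bounds[OF d(1) assms(2)] by auto
    thus ?thesis using True unfolding pos_def strand_cw_def by (simp add: mod_pos_pos_trivial)
  next
    case False
    hence "int (fraser_mult r M D (fst \<sigma>)) = int (snd \<sigma>) + 1" using d by auto
    thus ?thesis using False off_cw[OF d(1) assms(2)] unfolding pos_def strand_cw_def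
        by (simp add: add.assoc)
  qed
qed

lemma strand_cw_tail [simp]: "fst (fst (strand_cw G \<sigma>)) = fst (fst \<sigma>)"
  unfolding strand_cw_def by auto

lemma strand_cw_pow_tail [simp]: "fst (fst ((strand_cw G ^^ i) \<sigma>)) = fst (fst \<sigma>)"
  by (induction i) auto

lemma strand_cw_pow:
  assumes "\<sigma> \<in> strands G" "inner (fst (fst \<sigma>))"
  shows "(strand_cw G ^^ i) \<sigma> \<in> strands G" "pos ((strand_cw G ^^ i) \<sigma>) = (pos \<sigma> + int i) mod int r"
proof (induction i)
  case 0
  show "(strand_cw G ^^ 0) \<sigma> \<in> strands G" "pos ((strand_cw G ^^ 0) \<sigma>) = (pos \<sigma> + int 0) mod int r"
    using assms pos_bounds[OF assms] by (auto simp: mod_pos_pos_trivial)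
next
  case (Suc i)
  show "(strand_cw G ^^ Suc i) \<sigma> \<in> strands G" using strand_cw_props(1)[of
      "(strand_cw G ^^ i) \<sigma>"] Suc assms by auto
  have "pos ((strand_cw G ^^ Suc i) \<sigma>) = ((pos \<sigma> + int i) mod int r + 1) mod int r"
    using strand_cw_props(2)[of "(strand_cw G ^^ i) \<sigma>"] Suc assms by auto
  also have "\<dots> = (pos \<sigma> + int (Suc i)) mod int r" by (simp add: mod_add_left_eq mod_add_right_eq
      add.assoc add.commute)
  finally show "pos ((strand_cw G ^^ Suc i) \<sigma>) = (pos \<sigma> + int (Suc i)) mod int r" .
qed

text \<open>The claw comes first, then the wedges before \<open>x\<close>, whose weights
  telescope.\<close>

lemma off_Wh_Tri:
  assumes "Tr v x y" shows "off (Wv v, Tv v x y) = deg v + N (v + 1) x"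
proof -
  have "(x, y) \<in> set (wedges v)" using assms set_wedges by auto
  then obtain t where t: "t < length (wedges v)" "wedges v ! t = (x, y)"
      by (auto simp: in_set_conv_nth)
  define L where "L = nb (Wv v)"
  define C where "C = claw r M (vtx v)"
  have L: "L = map Bd C @ map (\<lambda>(x, y). Tv v x y) (wedges v)" unfolding L_def C_def by (rule nb_Wh)
  have Wver: "Wv v \<in> fraser_verts r M D" unfolding fraser_verts_def using vtx_range[of v] by blast
  have i: "length C + t < length L" "L ! (length C + t) = Tv v x y" unfolding L using t
      by (auto simp: nth_append)
  have "off (Wv v, Tv v x y) = sum_list (map (\<lambda>w. int (fraser_mult r M D (Wv v, w))) (take
      (length C + t) L))"
    using offset_nth[OF nb_props(1)[OF Wver] i(1)[unfolded L_def]] i(2)[unfolded L_def]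
        unfolding off_def L_def by simp
  also have "take (length C + t) L = map Bd C @ map (\<lambda>(x, y). Tv v x y) (take t (wedges v))"
      unfolding L by (simp add: take_map)
  also have "sum_list (map (\<lambda>w. int (fraser_mult r M D (Wv v, w))) (map Bd C @ map (\<lambda>(x, y). Tv
      v x y) (take t (wedges v))))
    = int (length C) + sum_list (map (\<lambda>(x, y). N x y) (take t (wedges v)))"
    unfolding map_append map_mult_wedges map_mult_claw by (simp add: sum_list_replicate)
  also have "\<dots> = deg v + N (v + 1) x"
    using sum_wedges_take[of t v] deg_claw[of v] wedges_nth[OF t(1)] t length_wedges
        unfolding C_def by auto
  finally show ?thesis .
qed

lemma off_Wh_Bd:
  assumes "(Wv v, Bd k) \<in> fraser_darts r M D" shows "0 \<le> off (Wv v, Bd k)"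
      "off (Wv v, Bd k) < deg v"
proof -
  have "k \<in> set (claw r M (vtx v))" using assms set_claw[OF vtx_range[of v]] unfolding darts_iff
      by auto
  then obtain t where t: "t < length (claw r M (vtx v))" "claw r M (vtx v) ! t = k"
      by (auto simp: in_set_conv_nth)
  define L where "L = nb (Wv v)"
  define C where "C = claw r M (vtx v)"
  have L: "L = map Bd C @ map (\<lambda>(x, y). Tv v x y) (wedges v)" unfolding L_def C_def by (rule nb_Wh)
  have Wver: "Wv v \<in> fraser_verts r M D" unfolding fraser_verts_def using vtx_range[of v] by blast
  have i: "t < length L" "L ! t = Bd k" unfolding L using t unfolding C_def
      by (auto simp: nth_append)
  have "off (Wv v, Bd k) = sum_list (map (\<lambda>w. int (fraser_mult r M D (Wv v, w))) (take t L))"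
    using offset_nth[OF nb_props(1)[OF Wver] i(1)[unfolded L_def]] i(2)[unfolded L_def]
        unfolding off_def L_def by simp
  also have "take t L = map Bd (take t C)" unfolding L using t unfolding C_def
      by (simp add: take_map)
  also have "sum_list (map (\<lambda>w. int (fraser_mult r M D (Wv v, w))) (map Bd (take t C))) = int t"
    unfolding map_mult_claw using t unfolding C_def by (simp add: sum_list_replicate)
  finally show "0 \<le> off (Wv v, Bd k)" "off (Wv v, Bd k) < deg v" using t deg_claw[of v] by auto
qed

lemma off_Tri:
  assumes "Tr j k l" shows "off (Tv j k l, Wv k) = (off (Tv j k l, Wv j) + N k l) mod int r"
proof -
  have "(Tv j k l, Wv j) \<in> fraser_darts r M D" unfolding darts_iff using Tr_triangle[OF assms]
      by blast
  from off_cw[OF this] show ?thesis unfolding cw_Tri[OF assms] mult_Tri(2)[OF assms]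
      by (simp add: inner_def)
qed

subsection \<open>Well-formedness\<close>

lemma finite_verts: "finite (fraser_verts r M D)"
  unfolding fraser_verts_def using finite_triangles by auto

lemma finite_darts: "finite (fraser_darts r M D)"
  by (rule finite_subset[of _ "fraser_verts r M D \<times> fraser_verts r M D"])
      (use darts_verts finite_verts in auto)

lemma orbit_cw:
  assumes "d \<in> fraser_darts r M D" shows "orbit (cw G) d = {e \<in> fraser_darts r M D. fst e = fst d}"
proof -
  note dn = dart_nb[OF assms]
  define L where "L = map (Pair (fst d)) (nb (fst d))"
  have "orbit (cw G) d = set L"
  proof (rule orbit_cycle_list)
    show "d \<in> set L" unfolding L_def using dn by (cases d) auto
    fix k assume k: "k < length L"
    hence k': "k < length (nb (fst d))" unfolding L_def by simp
    hence "Suc k mod length (nb (fst d)) < length (nb (fst d))" by (intro mod_less_divisor) auto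
    thus "cw G (L ! k) = L ! (Suc k mod length L)"
      using cycle_of_list_nth[OF nb_props(1) k'] dn k' unfolding L_def by simp
  qed
  also have "set L = {e \<in> fraser_darts r M D. fst e = fst d}"
    unfolding L_def using nb_props(2) dn by auto
  finally show ?thesis .
qed

lemma wf_fraser: "wf_hourglass G"
  unfolding wf_hourglass_def
proof (intro conjI ballI)
  show "finite (verts G)" "finite (darts G)" using finite_verts finite_darts by auto
  show "tail G ` darts G \<subseteq> verts G" using darts_verts by auto
  show "bij_betw (cw G) (darts G) (darts G)"
  proof -
    have inj: "inj_on (cw G) (darts G)"
    proof (rule inj_onI)
      fix d e assume "d \<in> darts G" "e \<in> darts G" "cw G d = cw G e"
      hence "fst d = fst e" "cycle_of_list (nb (fst d)) (snd d) = cycle_of_list (nb (fst d))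
          (snd e)"
        by auto
      thus "d = e" using permutes_inj[OF cycle_permutes[of "nb (fst d)"]]
          by (simp add: inj_eq prod_eq_iff)
    qed
    have "cw G ` darts G \<subseteq> darts G" using cw_dart unfolding fraser_simps(2) by blast
    moreover have "finite (darts G)" using finite_darts by simp
    ultimately have "cw G ` darts G = darts G" using inj endo_inj_surj by blast
    thus ?thesis using inj unfolding bij_betw_def by blast
  qed
  show "distinct (bdry G)" by (simp add: distinct_map inj_on_def)
  show "set (bdry G) \<subseteq> verts G" unfolding fraser_simps fraser_verts_def by auto
  fix d assume d: "d \<in> darts G"
  hence d': "d \<in> fraser_darts r M D" by simp
  show "opp G d \<in> darts G" using d darts_swap by (cases d) auto
  show "opp G d \<noteq> d" using d by (cases d) (auto simp: darts_iff)
  show "opp G (opp G d) = d" by simp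
  show "orbit (cw G) d = {e \<in> darts G. tail G e = tail G d}" using orbit_cw[OF d']
      by (simp del: fraser_simps(7))
  show "1 \<le> emult G d" using mult_pos[OF d'] by simp
  show "emult G (opp G d) = emult G d" using mult_swap by (cases d) (simp del: fraser_mult.simps)
qed

lemma coloured_fraser: "properly_coloured G"
  unfolding properly_coloured_def
proof
  fix d assume "d \<in> darts G"
  thus "black G (head G d) \<noteq> black G (tail G d)" by (cases d) (auto simp: darts_iff)
qed

lemma simple_degree_fraser: "v \<in> set (bdry G) \<Longrightarrow> simple_degree G v = 1"
proof -
  assume "v \<in> set (bdry G)"
  then obtain k where k: "k \<in> {1..n}" "v = Bd k" unfolding set_bdry by auto
  hence "{d \<in> darts G. tail G d = v} = {(Bd k, Wh (cl k))}" by (auto simp: darts_iff)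
  thus ?thesis unfolding simple_degree_def by simp
qed

lemma degree_fraser: assumes "v \<in> verts G - set (bdry G)" shows "degree G v = r"
proof -
  have v: "v \<in> fraser_verts r M D" "inner v" using assms unfolding inner_def set_bdry
      by (auto simp: fraser_verts_def)
  have "{d \<in> darts G. tail G d = v} = Pair v ` set (nb v)" using nb_props(2)[OF v(1)] by auto
  hence "int (degree G v) = (\<Sum>w\<in>set (nb v). int (fraser_mult r M D (v, w)))"
    unfolding degree_def by (simp add: sum.reindex inj_on_def)
  also have "\<dots> = tot v" unfolding tot_def using nb_props(1)[OF v(1)]
      by (simp add: sum_list_distinct_conv_sum_set)
  finally show ?thesis using tot_r[OF v] by simp
qed

end

section \<open>Trip segments in Fraser graphs\<close>

text \<open>Turns determine positions only modulo \<open>r\<close>; this lemma and the next recover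
  equalities from size bounds.\<close>

lemma dvd_range_eq:
  fixes r z :: int assumes "r dvd z" "0 < z" "z < 2 * r" shows "z = r"
proof -
  obtain k where k: "z = r * k" using assms(1) by blast
  have "0 < r" using assms by auto
  hence "0 < k" "k < 2" using assms k by (auto simp: zero_less_mult_iff mult.commute)
  thus ?thesis using k by (cases "k = 1") auto
qed

lemma dvd_small_zero: fixes r z :: int assumes "r dvd z" "- r < z" "z < r" shows "z = 0"
  using assms zdvd_not_zless[of z r] zdvd_not_zless[of "-z" r] by (cases z "0 :: int"
      rule: linorder_cases) auto

context fraser
begin

abbreviation "vis \<equiv> visited G"

lemma turn_tail: "turn G i \<sigma> \<tau> \<Longrightarrow> fst (fst \<tau>) = snd (fst \<sigma>)"
proof -
  assume t: "turn G i \<sigma> \<tau>"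
  have o: "fst (fst (strand_opp G \<sigma>)) = snd (fst \<sigma>)" by (simp add: strand_opp_def)
  show ?thesis
  proof (cases "black G (snd (fst \<sigma>))")
    case True
    hence "(strand_cw G ^^ i) \<tau> = strand_opp G \<sigma>" using t unfolding turn_def by simp
    thus ?thesis using strand_cw_pow_tail[of i \<tau>] o by simp
  next
    case False
    hence "\<tau> = (strand_cw G ^^ i) (strand_opp G \<sigma>)" using t unfolding turn_def by simp
    thus ?thesis using strand_cw_pow_tail[of i "strand_opp G \<sigma>"] o by simp
  qed
qed

definition sgn_of :: "fraser_vertex \<Rightarrow> int" where
  "sgn_of u = (if black G u then - 1 else 1)"

lemma strand_opp_strands: "\<sigma> \<in> strands G \<Longrightarrow> strand_opp G \<sigma> \<in> strands G"
  unfolding strands_iff strand_opp_def using darts_swap mult_swap by (cases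
      "fst \<sigma>") (auto simp del: fraser_mult.simps)

lemma turn_inner:
  assumes "\<sigma> \<in> strands G" "turn G i \<sigma> \<tau>" shows "inner (snd (fst \<sigma>))"
proof -
  have "snd (fst \<sigma>) \<in> fraser_verts r M D" using assms(1) darts_verts unfolding strands_iff
      by (metis prod.collapse)
  moreover have "snd (fst \<sigma>) \<notin> Bd ` {1..n}" using assms(2) unfolding turn_def set_bdry by auto
  ultimately show ?thesis unfolding inner_def fraser_verts_def by auto
qed

text \<open>Positions are compared modulo \<open>r\<close>: a turn adds \<open>i\<close> at white vertices and subtracts it at black ones.\<close>

lemma turn_pos:
  assumes "\<sigma> \<in> strands G" "\<tau> \<in> strands G" "turn G i \<sigma> \<tau>"
  shows "int r dvd pos \<tau> - pos (strand_opp G \<sigma>) - sgn_of (snd (fst \<sigma>)) * int i"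
proof -
  have i: "inner (snd (fst \<sigma>))" by (rule turn_inner[OF assms(1,3)])
  have o: "strand_opp G \<sigma> \<in> strands G" "fst (fst (strand_opp G \<sigma>)) = snd (fst \<sigma>)"
    using strand_opp_strands[OF assms(1)] by (auto simp: strand_opp_def)
  show ?thesis
  proof (cases "black G (snd (fst \<sigma>))")
    case True
    hence "(strand_cw G ^^ i) \<tau> = strand_opp G \<sigma>" using assms(3) unfolding turn_def by simp
    hence "pos (strand_opp G \<sigma>) = (pos \<tau> + int i) mod int r"
      using strand_cw_pow(2)[OF assms(2)] i turn_tail[OF assms(3)] by metis
    hence "int r dvd pos \<tau> + int i - pos (strand_opp G \<sigma>)" by (simp add: dvd_minus_mod)
    thus ?thesis using True unfolding sgn_of_def by (simp add: algebra_simps)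
  next
    case False
    hence "\<tau> = (strand_cw G ^^ i) (strand_opp G \<sigma>)" using assms(3) unfolding turn_def by simp
    hence "pos \<tau> = (pos (strand_opp G \<sigma>) + int i) mod int r"
      using strand_cw_pow(2)[OF o(1)] i o(2) by metis
    hence "int r dvd pos (strand_opp G \<sigma>) + int i - pos \<tau>" by (simp add: dvd_minus_mod)
    hence "int r dvd - (pos (strand_opp G \<sigma>) + int i - pos \<tau>)" by (simp only: dvd_minus_iff)
    thus ?thesis using False unfolding sgn_of_def by (simp add: algebra_simps)
  qed
qed

lemma pos_cong:
  assumes "\<sigma> \<in> strands G" "\<tau> \<in> strands G" "inner (fst (fst \<sigma>))" "fst (fst \<tau>) = fst (fst \<sigma>)"
      "int r dvd pos \<sigma> - pos \<tau>"
  shows "\<sigma> = \<tau>"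
proof -
  have "pos \<sigma> - pos \<tau> = 0"
    using dvd_small_zero[OF assms(5)] pos_bounds[OF assms(1,3)] pos_bounds[OF assms(2)]
        assms(3,4) by auto
  thus ?thesis using pos_inj assms by auto
qed

section \<open>Turning back along an hourglass\<close>

lemma sgn_opposite: "d \<in> fraser_darts r M D \<Longrightarrow> sgn_of (fst d) = - sgn_of (snd d)"
  unfolding sgn_of_def by (cases d) (auto simp: darts_iff)

text \<open>The two ends of an hourglass have opposite colours, so the turn after a return shifts by
  the opposite of the turn that caused it, and the walk is back on its first strand.\<close>

lemma uturn_next:
  assumes "\<sigma> \<in> strands G" "\<tau> \<in> strands G" "\<upsilon> \<in> strands G" "turn G i \<sigma> \<tau>" "turn G i \<tau> \<upsilon>"
      "fst \<tau> = prod.swap (fst \<sigma>)"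
  shows "\<upsilon> = \<sigma>"
proof (rule pos_cong[OF assms(3,1)])
  obtain d q q' where e: "\<sigma> = (d, q)" "\<tau> = (prod.swap d, q')" using assms(6)
      by (cases \<sigma>; cases \<tau>) auto
  have d: "d \<in> fraser_darts r M D" using assms(1) unfolding strands_iff e by auto
  have 1: "int r dvd int q' - int q - sgn_of (snd d) * int i"
    using turn_pos[OF assms(1,2,4)] unfolding e pos_def strand_opp_def by simp
  have 2: "int r dvd pos \<upsilon> - (off d + int q') + sgn_of (snd d) * int i"
    using turn_pos[OF assms(2,3,5)] sgn_opposite[OF d] unfolding e pos_def strand_opp_def by simp
  show "int r dvd pos \<upsilon> - pos \<sigma>" using dvd_add[OF 1 2] unfolding e pos_def
      by (simp add: algebra_simps)
  show "inner (fst (fst \<upsilon>))" using turn_inner[OF assms(2,5)] turn_tail[OF assms(5)] by simp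
  show "fst (fst \<sigma>) = fst (fst \<upsilon>)" using turn_tail[OF assms(5)] assms(6) by simp
qed

lemma strand_opp_opp: "strand_opp G (strand_opp G \<sigma>) = \<sigma>"
  by (simp add: strand_opp_def)

text \<open>The cancellation of \<open>uturn_next\<close>, read backwards.\<close>

lemma uturn_prev:
  assumes "\<upsilon> \<in> strands G" "\<sigma> \<in> strands G" "\<tau> \<in> strands G" "turn G i \<upsilon> \<sigma>" "turn G i \<sigma> \<tau>"
      "fst \<tau> = prod.swap (fst \<sigma>)"
  shows "\<upsilon> = \<tau>"
proof -
  obtain d q q' where e: "\<sigma> = (d, q)" "\<tau> = (prod.swap d, q')" using assms(6)
      by (cases \<sigma>; cases \<tau>) auto
  have d: "d \<in> fraser_darts r M D" using assms(2) unfolding strands_iff e by auto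
  have 1: "int r dvd int q' - int q - sgn_of (snd d) * int i"
    using turn_pos[OF assms(2,3,5)] unfolding e pos_def strand_opp_def by simp
  have h: "snd (fst \<upsilon>) = fst d" using turn_tail[OF assms(4)] e by simp
  have 2: "int r dvd off d + int q - pos (strand_opp G \<upsilon>) + sgn_of (snd d) * int i"
    using turn_pos[OF assms(1,2,4)] sgn_opposite[OF d] unfolding h e pos_def by simp
  have "strand_opp G \<tau> = strand_opp G \<upsilon>"
  proof (rule pos_cong[OF strand_opp_strands[OF assms(3)] strand_opp_strands[OF assms(1)]])
    show "int r dvd pos (strand_opp G \<tau>) - pos (strand_opp G \<upsilon>)"
      using dvd_add[OF 1 2] unfolding e pos_def strand_opp_def by (simp add: algebra_simps)
    show "inner (fst (fst (strand_opp G \<tau>)))" using turn_inner[OF assms(1,4)] h e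
        by (simp add: strand_opp_def)
    show "fst (fst (strand_opp G \<upsilon>)) = fst (fst (strand_opp G \<tau>))" using h e
        by (simp add: strand_opp_def)
  qed
  thus ?thesis using strand_opp_opp by metis
qed

lemma trip_nth:
  assumes "trip_segment G i S"
  shows "S \<noteq> []" "m < length S \<Longrightarrow> S ! m \<in> strands G" "Suc m < length S \<Longrightarrow> turn G i (S ! m) (S !
      Suc m)"
  using assms unfolding trip_segment_def by (auto simp: successively_conv_nth)

text \<open>One return propagates in both directions: the whole segment alternates between two
  strands of one hourglass, and such walks are trivial.\<close>

lemma no_uturn:
  assumes "trip_segment G i S" "Suc m < length S" shows "fst (S ! Suc m) \<noteq> prod.swap (fst (S ! m))"
proof
  assume u: "fst (S ! Suc m) = prod.swap (fst (S ! m))"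
  define \<sigma> \<tau> where "\<sigma> = S ! m" "\<tau> = S ! Suc m"
  note T = trip_nth[OF assms(1)]
  define P where "P k \<longleftrightarrow> (S ! k = \<sigma> \<and> S ! Suc k = \<tau>) \<or> (S ! k = \<tau> \<and> S ! Suc k = \<sigma>)" for k
  have sw: "fst \<tau> = prod.swap (fst \<sigma>)" "fst \<sigma> = prod.swap (fst \<tau>)" using u unfolding \<sigma>_\<tau>_def by auto
  have up: "P (m + k)" if "Suc (m + k) < length S" for k
    using that
  proof (induction k)
    case 0 show ?case unfolding P_def \<sigma>_\<tau>_def by simp
  next
    case (Suc k)
    hence p: "P (m + k)" by simp
    have s: "S ! (m + k) \<in> strands G" "S ! Suc (m + k) \<in> strands G"
        "S ! Suc (Suc (m + k)) \<in> strands G"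
      "turn G i (S ! (m + k)) (S ! Suc (m + k))" "turn G i (S ! Suc (m + k)) (S ! Suc (Suc (m +
          k)))"
      using T(2,3) Suc.prems by auto
    have "fst (S ! Suc (m + k)) = prod.swap (fst (S ! (m + k)))" using p sw unfolding P_def by auto
    hence "S ! Suc (Suc (m + k)) = S ! (m + k)" using uturn_next[OF s] by simp
    thus ?case using p unfolding P_def by auto
  qed
  have down: "P (m - k)" for k
  proof (induction k)
    case 0 show ?case unfolding P_def \<sigma>_\<tau>_def by simp
  next
    case (Suc k)
    show ?case
    proof (cases "k < m")
      case False thus ?thesis using Suc by simp
    next
      case True
      define j where "j = m - Suc k"
      have j: "m - k = Suc j" using True unfolding j_def by auto
      have p: "P (Suc j)" using Suc j by simp
      have s: "S ! j \<in> strands G" "S ! Suc j \<in> strands G" "S ! Suc (Suc j) \<in> strands G"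
        "turn G i (S ! j) (S ! Suc j)" "turn G i (S ! Suc j) (S ! Suc (Suc j))"
        using T(2,3) assms(2) j by auto
      have "fst (S ! Suc (Suc j)) = prod.swap (fst (S ! Suc j))" using p sw unfolding P_def by auto
      hence "S ! j = S ! Suc (Suc j)" using uturn_prev[OF s] by simp
      hence "P j" using p unfolding P_def by auto
      thus ?thesis unfolding j_def .
    qed
  qed
  have "S ! k \<in> {\<sigma>, \<tau>}" if "k < length S" for k
  proof (cases "k \<le> m")
    case True
    thus ?thesis using down[of "m - k"] unfolding P_def by auto
  next
    case False
    thus ?thesis using up[of "k - Suc m"] that unfolding P_def by auto
  qed
  hence "set S \<subseteq> {\<sigma>, \<tau>}" by (metis in_set_conv_nth subsetI)
  hence "fst ` set S \<subseteq> {fst \<sigma>, opp G (fst \<sigma>)}" using sw by (auto simp del: swap_swap)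
  moreover have "length S \<ge> 2" using assms(2) by simp
  ultimately have "trivial_walk G S" unfolding trivial_walk_def by blast
  thus False using assms(1) unfolding trip_segment_def by blast
qed

lemma vis_nth:
  assumes "trip_segment G i S" "m < length S"
  shows "vis S ! m = fst (fst (S ! m))" "vis S ! Suc m = snd (fst (S ! m))"
proof -
  show 1: "vis S ! m = fst (fst (S ! m))" using assms(2) unfolding visited_def
      by (simp add: nth_append)
  show "vis S ! Suc m = snd (fst (S ! m))"
  proof (cases "Suc m < length S")
    case True
    thus ?thesis using turn_tail[OF trip_nth(3)[OF assms(1) True]] unfolding visited_def
        by (simp add: nth_append)
  next
    case False
    hence "length S = Suc m" using assms(2) by auto
    thus ?thesis unfolding visited_def using trip_nth(1)[OF assms(1)]
        by (simp add: nth_append last_conv_nth)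
  qed
qed

lemma length_vis: "length (vis S) = Suc (length S)"
  unfolding visited_def by simp

lemma vis_dart:
  assumes "trip_segment G i S" "m < length S"
  shows "fst (S ! m) = (vis S ! m, vis S ! Suc m)" "(vis S ! m, vis S ! Suc m) \<in> fraser_darts r M D"
  using vis_nth[OF assms] trip_nth(2)[OF assms] unfolding strands_iff by (simp_all add: prod_eq_iff)

lemma vis_inner:
  assumes "trip_segment G i S" "0 < m" "m < length S"
  shows "inner (vis S ! m)"
proof -
  obtain k where k: "m = Suc k" using assms(2) by (cases m) auto
  thus ?thesis using turn_inner[OF trip_nth(2)[OF assms(1), of k]
      trip_nth(3)[OF assms(1), of k]] vis_nth(2)[OF assms(1), of k] assms(3) by simp
qed

text \<open>
  A segment that enters the triangle \<open>v, x, y\<close> at \<open>v\<close> on strand \<open>p\<close> leaves it at \<open>x\<close> or at \<open>y\<close>.  In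
  both cases its next strand belongs to the region cut off by the chord from \<open>x\<close> to \<open>y\<close>, \<open>p\<close> strands
  after the beginning of that region.  This state is recorded by \<open>KS S i m x y p\<close> if the segment is
  at \<open>x\<close>, and by \<open>LS S i m y x p\<close> if it is at \<open>y\<close>.  The bounds relating \<open>p\<close> and \<open>i\<close> force the next
  triangle to be left through a corner of the same kind.
\<close>

definition KS :: "fraser_dart strand list \<Rightarrow> nat \<Rightarrow> nat \<Rightarrow> int \<Rightarrow> int \<Rightarrow> int \<Rightarrow> bool" where
  "KS S i m v y p \<longleftrightarrow> m \<le> length S \<and> vis S ! m = Wv v \<and> E v y \<and> 0 \<le> p \<and> p < N v y \<and> p < int i \<and>
     (m < length S \<longrightarrow> pos (S ! m) = deg v + N (v + 1) y + p - N v y)"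

text \<open>Around \<open>v\<close>, the region of \<open>KS\<close> ends at the chord to
  \<open>y\<close>, at position \<open>deg v + N (v + 1) y\<close>, and has \<open>N v y\<close>
  strands, some of them in the claw; subtracting gives its beginning. The region of
  \<open>LS\<close> begins at the chord to \<open>x + s\<close>, runs to the end of the fan and
  continues into the claw, hence the reduction modulo \<open>r\<close>.\<close>

definition LS :: "fraser_dart strand list \<Rightarrow> nat \<Rightarrow> nat \<Rightarrow> int \<Rightarrow> int \<Rightarrow> int \<Rightarrow> bool" where
  "LS S i m v x p \<longleftrightarrow> m \<le> length S \<and> vis S ! m = Wv v \<and> E x v \<and> 0 \<le> p \<and> p < N x v \<and> int i \<le> p +
      int r - N x v \<and>
     (m < length S \<longrightarrow> pos (S ! m) = (deg v + N (v - int s + 1) x + p) mod int r)"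

lemma LS_shift: "LS S i m (v + int s) (x + int s) p \<longleftrightarrow> LS S i m v x p"
  using N_shift(1)[of "v - int s + 1" x] unfolding LS_def by (simp add: algebra_simps)

text \<open>Clockwise from \<open>v\<close>, the triangle has blocks of \<open>N x y\<close>,
  \<open>N y (v + s)\<close> and \<open>N v x\<close> strands, towards \<open>v\<close>,
  \<open>x\<close> and \<open>y\<close>. Going back by \<open>i\<close> from strand \<open>q\<close>
  leaves the first block and ends in the block of \<open>y\<close> if
  \<open>i \<le> q + N v x\<close>, otherwise in that of \<open>x\<close>. The next white turn adds
  \<open>i\<close> again, so the offset \<open>q\<close> is kept.\<close>

lemma white_step:
  assumes T: "trip_segment G i S" and i: "1 \<le> i" "i < r" and m: "m + 2 \<le> length S"
      "vis S ! m = Wv v"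
  obtains x y q where "Tr v x y" "vis S ! Suc m = Tv v x y" "0 \<le> q" "q < N x y"
    "pos (S ! m) = deg v + N (v + 1) x + q"
    "q + N v x < int i \<and> KS S i (m + 2) x y q \<or> int i \<le> q + N v x \<and> LS S i (m + 2) y x q"
proof -
  have m1: "m < length S" "Suc m < length S" using m by auto
  note d = vis_dart[OF T m1(1)] vis_dart[OF T m1(2)]
  have inn: "inner (vis S ! Suc m)" using vis_inner[OF T, of "Suc m"] m1 by simp
  obtain \<Delta> where \<Delta>: "\<Delta> \<in> triangles D" "vtx v \<in> \<Delta>" "vis S ! Suc m = Tri \<Delta>"
    using d(2) inn unfolding m(2) darts_iff inner_def by auto
  obtain x y where T3: "Tr v x y" "\<Delta> = {vtx v, vtx x, vtx y}" using triangle_lift[OF \<Delta>(1,2)]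
      by metis
  note R = Tr_rotate[OF T3(1)] and o = Tr_less[OF T3(1)] and EE = Tr_E[OF T3(1)]
  have v1: "vis S ! Suc m = Tv v x y" using \<Delta> T3 by simp
  define q where "q = int (snd (S ! m))"
  define q' where "q' = int (snd (S ! Suc m))"
  have st: "S ! m \<in> strands G" "S ! Suc m \<in> strands G" using trip_nth(2)[OF T] m1 by auto
  have q: "0 \<le> q" "q < N x y"
    using st(1) d(1) mult_Tri(1)[OF T3(1)] unfolding strands_iff q_def m(2) v1 by auto
  have posm: "pos (S ! m) = deg v + N (v + 1) x + q"
    unfolding pos_def q_def d(1) m(2) v1 off_Wh_Tri[OF T3(1)] ..
  have tot: "N v x + N x y + N y (v + int s) = int r" using N_Tr[OF T3(1)] card_M by simp
  have oppm: "pos (strand_opp G (S ! m)) = off (Tv v x y, Wv v) + q"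
    unfolding pos_def strand_opp_def q_def d(1) m(2) v1 by simp
  have t1: "int r dvd pos (S ! Suc m) - (off (Tv v x y, Wv v) + q) + int i"
    using turn_pos[OF st trip_nth(3)[OF T m1(2)]] unfolding oppm d(1) v1 sgn_of_def by simp
  have mod_dvd: "int r dvd off (Tv v x y, Wv x) - off (Tv v x y, Wv v) - N x y"
    using off_Tri[OF T3(1)] mod_eq_dvd_iff[of "off (Tv v x y, Wv x)" "int r"
        "off (Tv v x y, Wv v) + N x y"]
    by (simp add: algebra_simps)
  have mod_dvd2: "int r dvd off (Tv v x y, Wv y) - off (Tv v x y, Wv x) - N y (v + int s)"
    using off_Tri[OF R(3), unfolded R(1)] mod_eq_dvd_iff[of "off (Tv v x y, Wv y)" "int r"
        "off (Tv v x y, Wv x) + N y (v + int s)"]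
    by (simp add: algebra_simps)
  have vr: "vis S ! (m + 2) \<in> {Wv v, Wv x, Wv y}"
    using d(4) unfolding v1 darts_iff by auto
  have "vis S ! (m + 2) \<noteq> Wv v"
    using no_uturn[OF T m1(2)] unfolding d(1,3) m(2) v1 by (simp add: numeral_2_eq_2)
  hence cs: "vis S ! (m + 2) = Wv x \<or> vis S ! (m + 2) = Wv y" using vr by auto
  have dS: "fst (S ! Suc m) = (Tv v x y, vis S ! (m + 2))" using d(3) v1
      by (simp add: numeral_2_eq_2)
  have next_pos: "int r dvd pos (S ! (m + 2)) - (off (vis S ! (m + 2), Tv v x y) + q') - int i"
      if "m + 2 < length S"
  proof -
    have "S ! (m + 2) \<in> strands G" using trip_nth(2)[OF T that] .
    moreover have "turn G i (S ! Suc m) (S ! (m + 2))" using trip_nth(3)[OF T, of "Suc m"] that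
        by (simp add: numeral_2_eq_2)
    ultimately have "int r dvd pos (S ! (m + 2)) - pos (strand_opp G (S ! Suc m)) - sgn_of (snd
        (fst (S ! Suc m))) * int i"
      using turn_pos[OF st(2)] by blast
    moreover have "sgn_of (snd (fst (S ! Suc m))) = 1" unfolding dS sgn_of_def using cs by auto
    ultimately show ?thesis unfolding pos_def strand_opp_def dS q'_def by simp
  qed
  have bnd: "0 \<le> pos (S ! (m + 2)) \<and> pos (S ! (m + 2)) < int r" if "m + 2 < length S"
  proof -
    have "inner (vis S ! (m + 2))" using cs unfolding inner_def by auto
    thus ?thesis using pos_bounds[OF trip_nth(2)[OF T that]] vis_nth(1)[OF T that] by simp
  qed
  note shiftN = N_shift(1)[of v x] N_shift(1)[of x y]
  from cs show ?thesis
  proof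
    assume vx: "vis S ! (m + 2) = Wv x"
    have q': "0 \<le> q'" "q' < N y (v + int s)"
      using st(2) mult_Tri(2)[OF R(3), unfolded R(1)] dS unfolding strands_iff vx q'_def
          by (auto simp del: fraser_mult.simps)
    have "int r dvd (q' + N x y + int i - q)"
    proof -
      have "pos (S ! Suc m) = off (Tv v x y, Wv x) + q'" unfolding pos_def dS vx q'_def by simp
      hence "int r dvd (off (Tv v x y, Wv x) + q' - (off (Tv v x y, Wv v) + q) + int i) - (off
          (Tv v x y, Wv x) - off (Tv v x y, Wv v) - N x y)"
        using dvd_diff[OF t1 mod_dvd] by simp
      thus ?thesis by (simp add: algebra_simps)
    qed
    moreover have "0 \<le> N v x" by simp
    \<comment> \<open>A multiple of \<open>r\<close> strictly between 0 and
      \<open>2 * r\<close>.\<close>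
    ultimately have "q' + N x y + int i - q = int r" by (intro dvd_range_eq)
        (use q q' i tot in linarith)+
    hence qq: "q' = int r - N x y - int i + q" by simp
    have kc: "q + N v x < int i" using q' qq tot by simp
    have "KS S i (m + 2) x y q"
      unfolding KS_def
    proof (intro conjI impI)
      show "m + 2 \<le> length S" "vis S ! (m + 2) = Wv x" "E x y" "0 \<le> q" "q < N x y"
          using m vx EE q by auto
      show "q < int i" using kc N_nonneg[of v x] by linarith
      assume l: "m + 2 < length S"
      have "off (Wv x, Tv v x y) = deg x + N (x + 1) y" using off_Wh_Tri[OF R(3)] unfolding R(1) .
      hence d: "int r dvd pos (S ! (m + 2)) - (deg x + N (x + 1) y + q - N x y) - int r"
        using next_pos[OF l] unfolding vx qq by (simp add: algebra_simps)
      hence d: "int r dvd pos (S ! (m + 2)) - (deg x + N (x + 1) y + q - N x y)"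
        by (metis dvd_add_right_iff dvd_refl diff_add_cancel add.commute)
      have "N x y \<le> deg x + N (x + 1) y" by (rule N_drop_start) (use o in auto)
      moreover have "N (x + 1) y \<le> N (x + 1) (x + int s - 1)" by (rule N_mono) (use o in auto)
      ultimately have "0 \<le> deg x + N (x + 1) y + q - N x y"
          "deg x + N (x + 1) y + q - N x y < int r"
        using deg_N[of x] card_M q by auto
      thus "pos (S ! (m + 2)) = deg x + N (x + 1) y + q - N x y"
        using dvd_small_zero[OF d] bnd[OF l] by auto
    qed
    thus ?thesis using that[of x y q] T3 v1 q posm kc by auto
  next
    assume vy: "vis S ! (m + 2) = Wv y"
    have q': "0 \<le> q'" "q' < N v x"
      using st(2) mult_Tri(2)[OF R(4), unfolded R(2), unfolded vtx_shift] dS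
          unfolding strands_iff vy q'_def by (auto simp del: fraser_mult.simps)
    have "int r dvd (q' + N x y + N y (v + int s) + int i - q)"
    proof -
      have "pos (S ! Suc m) = off (Tv v x y, Wv y) + q'" unfolding pos_def dS vy q'_def by simp
      hence "int r dvd (off (Tv v x y, Wv y) + q' - (off (Tv v x y, Wv v) + q) + int i) - (off
          (Tv v x y, Wv x) - off (Tv v x y, Wv v) - N x y) - (off (Tv v x y, Wv y) - off (Tv v x
          y, Wv x) - N y (v + int s))"
        using dvd_diff[OF dvd_diff[OF t1 mod_dvd] mod_dvd2] by simp
      thus ?thesis by (simp add: algebra_simps)
    qed
    moreover have "0 \<le> N y (v + int s)" by simp
    ultimately have "q' + N x y + N y (v + int s) + int i - q = int r" by (intro dvd_range_eq)
        (use q q' i tot in linarith)+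
    hence qq: "q' = N v x - int i + q" using tot by simp
    have lc: "int i \<le> q + N v x" using q' qq by simp
    have "LS S i (m + 2) y x q"
      unfolding LS_def
    proof (intro conjI impI)
      show "m + 2 \<le> length S" "vis S ! (m + 2) = Wv y" "E x y" "0 \<le> q" "q < N x y"
          using m vy EE q by auto
      show "int i \<le> q + int r - N x y" using lc tot N_nonneg[of y "v + int s"] by linarith
      assume l: "m + 2 < length S"
      have "off (Wv y, Tv v x y) = deg y + N (y + 1) (v + int s)"
        using off_Wh_Tri[OF R(4)] N_shift(1)[of "y - int s + 1" v] unfolding R(2)
            by (simp add: algebra_simps)
      \<comment> \<open>From \<open>y\<close> the interval runs up to \<open>x + s\<close>; the
        chord from \<open>y\<close> to \<open>v + s\<close> splits it.\<close>
      moreover have "N (y - int s + 1) x = N (y + 1) (v + int s) + N v x"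
      proof -
        have "N (y + 1) (x + int s) = N (y + 1) (v + int s) + N (v + int s) (x + int s)"
          by (rule N_split[of y]) (use E_rev(1)[OF EE(3)] o in auto)
        thus ?thesis using N_shift(1)[of "y - int s + 1" x] shiftN by (simp add: algebra_simps)
      qed
      ultimately have "int r dvd pos (S ! (m + 2)) - (deg y + N (y - int s + 1) x + q)"
        using next_pos[OF l] unfolding vy qq by (simp add: algebra_simps)
      hence "pos (S ! (m + 2)) mod int r = (deg y + N (y - int s + 1) x + q) mod int r"
          by (simp add: mod_eq_dvd_iff)
      thus "pos (S ! (m + 2)) = (deg y + N (y - int s + 1) x + q) mod int r" using bnd[OF l]
          by (simp add: mod_pos_pos_trivial)
    qed
    thus ?thesis using that[of x y q] T3 v1 q posm lc by auto
  qed
qed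

lemma wedge_chord: assumes "Tr v x y" "E v z" shows "z \<le> x \<or> y \<le> z"
  using E_noncrossing[OF assms(2) Tr_E(2)[OF assms(1)]] Tr_less[OF assms(1)] by force

text \<open>The bound \<open>p < N v y\<close> keeps the next triangle on the near side of the chord
  \<open>v y\<close>. Superadditivity gives \<open>q + N v x' \<le> p < i\<close>, which is again
  the condition for the first corner: the segment keeps turning to the same side.\<close>

lemma KS_step:
  assumes T: "trip_segment G i S" and i: "1 \<le> i" "i < r" and K: "KS S i m v y p" and m:
      "m + 2 \<le> length S"
  obtains x' y' q where "Tr v x' y'" "y' \<le> y" "vis S ! Suc m = Tv v x' y'" "0 \<le> q"
      "q = N x' y - N v y + p"
    "KS S i (m + 2) x' y' q"
proof -
  have k: "vis S ! m = Wv v" "E v y" "0 \<le> p" "p < N v y" "p < int i"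
      "pos (S ! m) = deg v + N (v + 1) y + p - N v y"
    using K m unfolding KS_def by auto
  obtain x' y' q where w: "Tr v x' y'" "vis S ! Suc m = Tv v x' y'" "0 \<le> q" "q < N x' y'"
    "pos (S ! m) = deg v + N (v + 1) x' + q"
    "q + N v x' < int i \<and> KS S i (m + 2) x' y' q \<or> int i \<le> q + N v x' \<and> LS S i (m + 2) y' x' q"
    using white_step[OF T i m k(1)] by metis
  have o: "v < x'" "x' < y'" "y' < v + int s" "v < y" "y < v + int s" using Tr_less[OF w(1)]
      E_less[OF k(2)] by auto
  have "\<not> y \<le> x'"
  proof
    assume "y \<le> x'"
    hence "N (v + 1) y \<le> N (v + 1) x'" by (intro N_mono) auto
    thus False using k w by simp
  qed
  hence y': "y' \<le> y" using wedge_chord[OF w(1) k(2)] by auto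
  have "N (v + 1) y = N (v + 1) x' + N x' y"
    by (rule N_split[OF Tr_E(1)[OF w(1)]]) (use o y' in auto)
  hence q: "q = N x' y - N v y + p" using k w by simp
  have "N v x' + N x' y \<le> N v y" by (rule N_add_le) (use o y' in auto)
  hence "KS S i (m + 2) x' y' q" using w(6) q k by auto
  thus ?thesis using that w y' q by blast
qed

text \<open>Mirror image of \<open>KS_step\<close>: the bound \<open>i \<le> p + r - N x v\<close>
  together with \<open>N_complement\<close> selects the second corner again.\<close>

lemma LS_step:
  assumes T: "trip_segment G i S" and i: "1 \<le> i" "i < r" and L: "LS S i m v x p" and m:
      "m + 2 \<le> length S"
  obtains x' y' q where "Tr x' y' v" "x \<le> x'" "vis S ! Suc m = Tv x' y' v" "0 \<le> q"
      "q = p - N x x'" "q < N x' y'"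
    "LS S i (m + 2) y' x' q"
proof -
  define X where "X = x + int s"
  have k: "vis S ! m = Wv v" "E x v" "0 \<le> p" "p < N x v" "int i \<le> p + int r - N x v"
      "pos (S ! m) = (deg v + N (v - int s + 1) x + p) mod int r"
    using L m unfolding LS_def by auto
  obtain x' y' q where w: "Tr v x' y'" "vis S ! Suc m = Tv v x' y'" "0 \<le> q" "q < N x' y'"
    "pos (S ! m) = deg v + N (v + 1) x' + q"
    "q + N v x' < int i \<and> KS S i (m + 2) x' y' q \<or> int i \<le> q + N v x' \<and> LS S i (m + 2) y' x' q"
    using white_step[OF T i m k(1)] by metis
  have EX: "E v X" unfolding X_def by (rule E_rev(1)[OF k(2)])
  have o: "v < x'" "x' < y'" "y' < v + int s" "v < X" "X < v + int s" using Tr_less[OF w(1)]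
      E_less[OF EX] by auto
  have NX: "N (v - int s + 1) x = N (v + 1) X" "N x v = N X (v + int s)"
    using N_shift(1)[of "v - int s + 1" x] N_shift(1)[of x v] unfolding X_def
        by (simp_all add: algebra_simps)
  define V where "V = deg v + N (v + 1) X + p"
  have tv: "N (v + 1) (v + int s - 1) = N (v + 1) X + N X (v + int s - 1)"
    by (rule N_split[OF EX]) (use o in auto)
  have dr: "N X (v + int s) \<le> N X (v + int s - 1) + deg v"
    using N_drop_end[of X "v + int s"] o by simp
  have dN: "deg v + N (v + 1) (v + int s - 1) = int r" using deg_N[of v] card_M by simp
  have dnn: "0 \<le> deg v" unfolding deg_def by simp
  \<comment> \<open>A position that wraps would be below \<open>deg v\<close>, hence a claw edge,
    whereas the segment goes on into a triangle.\<close>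
  have "V < int r"
  proof (rule ccontr)
    assume ge: "\<not> V < int r"
    have "V < 2 * int r"
    proof -
      have "deg v \<le> int r" using dN N_nonneg[of "v + 1" "v + int s - 1"] by linarith
      thus ?thesis unfolding V_def using k(4) NX tv dr dN by linarith
    qed
    hence "V mod int r = V - int r" using ge mod_pos_pos_trivial[of "V - int r" "int r"]
        by (simp add: mod_diff_eq[symmetric])
    hence "deg v + N (v + 1) x' + q = V - int r" using w(5) k(6) NX unfolding V_def by simp
    moreover have "V - int r < deg v" unfolding V_def using k(4) NX tv dr dN by linarith
    moreover have "0 \<le> N (v + 1) x'" by simp
    ultimately show False using w(3) by linarith
  qed
  moreover have "0 \<le> V" unfolding V_def using dnn k(3) N_nonneg[of "v + 1" X] by linarith
  ultimately have eq: "N (v + 1) x' + q = N (v + 1) X + p" using w(5) k(6) NX unfolding V_def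
      by (simp add: mod_pos_pos_trivial)
  have "\<not> y' \<le> X"
  proof
    assume "y' \<le> X"
    hence "N (v + 1) y' \<le> N (v + 1) X" by (intro N_mono) auto
    moreover have "N (v + 1) y' = N (v + 1) x' + N x' y'"
      by (rule N_split[OF Tr_E(1)[OF w(1)]]) (use o in auto)
    ultimately show False using eq w k by linarith
  qed
  hence X': "X \<le> x'" using wedge_chord[OF w(1) EX] by auto
  have "N (v + 1) x' = N (v + 1) X + N X x'"
    by (rule N_split[OF EX]) (use o X' in auto)
  hence q: "q = p - N X x'" using eq by simp
  have "int r \<le> N (v - int s) x + N x v" using N_complement[OF k(2)] card_M by simp
  moreover have "N (v - int s) x = N v X" using N_shift(1)[of "v - int s" x] unfolding X_def by simp
  moreover have "N v X + N X x' \<le> N v x'" by (rule N_add_le) (use o X' in auto)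
  ultimately have "int i \<le> q + N v x'" using q k(5) by linarith
  hence "LS S i (m + 2) y' x' q" using w(6) by auto
  hence 1: "LS S i (m + 2) (y' - int s) (x' - int s) q" using LS_shift[of S i "m + 2"
      "y' - int s" "x' - int s" q] by simp
  have 2: "Tr (x' - int s) (y' - int s) v" using Tr_rotate(4)[OF Tr_rotate(4)[OF w(1)]] by simp
  have 3: "Tv (x' - int s) (y' - int s) v = Tv v x' y'" by (simp add: insert_commute)
  have 4: "q = p - N x (x' - int s)" using q N_shift(1)[of x "x' - int s"] unfolding X_def by simp
  have 5: "q < N (x' - int s) (y' - int s)" using w(4) by simp
  show ?thesis using that[OF 2 _ _ w(3) 4 5 1] X' w(2) 3 unfolding X_def by simp
qed

section \<open>Monotone motion of the white vertices\<close>

lemma no_white_Suc: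
  assumes "trip_segment G i S" "m < length S" "vis S ! m = Wh j" shows "vis S ! Suc m \<noteq> Wh j'"
  using vis_dart(2)[OF assms(1,2)] unfolding assms(3) darts_iff by auto

text \<open>Each step replaces the interval from \<open>v\<close> to \<open>y\<close> by one inside
  it that starts strictly later.\<close>

lemma KS_zone:
  assumes T: "trip_segment G i S" and i: "1 \<le> i" "i < r"
  shows "KS S i m v y p \<Longrightarrow> m \<le> m' \<Longrightarrow> m' \<le> length S \<Longrightarrow> vis S ! m' = Wh w \<Longrightarrow>
    \<exists>v'. w = vtx v' \<and> v \<le> v' \<and> v' < y \<and> (m < m' \<longrightarrow> v < v')"
proof (induction "length S - m" arbitrary: m v y p rule: less_induct)
  case less
  have k: "vis S ! m = Wv v" "E v y" using less.prems unfolding KS_def by auto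
  consider "m' = m" | "m' = Suc m" | "m + 2 \<le> m'" using less.prems by linarith
  thus ?case
  proof cases
    case 1 thus ?thesis using less.prems k E_less[OF k(2)] by auto
  next
    case 2 thus ?thesis using no_white_Suc[OF T _ k(1)] less.prems by auto
  next
    case 3
    hence m: "m + 2 \<le> length S" using less.prems by auto
    obtain x' y' q where st: "Tr v x' y'" "y' \<le> y" "KS S i (m + 2) x' y' q"
        using KS_step[OF T i less.prems(1) m] by metis
    have "length S - (m + 2) < length S - m" using m by auto
    from less.hyps[OF this st(3) 3 less.prems(3,4)] obtain v' where "w = vtx v'" "x' \<le> v'"
        "v' < y'" by blast
    thus ?thesis using st(2) Tr_less[OF st(1)] by (intro exI[of _ v']) auto
  qed
qed

text \<open>Mirror image: the interval from \<open>x\<close> to \<open>v\<close> shrinks strictly at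
  its end \<open>v\<close>.\<close>

lemma LS_zone:
  assumes T: "trip_segment G i S" and i: "1 \<le> i" "i < r"
  shows "LS S i m v x p \<Longrightarrow> m \<le> m' \<Longrightarrow> m' \<le> length S \<Longrightarrow> vis S ! m' = Wh w \<Longrightarrow>
    \<exists>v'. w = vtx v' \<and> x < v' \<and> v' \<le> v \<and> (m < m' \<longrightarrow> v' < v)"
proof (induction "length S - m" arbitrary: m v x p rule: less_induct)
  case less
  have k: "vis S ! m = Wv v" "E x v" using less.prems unfolding LS_def by auto
  consider "m' = m" | "m' = Suc m" | "m + 2 \<le> m'" using less.prems by linarith
  thus ?case
  proof cases
    case 1 thus ?thesis using less.prems k E_less[OF k(2)] by auto
  next
    case 2 thus ?thesis using no_white_Suc[OF T _ k(1)] less.prems by auto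
  next
    case 3
    hence m: "m + 2 \<le> length S" using less.prems by auto
    obtain x' y' q where st: "Tr x' y' v" "x \<le> x'" "LS S i (m + 2) y' x' q"
        using LS_step[OF T i less.prems(1) m] by metis
    have "length S - (m + 2) < length S - m" using m by auto
    from less.hyps[OF this st(3) 3 less.prems(3,4)] obtain v' where "w = vtx v'" "x' < v'"
        "v' \<le> y'" by blast
    thus ?thesis using st(2) Tr_less[OF st(1)] by (intro exI[of _ v']) auto
  qed
qed

text \<open>From \<open>v\<close> on, the segment stays beyond the opposite side of the triangle,
  and after the next white vertex strictly between the ends of that side. The second claim excludes
  a return to the triangle.\<close>

lemma later_white:
  assumes T: "trip_segment G i S" and i: "1 \<le> i" "i < r"
    and m: "vis S ! m = Wh v" "m + 2 \<le> m'" "m' \<le> length S" "vis S ! m' = Wh w"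
  shows "w \<noteq> v" "m + 2 < m' \<Longrightarrow> vis S ! Suc m = Tri \<Delta> \<Longrightarrow> w \<notin> \<Delta>"
proof -
  have m2: "m < length S" "m + 2 \<le> length S" using m by auto
  have "Wh v \<in> fraser_verts r M D" using darts_verts[OF vis_dart(2)[OF T m2(1)]] m(1) by simp
  hence "v \<in> {1..s}" unfolding fraser_verts_def by auto
  then obtain z where z: "v = vtx z" using vtx_ex by blast
  obtain x y q where st: "Tr z x y" "vis S ! Suc m = Tv z x y"
    "q + N z x < int i \<and> KS S i (m + 2) x y q \<or> int i \<le> q + N z x \<and> LS S i (m + 2) y x q"
    using white_step[OF T i m2(2), of z] m(1) z by metis
  note o = Tr_less[OF st(1)]
  have "\<exists>v'. w = vtx v' \<and> x \<le> v' \<and> v' \<le> y \<and> (m + 2 < m' \<longrightarrow> x < v' \<and> v' < y)"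
    using st(3)
  proof (elim disjE conjE)
    assume "KS S i (m + 2) x y q"
    from KS_zone[OF T i this m(2-4)] show ?thesis by force
  next
    assume "LS S i (m + 2) y x q"
    from LS_zone[OF T i this m(2-4)] show ?thesis by force
  qed
  then obtain v' where v': "w = vtx v'" "x \<le> v'" "v' \<le> y" "m + 2 < m' \<longrightarrow> x < v' \<and> v' < y" by blast
  show "w \<noteq> v" unfolding z v'(1) using vtx_close[of v' z] v' o by auto
  show "w \<notin> \<Delta>" if "m + 2 < m'" "vis S ! Suc m = Tri \<Delta>"
    using that st(2) v' o vtx_close[of v' z] vtx_close[of v' x] vtx_close[of v' y] by auto
qed

section \<open>No vertex is visited twice\<close>

lemma vis_vert:
  assumes "trip_segment G i S" "m \<le> length S" shows "vis S ! m \<in> fraser_verts r M D"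
proof (cases "m < length S")
  case True
  thus ?thesis using darts_verts[OF vis_dart(2)[OF assms(1) True]] by simp
next
  case False
  hence "m = Suc (length S - 1)" "length S - 1 < length S"
      using assms(2) trip_nth(1)[OF assms(1)] by (auto simp: not_less)
  thus ?thesis using darts_verts[OF vis_dart(2)[OF assms(1), of "length S - 1"]] by simp
qed

lemma vis_adj:
  assumes "trip_segment G i S" "Suc m \<le> length S"
  shows "vis S ! m \<noteq> vis S ! Suc m"
    and "vis S ! m = Tri \<Delta> \<Longrightarrow> \<exists>w\<in>\<Delta>. vis S ! Suc m = Wh w"
        "vis S ! Suc m = Tri \<Delta> \<Longrightarrow> \<exists>w\<in>\<Delta>. vis S ! m = Wh w"
    and "vis S ! m = Bd k \<Longrightarrow> vis S ! Suc m = Wh (cl k)" "vis S ! Suc m = Bd k \<Longrightarrow> vis S ! m = Wh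
        (cl k)"
  using vis_dart(2)[OF assms(1), of m] assms(2) unfolding darts_iff by auto

lemma vis_no_uturn:
  assumes "trip_segment G i S" "Suc m < length S" shows "vis S ! m \<noteq> vis S ! Suc (Suc m)"
  using no_uturn[OF assms] vis_dart(1)[OF assms(1), of m] vis_dart(1)[OF assms] assms(2) by auto

text \<open>For a triangle the proof looks at the white vertex just before it, so a triangle at the
  very start is set aside.\<close>

lemma vis_neq_pos:
  assumes T: "trip_segment G i S" and i: "1 \<le> i" "i < r" and ab: "a < b" "b \<le> length S"
  shows "\<not> (vis S ! a = u \<and> vis S ! b = u \<and> (\<forall>\<Delta>. u = Tri \<Delta> \<longrightarrow> a \<noteq> 0))"
proof
  assume h: "vis S ! a = u \<and> vis S ! b = u \<and> (\<forall>\<Delta>. u = Tri \<Delta> \<longrightarrow> a \<noteq> 0)"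
  have "b \<noteq> Suc a" using vis_adj(1)[OF T, of a] h ab by auto
  hence ab2: "a + 2 \<le> b" using ab by auto
  have "b \<noteq> a + 2" using vis_no_uturn[OF T, of a] h ab by auto
  hence ab3: "a + 3 \<le> b" using ab2 by auto
  have inn: "inner (vis S ! k)" if "0 < k" "k < length S" for k using vis_inner[OF T] that by blast
  show False
  proof (cases u)
    case (Wh w)
    thus False using later_white(1)[OF T i, of a w b w] h ab2 ab by auto
  next
    case (Bd k)
    have ni: "\<not> inner (vis S ! a)" "\<not> inner (vis S ! b)" using h Bd unfolding inner_def by auto
    have "\<not> 0 < a" using inn[of a] ni ab by (meson less_le_trans)
    moreover have "\<not> b < length S" using inn[of b] ni ab
        by (meson less_le_trans le_less_trans zero_le)
    ultimately have "a = 0" "b = length S" using ab by auto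
    hence "vis S ! 1 = Wh (cl k)" "vis S ! (b - 1) = Wh (cl k)"
      using vis_adj(4)[OF T, of 0 k] vis_adj(5)[OF T, of "b - 1" k] h ab ab3 Bd by auto
    moreover have "b - 1 \<noteq> 2" using vis_adj(1)[OF T, of 1] ab ab3 calculation
        by (auto simp: numeral_2_eq_2)
    moreover have "1 + 2 \<le> b - 1" "b - 1 \<le> length S" using \<open>b - 1 \<noteq> 2\<close> ab ab3 by linarith+
    ultimately show False using later_white(1)[OF T i, of 1 "cl k" "b - 1" "cl k"] by blast
  next
    case (Tri \<Delta>)
    hence a0: "0 < a" using h by auto
    obtain v where v: "vis S ! (a - 1) = Wh v" using vis_adj(3)[OF T, of "a - 1" \<Delta>] h Tri a0 ab
        by auto
    obtain w where w: "w \<in> \<Delta>" "vis S ! (b - 1) = Wh w" using vis_adj(3)[OF T, of "b - 1" \<Delta>]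
        h Tri ab by auto
    have "a - 1 + 2 \<le> b - 1" "a - 1 + 2 < b - 1" "b - 1 \<le> length S" "Suc (a - 1) = a"
        using a0 ab ab3 by linarith+
    thus False using later_white(2)[OF T i v, of "b - 1" w \<Delta>] w h Tri by simp
  qed
qed

text \<open>Gives a starting triangle a predecessor, which removes the exception of
  \<open>vis_neq_pos\<close>.\<close>

lemma extend_back:
  assumes T: "trip_segment G i S" and t: "vis S ! 0 = Tri \<Delta>" and l: "2 \<le> length S"
  obtains \<sigma> where "trip_segment G i (\<sigma> # S)" "vis (\<sigma> # S) = fst (fst \<sigma>) # vis S"
proof -
  have S0: "S ! 0 \<in> strands G" "S \<noteq> []" using trip_nth[OF T] by auto
  have tl: "fst (fst (S ! 0)) = Tri \<Delta>" using vis_nth(1)[OF T, of 0] t S0 by simp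
  \<comment> \<open>A right turn leaves \<open>i\<close> strands counterclockwise from the arriving
    one, so the arriving strand is found \<open>i\<close> strands clockwise from the leaving
    one.\<close>
  define \<sigma> where "\<sigma> = strand_opp G ((strand_cw G ^^ i) (S ! 0))"
  have "\<sigma> \<in> strands G" unfolding \<sigma>_def
    using strand_opp_strands[OF strand_cw_pow(1)[OF S0(1)]] tl unfolding inner_def by auto
  moreover have hd: "snd (fst \<sigma>) = Tri \<Delta>" unfolding \<sigma>_def using strand_cw_pow_tail[of i "S ! 0"]
      tl by (simp add: strand_opp_def)
  have "turn G i \<sigma> (S ! 0)" unfolding turn_def fraser_simps hd using strand_opp_opp
      by (simp add: \<sigma>_def) auto
  moreover have "\<not> trivial_walk G (\<sigma> # S)"
  proof
    assume "trivial_walk G (\<sigma> # S)"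
    hence "trivial_walk G S" using l unfolding trivial_walk_def by auto
    thus False using T unfolding trip_segment_def by blast
  qed
  ultimately have "trip_segment G i (\<sigma> # S)"
    using T S0(2) unfolding trip_segment_def by (auto simp: successively_Cons hd_conv_nth)
  moreover have "vis (\<sigma> # S) = fst (fst \<sigma>) # vis S" unfolding visited_def using S0(2) by simp
  ultimately show ?thesis using that by blast
qed

lemma distinct_vis:
  assumes T: "trip_segment G i S" and i: "1 \<le> i" "i < r"
  shows "distinct (vis S)"
proof -
  have "vis S ! a \<noteq> vis S ! b" if ab: "a < b" "b \<le> length S" for a b
  proof
    assume eq: "vis S ! a = vis S ! b"
    show False
    proof (cases "a = 0 \<and> (\<exists>\<Delta>. vis S ! 0 = Tri \<Delta>)")
      case False
      thus False using vis_neq_pos[OF T i ab, of "vis S ! a"] eq by auto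
    next
      case True
      then obtain \<Delta> where \<Delta>: "vis S ! 0 = Tri \<Delta>" by blast
      have "b \<noteq> 1" using vis_adj(1)[OF T, of 0] eq ab True by auto
      hence "2 \<le> length S" using ab by auto
      then obtain \<sigma> where s: "trip_segment G i (\<sigma> # S)" "vis (\<sigma> # S) = fst (fst \<sigma>) # vis S"
          using extend_back[OF T \<Delta>] by blast
      have "Suc a < Suc b" "Suc b \<le> length (\<sigma> # S)" using ab by auto
      from vis_neq_pos[OF s(1) i this, of "vis S ! a"] show False using eq s(2) by simp
    qed
  qed
  thus ?thesis unfolding distinct_conv_nth length_vis by (metis less_Suc_eq_le linorder_neqE_nat)
qed

lemma vis_inj:
  assumes "trip_segment G i S" "1 \<le> i" "i < r" "a \<le> length S" "b \<le> length S"
      "vis S ! a = vis S ! b" shows "a = b"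
  using distinct_vis[OF assms(1-3)] assms(4-6) by (simp add: nth_eq_iff_index_eq length_vis)

subsection \<open>Two trip segments\<close>

text \<open>The same strand, measured in the smaller region of \<open>x v\<close>: the offset loses
  the \<open>N k x\<close> strands between the two chords at \<open>v\<close>.\<close>

lemma LS_rebase:
  assumes "LS T i h v k p" "k \<le> x" "x < v" "E x v" "N k x \<le> p" "p - N k x < N x v"
  shows "LS T i h v x (p - N k x)"
proof -
  have L: "E k v" "int i \<le> p + int r - N k v" using assms(1) unfolding LS_def by auto
  have o: "k < v" "v < k + int s" using E_less[OF L(1)] by auto
  have "N (v - int s + 1) x = N (v - int s + 1) k + N k x"
    by (rule N_split[OF E_rev(2)[OF L(1)]]) (use o assms in auto)
  moreover have "N k x + N x v \<le> N k v" by (rule N_add_le) (use o assms in auto)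
  ultimately show ?thesis using assms L unfolding LS_def by (auto simp: add.assoc)
qed

text \<open>The same strand, measured in the smaller region of \<open>k y\<close>. The added term is
  the distance between the beginnings of the two regions around \<open>k\<close>.\<close>

lemma KS_rebase:
  assumes "KS S i m k l p" "E k y" "y \<le> l" "0 \<le> p + N y l - N k l + N k y" "p + N y l < N k l"
  shows "KS S i m k y (p + N y l - N k l + N k y)"
proof -
  have K: "E k l" "p < int i" using assms(1) unfolding KS_def by auto
  have o: "k < l" "l < k + int s" "k < y" using E_less[OF K(1)] E_less[OF assms(2)] by auto
  have "N (k + 1) l = N (k + 1) y + N y l" by (rule N_split[OF assms(2)]) (use o assms in auto)
  moreover have "N k y + N y l \<le> N k l" by (rule N_add_le) (use o assms in auto)
  ultimately show ?thesis using assms K unfolding KS_def by auto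
qed

text \<open>
  If two segments leave a triangle through different corners of the same side, the order of their
  strands decides that at most one of them enters any later triangle, so they never meet again.
\<close>

lemma KL_disjoint:
  assumes T: "trip_segment G i S" "1 \<le> i" "i < r" and T': "trip_segment G i' S'" "1 \<le> i'" "i' < r"
  shows "KS S i m k l p \<Longrightarrow> LS S' i' h l k p' \<Longrightarrow> p \<le> p' \<Longrightarrow> m \<le> m' \<Longrightarrow> m' \<le> length S \<Longrightarrow>
    h \<le> h' \<Longrightarrow> h' \<le> length S' \<Longrightarrow> vis S ! m' = Wh w \<Longrightarrow> vis S' ! h' = Wh w \<Longrightarrow> False"
proof (induction "nat (l - k)" arbitrary: m h k l p p' rule: less_induct)
  case less
  note K = less.prems(1) and L = less.prems(2)
  have k: "vis S ! m = Wv k" "E k l" using K unfolding KS_def by auto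
  have l: "vis S' ! h = Wv l" using L unfolding LS_def by auto
  have kl: "k < l" "l < k + int s" using E_less[OF k(2)] by auto
  obtain v1 where v1: "w = vtx v1" "k \<le> v1" "v1 < l" "m < m' \<longrightarrow> k < v1"
      using KS_zone[OF T K less.prems(4,5,8)] by blast
  obtain v2 where v2: "w = vtx v2" "k < v2" "v2 \<le> l" "h < h' \<longrightarrow> v2 < l"
      using LS_zone[OF T' L less.prems(6,7,9)] by blast
  have vv: "v1 = v2" using vtx_close[of v1 v2] v1 v2 kl by auto
  have "m \<noteq> m'" using vtx_close[of v1 k] v1 v2 vv k less.prems(8) kl by auto
  moreover have "h \<noteq> h'" using vtx_close[of v2 l] v1 v2 vv l less.prems(9) kl by auto
  ultimately have mm: "m < m'" "h < h'" using less.prems(4,6) by auto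
  have "m' \<noteq> Suc m" "h' \<noteq> Suc h"
    using no_white_Suc[OF T(1) _ k(1), of w] no_white_Suc[OF T'(1) _ l, of w]
        mm less.prems(5,7,8,9) by auto
  hence m2: "m + 2 \<le> m'" "h + 2 \<le> h'" using mm by auto
  have ms: "m + 2 \<le> length S" "h + 2 \<le> length S'" using m2 less.prems(5,7) by auto
  obtain x y q where s: "Tr k x y" "y \<le> l" "0 \<le> q" "q = N x l - N k l + p" "KS S i (m + 2) x y q"
    using KS_step[OF T K ms(1)] by metis
  obtain x' y' q' where s': "Tr x' y' l" "k \<le> x'" "0 \<le> q'" "q' = p' - N k x'" "q' < N x' y'"
      "LS S' i' (h + 2) y' x' q'"
    using LS_step[OF T' L ms(2)] by metis
  obtain v3 where v3: "w = vtx v3" "x \<le> v3" "v3 < y" using KS_zone[OF T s(5) m2(1)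
      less.prems(5,8)] by blast
  obtain v4 where v4: "w = vtx v4" "x' < v4" "v4 \<le> y'" using LS_zone[OF T' s'(6) m2(2)
      less.prems(7,9)] by blast
  note o = Tr_less[OF s(1)] Tr_less[OF s'(1)] and EE = Tr_E[OF s(1)] and EE' = Tr_E[OF s'(1)]
  have "v3 = v4" using vtx_close[of v3 v4] v3 v4 kl o s s' by auto
  hence xy: "x' < y" using v3 v4 by auto
  \<comment> \<open>The ranges left to the segments overlap at \<open>w\<close>, so the chords
    \<open>k y\<close> and \<open>x' l\<close> cross unless an end of the chord \<open>k l\<close>
    is shared.\<close>
  have "x' = k \<or> y = l"
    using E_noncrossing[OF EE(3) EE'(3)] xy o s(2) s'(2) kl by force
  thus False
  proof (elim disjE)
    assume x': "x' = k"
    show False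
    proof (cases "y = l")
      case True
      \<comment> \<open>Both enter the triangle \<open>k\<close>, \<open>x\<close>,
        \<open>l\<close>. Then \<open>N k x \<le> p\<close> and \<open>p' < N k x\<close>, against
        \<open>p \<le> p'\<close>.\<close>
      have "x = y'" using apex_unique[of k x l y'] EE EE' x' True kl by auto
      have "N k x + N x l \<le> N k l" by (rule N_add_le) (use kl o True in auto)
      thus False using s s' x' less.prems(3) \<open>x = y'\<close> by auto
    next
      case False
      hence yl: "y < l" using s(2) by auto
      have "\<not> y' < y" using E_noncrossing[OF EE(3) EE'(2)] yl o kl x' by auto
      hence yy: "y \<le> y'" by simp
      \<comment> \<open>The shorter chord \<open>k y'\<close> takes over the role of
        \<open>k l\<close>: \<open>S\<close> is measured anew against it without moving, and
        \<open>S'\<close> has just arrived at \<open>y'\<close>.\<close>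
      define p2 where "p2 = p + N y' l - N k l + N k y'"
      have "N k y' + N y' l \<le> N k l" by (rule N_add_le) (use kl o x' in auto)
      hence lt: "p + N y' l < N k l" using s' x' less.prems(3) by auto
      have Ek: "E k y'" using EE'(1) x' by simp
      have "N x l = N x y' + N y' l" by (rule N_split[OF Ek]) (use o yy kl x' in auto)
      moreover have "N x y' \<le> N k y'" by (rule N_mono) (use o in auto)
      ultimately have "0 \<le> p2" using s unfolding p2_def by auto
      hence K2: "KS S i m k y' p2" unfolding p2_def by (intro KS_rebase[OF K Ek])
          (use o lt x' in auto)
      have "p2 \<le> q'" using s' x' less.prems(3) \<open>N k y' + N y' l \<le> N k l\<close> unfolding p2_def by auto
      moreover have "nat (y' - k) < nat (l - k)" using o x' by auto
      ultimately show False using less.hyps[OF _ K2] s'(6) less.prems(4,5,7,8,9) m2(2) x' by blast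
    qed
  next
    assume y: "y = l"
    show False
    proof (cases "x' = k")
      case True
      have "x = y'" using apex_unique[of k x l y'] EE EE' True y kl by auto
      have "N k x + N x l \<le> N k l" by (rule N_add_le) (use kl o y in auto)
      thus False using s s' True less.prems(3) \<open>x = y'\<close> by auto
    next
      case False
      have "\<not> x' < x" using E_noncrossing[OF EE(1) EE'(3)] False s'(2) o y kl by auto
      hence xx: "x \<le> x'" by simp
      have Ex: "E x l" using EE(2) y by simp
      have 1: "N k x' = N k x + N x x'"
        by (rule N_split[OF E_rev(2)[OF Ex]]) (use o s'(2) xx kl in auto)
      have 2: "N x x' + N x' y' \<le> N x l"
      proof -
        have "N x x' + N x' y' \<le> N x y'" by (rule N_add_le) (use o xx kl in auto)
        moreover have "N x y' \<le> N x l" by (rule N_mono) (use o in auto)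
        ultimately show ?thesis by simp
      qed
      have 3: "N k x \<le> p'" using s'(3,4) 1 N_nonneg[of x x'] by linarith
      have L2: "LS S' i' h l x (p' - N k x)"
        by (rule LS_rebase[OF L]) (use o Ex s' 1 2 3 y in auto)
      have K2: "KS S i (m + 2) x l q" using s(5) y by simp
      have "N k x + N x l \<le> N k l" by (rule N_add_le) (use kl o y in auto)
      hence "q \<le> p' - N k x" using s less.prems(3) by auto
      moreover have "nat (l - x) < nat (l - k)" using o y by auto
      ultimately show False using less.hyps[OF _ K2 L2] less.prems(5-9) m2(1) by blast
    qed
  qed
qed

text \<open>
  \<open>S\<close> and \<open>S'\<close> come from a common white vertex, through two adjacent triangles, to the common
  corner of these triangles, and turn away from each other there.
\<close>

definition bounce :: "fraser_dart strand list \<Rightarrow> nat \<Rightarrow> nat \<Rightarrow> fraser_dart strand list \<Rightarrow> nat \<Rightarrow> nat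
    \<Rightarrow> bool" where
  "bounce S i m S' i' h \<longleftrightarrow> (\<exists>v x y y' q q'. Tr v x y \<and> Tr v y y' \<and> 0 < m \<and> 0 < h \<and>
     vis S ! (m - 1) = Tv v x y \<and> vis S' ! (h - 1) = Tv v y y' \<and> LS S i m y x q \<and> KS S' i' h y
         y' q')"

text \<open>The segments take different wedges at \<open>v\<close>, so the regions beyond share at
  most the corner \<open>y = x'\<close>. A segment can be there only directly after its triangle:
  \<open>S\<close> at its second corner, \<open>S'\<close> at its first.\<close>

lemma meet_wedges:
  assumes T: "trip_segment G i S" "1 \<le> i" "i < r" and T': "trip_segment G i' S'" "1 \<le> i'" "i' < r"
    and w: "Tr v x y" "vis S ! Suc m = Tv v x y"
      "q + N v x < int i \<and> KS S i (m + 2) x y q \<or> int i \<le> q + N v x \<and> LS S i (m + 2) y x q"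
    and w': "Tr v x' y'" "vis S' ! Suc h = Tv v x' y'"
      "q' + N v x' < int i' \<and> KS S' i' (h + 2) x' y' q' \<or> int i' \<le> q' + N v x' \<and> LS S' i' (h +
          2) y' x' q'"
    and m: "m + 2 \<le> m'" "m' \<le> length S" "vis S ! m' = Wh u" and h: "h + 2 \<le> h'" "h' \<le> length S'"
        "vis S' ! h' = Wh u"
    and yx: "y \<le> x'"
  shows "m' = m + 2 \<and> h' = h + 2 \<and> bounce S i m' S' i' h'"
proof -
  note o = Tr_less[OF w(1)] Tr_less[OF w'(1)]
  have z1: "\<exists>v1. u = vtx v1 \<and> x \<le> v1 \<and> v1 \<le> y \<and> (v1 = y \<longrightarrow> m' = m + 2 \<and> LS S i (m + 2) y x q)"
    using w(3)
  proof (elim disjE conjE)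
    assume "KS S i (m + 2) x y q"
    from KS_zone[OF T this m] show ?thesis by force
  next
    assume L: "LS S i (m + 2) y x q"
    from LS_zone[OF T L m] obtain v1 where v1: "u = vtx v1" "x < v1" "v1 \<le> y"
        "m + 2 < m' \<longrightarrow> v1 < y" by blast
    thus ?thesis using L m(1) by (intro exI[of _ v1]) auto
  qed
  have z2: "\<exists>v2. u = vtx v2 \<and> x' \<le> v2 \<and> v2 \<le> y' \<and> (v2 = x' \<longrightarrow> h' = h + 2 \<and> KS S' i' (h + 2) x' y'
      q')"
    using w'(3)
  proof (elim disjE conjE)
    assume K: "KS S' i' (h + 2) x' y' q'"
    from KS_zone[OF T' K h] obtain v2 where v2: "u = vtx v2" "x' \<le> v2" "v2 < y'"
        "h + 2 < h' \<longrightarrow> x' < v2" by blast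
    thus ?thesis using K h(1) by (intro exI[of _ v2]) auto
  next
    assume "LS S' i' (h + 2) y' x' q'"
    from LS_zone[OF T' this h] show ?thesis by force
  qed
  obtain v1 where v1: "u = vtx v1" "x \<le> v1" "v1 \<le> y" "v1 = y \<longrightarrow> m' = m + 2 \<and> LS S i (m + 2) y x
      q" using z1 by blast
  obtain v2 where v2: "u = vtx v2" "x' \<le> v2" "v2 \<le> y'" "v2 = x' \<longrightarrow> h' = h + 2 \<and> KS S' i' (h + 2)
      x' y' q'" using z2 by blast
  have "v1 = v2" using vtx_close[of v1 v2] v1 v2 o yx by auto
  hence e: "v1 = y" "v2 = x'" "x' = y" using v1 v2 yx by auto
  have 1: "m' = m + 2" "LS S i (m + 2) y x q" using v1(4) e by auto
  have 2: "h' = h + 2" "KS S' i' (h + 2) y y' q'" using v2(4) e by auto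
  have "bounce S i m' S' i' h'"
    unfolding bounce_def 1(1) 2(1)
    by (rule exI[of _ v], rule exI[of _ x], rule exI[of _ y], rule exI[of _ y'], rule exI[of _
        q], rule exI[of _ q'])
      (use w w' 1 2 e in auto)
  thus ?thesis using 1 2 by blast
qed

text \<open>Three cases: both segments use the same two edges; they enter different triangles, and
  \<open>meet_wedges\<close> applies; or they part inside a common triangle, and
  \<open>KL_disjoint\<close> excludes another meeting.\<close>

lemma meet_step:
  assumes T: "trip_segment G i S" "1 \<le> i" "i < r" and T': "trip_segment G i' S'" "1 \<le> i'" "i' < r"
    and ii: "i' = i \<or> i' = i + 1"
    and v: "vis S ! m = Wh j" "vis S' ! h = Wh j"
    and m: "m < m'" "m' \<le> length S" "vis S ! m' = Wh u" and h: "h < h'" "h' \<le> length S'"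
        "vis S' ! h' = Wh u"
  shows "(m + 2 \<le> m' \<and> h + 2 \<le> h' \<and> fst (S ! m) = fst (S' ! h) \<and> fst (S ! Suc m) = fst (S' ! Suc
      h)) \<or>
    bounce S i m' S' i' h' \<or> bounce S' i' h' S i m'"
proof -
  have "Wh j \<in> fraser_verts r M D" using vis_vert[OF T(1), of m] m v by simp
  hence "j \<in> {1..s}" unfolding fraser_verts_def by auto
  then obtain z where z: "j = vtx z" using vtx_ex by blast
  note v = v[unfolded z]
  have "m' \<noteq> Suc m" "h' \<noteq> Suc h"
    using no_white_Suc[OF T(1) _ v(1), of u] no_white_Suc[OF T'(1) _ v(2), of u] m h by auto
  hence m2: "m + 2 \<le> m'" "h + 2 \<le> h'" using m(1) h(1) by auto
  hence l: "m + 2 \<le> length S" "h + 2 \<le> length S'" using m(2) h(2) by auto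
  obtain x y q where w: "Tr z x y" "vis S ! Suc m = Tv z x y"
      "q + N z x < int i \<and> KS S i (m + 2) x y q \<or> int i \<le> q + N z x \<and> LS S i (m + 2) y x q"
    using white_step[OF T l(1) v(1)] by metis
  obtain x' y' q' where w': "Tr z x' y'" "vis S' ! Suc h = Tv z x' y'"
      "q' + N z x' < int i' \<and> KS S' i' (h + 2) x' y' q' \<or> int i' \<le> q' + N z x' \<and> LS S' i' (h +
          2) y' x' q'"
    using white_step[OF T' l(2) v(2)] by metis
  note o = Tr_less[OF w(1)] Tr_less[OF w'(1)]
  have cases: "y \<le> x' \<or> y' \<le> x \<or> (x = x' \<and> y = y')"
    using wedge_chord[OF w(1), of x'] wedge_chord[OF w(1), of y'] wedge_chord[OF w'(1), of x]
        wedge_chord[OF w'(1), of y]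
      Tr_E[OF w(1)] Tr_E[OF w'(1)] o by linarith
  show ?thesis
  proof (cases "y \<le> x' \<or> y' \<le> x")
    case True
    thus ?thesis
    proof
      assume "y \<le> x'"
      thus ?thesis using meet_wedges[OF T T' w w' m2(1) m(2,3) m2(2) h(2,3)] by blast
    next
      assume "y' \<le> x"
      thus ?thesis using meet_wedges[OF T' T w' w m2(2) h(2,3) m2(1) m(2,3)] by blast
    qed
  next
    case False
    hence e: "x' = x" "y' = y" using cases by auto
    note w' = w'[unfolded e]
    have d1: "fst (S ! m) = fst (S' ! h)"
      using vis_dart(1)[OF T(1), of m] vis_dart(1)[OF T'(1), of h] l v w(2) w'(2) by auto
    have KK: "vis S ! (m + 2) = vis S' ! (h + 2)"
    proof (rule ccontr)
      assume ne: "vis S ! (m + 2) \<noteq> vis S' ! (h + 2)"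
      consider "q + N z x < int i" "KS S i (m + 2) x y q" "int i' \<le> q' + N z x"
          "LS S' i' (h + 2) y x q'"
        | "q' + N z x < int i'" "KS S' i' (h + 2) x y q'" "int i \<le> q + N z x" "LS S i (m + 2) y x q"
        using w(3) w'(3) ne unfolding KS_def LS_def by fastforce
      thus False
      proof cases
        case 1
        have "q \<le> q'" using 1 ii by auto
        thus False using KL_disjoint[OF T T' 1(2,4) _ m2(1) m(2) m2(2) h(2) m(3) h(3)] by blast
      next
        case 2
        \<comment> \<open>Here \<open>i' = i + 1\<close> is the extreme case:
          \<open>q' + N z x < i'\<close> still gives \<open>q' + N z x \<le> i\<close>, and
          \<open>i \<le> q + N z x\<close>.\<close>
        have "q' \<le> q" using 2 ii by auto
        thus False using KL_disjoint[OF T' T 2(2,4) _ m2(2) h(2) m2(1) m(2) h(3) m(3)] by blast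
      qed
    qed
    have "fst (S ! Suc m) = fst (S' ! Suc h)"
      using vis_dart(1)[OF T(1), of "Suc m"] vis_dart(1)[OF T'(1), of "Suc h"] l w(2) w'(2) KK
          by (auto simp: numeral_2_eq_2)
    thus ?thesis using d1 m2 by blast
  qed
qed

text \<open>Iterates \<open>meet_step\<close> along common white vertices; since no vertex is
  repeated, both segments reach the target after the same step.\<close>

lemma meets:
  assumes T: "trip_segment G i S" "1 \<le> i" "i < r" and T': "trip_segment G i' S'" "1 \<le> i'" "i' < r"
    and ii: "i' = i \<or> i' = i + 1"
    and u: "m' \<le> length S" "vis S ! m' = Wh u" "h' \<le> length S'" "vis S' ! h' = Wh u"
  shows "vis S ! m = Wh j \<Longrightarrow> vis S' ! h = Wh j \<Longrightarrow> m < m' \<Longrightarrow> h < h' \<Longrightarrow>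
    (\<forall>c. m \<le> c \<and> c < m' \<longrightarrow> fst (S ! c) \<in> fst ` set S') \<or> bounce S i m' S' i' h' \<or> bounce S' i' h'
        S i m'"
proof (induction "m' - m" arbitrary: m h j rule: less_induct)
  case less
  from meet_step[OF T T' ii less.prems(1,2) less.prems(3) u(1,2) less.prems(4) u(3,4)]
  show ?case
  proof (elim disjE)
    assume e: "m + 2 \<le> m' \<and> h + 2 \<le> h' \<and> fst (S ! m) = fst (S' ! h) \<and> fst (S ! Suc m) = fst (S'
        ! Suc h)"
    hence l: "Suc m < length S" "Suc h < length S'" using u by auto
    have i2: "fst (S ! m) \<in> fst ` set S'" "fst (S ! Suc m) \<in> fst ` set S'" using e l by auto
    have v2: "vis S ! (m + 2) = vis S' ! (h + 2)"
      using vis_nth(2)[OF T(1) l(1)] vis_nth(2)[OF T'(1) l(2)] e by (simp add: numeral_2_eq_2)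
    have "m + 2 = m' \<longleftrightarrow> h + 2 = h'"
      using vis_inj[OF T, of "m + 2" m'] vis_inj[OF T', of "h + 2" h'] v2 u e by auto
    then consider "m' = m + 2" | "m + 2 < m'" "h + 2 < h'" using e by linarith
    thus ?thesis
    proof cases
      case 1
      hence "c = m \<or> c = Suc m" if "m \<le> c" "c < m'" for c using that by auto
      thus ?thesis using i2 by blast
    next
      case 2
      have "\<exists>j'. vis S ! (m + 2) = Wh j'"
      proof -
        have "inner (vis S ! Suc m)" by (rule vis_inner[OF T(1)]) (use l in auto)
        then obtain \<Delta> where "vis S ! Suc m = Tri \<Delta>"
          using vis_dart(2)[OF T(1), of m] l less.prems(1) unfolding darts_iff inner_def by auto
        thus ?thesis using vis_adj(2)[OF T(1), of "Suc m" \<Delta>] l by (auto simp: numeral_2_eq_2)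
      qed
      then obtain j' where j': "vis S ! (m + 2) = Wh j'" by blast
      have "m' - (m + 2) < m' - m" using 2 by auto
      from less.hyps[OF this j' j'[unfolded v2] 2] show ?thesis
      proof (elim disjE)
        assume a: "\<forall>c. m + 2 \<le> c \<and> c < m' \<longrightarrow> fst (S ! c) \<in> fst ` set S'"
        have "fst (S ! c) \<in> fst ` set S'" if "m \<le> c" "c < m'" for c
        proof -
          have "c = m \<or> c = Suc m \<or> m + 2 \<le> c" using that by auto
          thus ?thesis using i2 a that by blast
        qed
        thus ?thesis by blast
      qed blast+
    qed
  qed blast+
qed

subsection \<open>Essential intersections contain a common white vertex\<close>

lemma traversed_iff: "d \<in> traversed G S \<longleftrightarrow> (\<exists>m<length S. d = fst (S ! m) \<or> d = prod.swap (fst (S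
    ! m)))"
proof -
  have "set S = (\<lambda>m. S ! m) ` {..<length S}" by (auto simp: set_conv_nth)
  hence "traversed G S = (\<lambda>m. fst (S ! m)) ` {..<length S} \<union> (\<lambda>m. prod.swap (fst (S ! m))) `
      {..<length S}"
    unfolding traversed_def by (simp add: image_image)
  thus ?thesis by auto
qed

lemma traversed_swap: "d \<in> traversed G S \<Longrightarrow> prod.swap d \<in> traversed G S"
  unfolding traversed_iff by (elim exE conjE disjE, rule_tac x = m in exI, simp, rule_tac x = m
      in exI, simp)

lemma traversed_step:
  assumes "trip_segment G i S" "m < length S"
  shows "(vis S ! m, vis S ! Suc m) \<in> traversed G S" "(vis S ! Suc m, vis S ! m) \<in> traversed G S"
proof -
  show 1: "(vis S ! m, vis S ! Suc m) \<in> traversed G S"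
    unfolding traversed_iff vis_dart(1)[OF assms, symmetric] using assms(2) by blast
  show "(vis S ! Suc m, vis S ! m) \<in> traversed G S" using traversed_swap[OF 1] by simp
qed

lemma shared_swap: "d \<in> shared G S S' \<Longrightarrow> prod.swap d \<in> shared G S S'"
  unfolding shared_def using traversed_swap by blast

lemma shared_sym: "shared G S S' = shared G S' S"
  unfolding shared_def by auto

lemma traversed_at:
  assumes T: "trip_segment G i S" "1 \<le> i" "i < r" and d: "d \<in> traversed G S" "fst d = vis S ! m"
      "m \<le> length S"
  shows "m < length S \<and> d = fst (S ! m) \<and> snd d = vis S ! Suc m \<or> 0 < m \<and> d = prod.swap (fst (S
      ! (m - 1))) \<and> snd d = vis S ! (m - 1)"
proof -
  obtain c where c: "c < length S" "d = fst (S ! c) \<or> d = prod.swap (fst (S ! c))"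
      using d(1) traversed_iff by blast
  note vd = vis_dart(1)[OF T(1) c(1)]
  from c(2) show ?thesis
  proof
    assume e: "d = fst (S ! c)"
    hence "c = m" using vis_inj[OF T, of c m] vd d c by auto
    thus ?thesis using e c vd by auto
  next
    assume e: "d = prod.swap (fst (S ! c))"
    hence "Suc c = m" using vis_inj[OF T, of "Suc c" m] vd d c by auto
    thus ?thesis using e c vd by auto
  qed
qed

text \<open>The walk passes each vertex once and its edges just outside a stretch are not in
  \<open>X\<close>; so no edge of \<open>X\<close> leads out of the stretch.\<close>

lemma stretch_closed:
  assumes T: "trip_segment G i S" "1 \<le> i" "i < r" and st: "stretch X S a b"
    and X: "X \<subseteq> traversed G S" "\<And>d. d \<in> X \<Longrightarrow> prod.swap d \<in> X"
    and d: "d \<in> X" "fst d = vis S ! m" "a \<le> m" "m \<le> b"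
  shows "\<exists>m'. a \<le> m' \<and> m' \<le> b \<and> snd d = vis S ! m'"
proof -
  have b: "b \<le> length S" "a = 0 \<or> fst (S ! (a - 1)) \<notin> X" "b = length S \<or> fst (S ! b) \<notin> X"
      using st unfolding stretch_def by auto
  from traversed_at[OF T _ d(2)] X(1) d(1,4) b(1) have
    "m < length S \<and> d = fst (S ! m) \<and> snd d = vis S ! Suc m \<or> 0 < m \<and> d = prod.swap (fst (S ! (m
        - 1))) \<and> snd d = vis S ! (m - 1)" by auto
  thus ?thesis
  proof (elim disjE conjE)
    assume h: "m < length S" "d = fst (S ! m)" "snd d = vis S ! Suc m"
    hence "m \<noteq> b" using b d by auto
    thus ?thesis using h d by (intro exI[of _ "Suc m"]) auto
  next
    assume h: "0 < m" "d = prod.swap (fst (S ! (m - 1)))" "snd d = vis S ! (m - 1)"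
    hence "fst (S ! (m - 1)) \<in> X" using X(2)[OF d(1)] by simp
    hence "m \<noteq> a" using b h by auto
    thus ?thesis using h d by (intro exI[of _ "m - 1"]) auto
  qed
qed

text \<open>Skipping moves only along edges of \<open>X\<close>, hence stays in a set closed under
  them.\<close>

lemma contracted_cw_tail:
  assumes V: "\<And>d. d \<in> X \<Longrightarrow> fst d \<in> V \<Longrightarrow> snd d \<in> V" and e: "fst e \<in> V"
  shows "fst (contracted_cw G X e) \<in> V"
proof -
  define sk where "sk = (\<lambda>e. cw G (opp G e))"
  define K where "K = (LEAST k. (sk ^^ k) (cw G e) \<notin> X)"
  have "k \<le> K \<Longrightarrow> fst ((sk ^^ k) (cw G e)) \<in> V" for k
  proof (induction k)
    case 0 thus ?case using e by simp
  next
    case (Suc k)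
    have "(sk ^^ k) (cw G e) \<in> X" using not_less_Least[of k "\<lambda>k. (sk ^^ k) (cw G e) \<notin> X"]
        Suc.prems unfolding K_def by auto
    hence "snd ((sk ^^ k) (cw G e)) \<in> V" using V Suc by auto
    thus ?case by (simp add: sk_def)
  qed
  thus ?thesis unfolding contracted_cw_def Let_def sk_def[symmetric] K_def[symmetric] by simp
qed

lemma contracted_cw_pow_tail:
  assumes V: "\<And>d. d \<in> X \<Longrightarrow> fst d \<in> V \<Longrightarrow> snd d \<in> V" and e: "fst e \<in> V"
  shows "fst ((contracted_cw G X ^^ k) e) \<in> V"
  by (induction k) (use e contracted_cw_tail[OF V] in auto)

lemma card_triangle: "\<Delta> \<in> triangles D \<Longrightarrow> card \<Delta> = 3"
proof -
  assume "\<Delta> \<in> triangles D"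
  then obtain a b c where "\<Delta> = {a, b, c}" "(a, b) \<in> D" "(b, c) \<in> D" unfolding triangles_def by blast
  moreover from this have "a < b" "b < c" using Dchords unfolding chords_def by auto
  ultimately show ?thesis by simp
qed

text \<open>At a crossing, rotation in the contracted graph leads from the dart of \<open>S\<close>
  to that of \<open>S'\<close>, so the vertex where \<open>S'\<close> enters its stretch also lies
  in the stretch of \<open>S\<close>. If it is a triangle, each segment uses two of its three edges;
  a common edge is contracted, and its white end lies in both stretches. A common boundary vertex
  leads to its white neighbour in the same way.\<close>

lemma essential_meet:
  assumes T: "trip_segment G i S" "1 \<le> i" "i < r" and T': "trip_segment G i' S'" "1 \<le> i'" "i' < r"
    and es: "essential_at G S S' a b c d"
  shows "\<exists>m h w. a \<le> m \<and> m \<le> b \<and> c \<le> h \<and> h \<le> d \<and> vis S ! m = Wh w \<and> vis S' ! h = Wh w"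
proof -
  define X where "X = shared G S S'"
  have st: "stretch X S a b" "stretch X S' c d" using es unfolding essential_at_def X_def by auto
  have X1: "X \<subseteq> traversed G S" "X \<subseteq> traversed G S'" unfolding X_def shared_def by auto
  have X2: "prod.swap e \<in> X" if "e \<in> X" for e using shared_swap that unfolding X_def by blast
  have cl1: "\<exists>m'. a \<le> m' \<and> m' \<le> b \<and> snd e = vis S ! m'" if "e \<in> X" "fst e = vis S ! m" "a \<le> m"
      "m \<le> b" for e m
    by (rule stretch_closed[OF T st(1) X1(1) _ that]) (rule X2)
  have cl2: "\<exists>m'. c \<le> m' \<and> m' \<le> d \<and> snd e = vis S' ! m'" if "e \<in> X" "fst e = vis S' ! m" "c \<le> m"
      "m \<le> d" for e m
    by (rule stretch_closed[OF T' st(2) X1(2) _ that]) (rule X2)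
  have b: "a \<le> b" "b \<le> length S" "c \<le> d" "d \<le> length S'" using st unfolding stretch_def by auto
  \<comment> \<open>An edge of \<open>X\<close> at a vertex common to both stretches has its other
    end in both as well.\<close>
  have fin: ?thesis if h: "e \<in> X" "fst e = vis S ! m" "a \<le> m" "m \<le> b" "fst e = vis S' ! h"
      "c \<le> h" "h \<le> d" "snd e = Wh w" for e m h w
  proof -
    obtain m' where "a \<le> m'" "m' \<le> b" "snd e = vis S ! m'" using cl1[OF h(1-4)] by blast
    moreover obtain h' where "c \<le> h'" "h' \<le> d" "snd e = vis S' ! h'" using cl2[OF h(1,5-7)] by blast
    ultimately show ?thesis using h(8) by (intro exI[of _ m'] exI[of _ h'] exI[of _ w]) simp
  qed
  from es consider "cross_at G S S' a b c d" | "endpoints_in G S a b \<inter> endpoints_in G S' c d \<inter>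
      set (bdry G) \<noteq> {}"
    unfolding essential_at_def by blast
  thus ?thesis
  proof cases
    case 1
    define f where "f = contracted_cw G X"
    define x where "x = opp G (fst (S ! (a - 1)))"
    define y where "y = opp G (fst (S' ! (c - 1)))"
    have cr: "0 < a" "b < length S" "0 < c" "d < length S'"
        "\<exists>x' y'. in_cyclic_order f x y x' y' \<or> in_cyclic_order f x y' x' y"
      using 1 unfolding cross_at_def Let_def f_def X_def x_def y_def by blast+
    then obtain k where k: "(f ^^ k) x = y" unfolding in_cyclic_order_def by blast
    have xt: "fst x = vis S ! a" using vis_nth(2)[OF T(1), of "a - 1"] cr b unfolding x_def by simp
    have yt: "fst y = vis S' ! c" using vis_nth(2)[OF T'(1), of "c - 1"] cr b unfolding y_def
        by simp
    define V where "V = {vis S ! m | m. a \<le> m \<and> m \<le> b}"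
    have "fst ((f ^^ k) x) \<in> V"
      unfolding f_def
    proof (rule contracted_cw_pow_tail)
      show "fst x \<in> V" using xt b unfolding V_def by auto
      show "snd e \<in> V" if "e \<in> X" "fst e \<in> V" for e using cl1[of e] that unfolding V_def by auto
    qed
    then obtain m where m: "a \<le> m" "m \<le> b" "vis S ! m = vis S' ! c" using k yt unfolding V_def
        by auto
    show ?thesis
    proof (cases "vis S ! m")
      case (Wh w)
      thus ?thesis using m b by (intro exI[of _ m] exI[of _ c] exI[of _ w]) auto
    next
      case (Bd k)
      thus ?thesis using vis_inner[OF T(1), of m] m cr unfolding inner_def by auto
    next
      case (Tri \<Delta>)
      have ml: "0 < m" "m < length S" "c < length S'" using m cr b by auto
      have "\<Delta> \<in> triangles D" using vis_vert[OF T(1), of m] Tri ml unfolding fraser_verts_def by auto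
      hence c3: "card \<Delta> = 3" "finite \<Delta>" using card_triangle triangle_sub by auto
      obtain w1 where w1: "w1 \<in> \<Delta>" "vis S ! (m - 1) = Wh w1" using vis_adj(3)[OF T(1), of
          "m - 1" \<Delta>] Tri ml by auto
      obtain w2 where w2: "w2 \<in> \<Delta>" "vis S ! Suc m = Wh w2" using vis_adj(2)[OF T(1), of m \<Delta>]
          Tri ml by auto
      obtain w3 where w3: "w3 \<in> \<Delta>" "vis S' ! (c - 1) = Wh w3" using vis_adj(3)[OF T'(1), of
          "c - 1" \<Delta>] Tri m(3) ml cr by auto
      obtain w4 where w4: "w4 \<in> \<Delta>" "vis S' ! Suc c = Wh w4" using vis_adj(2)[OF T'(1), of c \<Delta>]
          Tri m(3) ml by auto
      have n12: "w1 \<noteq> w2" using vis_no_uturn[OF T(1), of "m - 1"] w1 w2 ml by auto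
      have n34: "w3 \<noteq> w4" using vis_no_uturn[OF T'(1), of "c - 1"] w3 w4 ml cr by auto
      have "{w1, w2} \<inter> {w3, w4} \<noteq> {}"
      proof
        assume "{w1, w2} \<inter> {w3, w4} = {}"
        hence "card {w1, w2, w3, w4} = 4" using n12 n34 by auto
        moreover have "card {w1, w2, w3, w4} \<le> card \<Delta>" using w1 w2 w3 w4 c3
            by (intro card_mono) auto
        ultimately show False using c3 by simp
      qed
      then obtain w where w: "w = w1 \<or> w = w2" "w = w3 \<or> w = w4" by auto
      have inS: "(vis S ! m, Wh w) \<in> traversed G S"
        using w(1) traversed_step(1)[OF T(1), of m] traversed_step(2)[OF T(1), of "m - 1"]
            w1 w2 ml by auto
      have inS': "(vis S ! m, Wh w) \<in> traversed G S'"
        using w(2) traversed_step(1)[OF T'(1), of c] traversed_step(2)[OF T'(1), of "c - 1"]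
            w3 w4 ml cr m(3) by auto
      have "(vis S ! m, Wh w) \<in> X" using inS inS' unfolding X_def shared_def by auto
      thus ?thesis using fin[of "(vis S ! m, Wh w)" m c w] m b by simp
    qed
  next
    case 2
    then obtain e where e: "e \<in> endpoints_in G S a b" "e \<in> endpoints_in G S' c d" "e \<in> Bd ` {1..n}"
      unfolding set_bdry by blast
    obtain k where k0: "e = Bd k" using e(3) by blast
    obtain m where m: "m \<in> {0, length S}" "a \<le> m" "m \<le> b" "vis S ! m = Bd k" using e(1) k0
        unfolding endpoints_in_def by blast
    obtain h where h: "h \<in> {0, length S'}" "c \<le> h" "h \<le> d" "vis S' ! h = Bd k" using e(2) k0
        unfolding endpoints_in_def by blast
    note k = m(4) h(4) m(1) h(1) m(2,3) h(2,3)
    have tr: "(Bd k, Wh (cl k)) \<in> traversed G U" if TU: "trip_segment G iU U" and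
        "vis U ! mU = Bd k" "mU \<in> {0, length U}" for iU U mU
    proof (cases "mU = 0")
      case True
      have l: "0 < length U" using trip_nth(1)[OF TU] by simp
      thus ?thesis using traversed_step(1)[OF TU, of 0] vis_adj(4)[OF TU Suc_leI[OF l], of k]
          that True by auto
    next
      case False
      hence l: "mU = length U" "0 < length U" using that trip_nth(1)[OF TU] by auto
      thus ?thesis using traversed_step(2)[OF TU, of "length U - 1"] vis_adj(5)[OF TU, of
          "length U - 1" k] that by auto
    qed
    have "(Bd k, Wh (cl k)) \<in> X" using tr[OF T(1) k(1,3)] tr[OF T'(1) k(2,4)]
        unfolding X_def shared_def by auto
    thus ?thesis using fin[of "(Bd k, Wh (cl k))" m h "cl k"] k by simp
  qed
qed

text \<open>A chord at \<open>y\<close> splits the strands at \<open>Wh y\<close> without cutting through an hourglass.\<close>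

lemma pos_chord:
  assumes st: "\<sigma> \<in> strands G" "fst (fst \<sigma>) = Wv y" and E: "E y z"
  shows "deg y + N (y + 1) z \<le> pos \<sigma> \<Longrightarrow> deg y + N (y + 1) z \<le> off (fst \<sigma>)"
    and "off (fst \<sigma>) \<le> pos \<sigma>"
    and "(\<exists>k. snd (fst \<sigma>) = Bd k) \<and> pos \<sigma> = off (fst \<sigma>) \<and> pos \<sigma> < deg y \<or> deg y \<le> off (fst \<sigma>)"
proof -
  obtain w q where s: "\<sigma> = ((Wv y, w), q)" using st(2) by (metis prod.collapse)
  have d: "(Wv y, w) \<in> fraser_darts r M D" "q < fraser_mult r M D (Wv y, w)" using st(1)
      unfolding strands_iff s by auto
  show "off (fst \<sigma>) \<le> pos \<sigma>" unfolding pos_def by simp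
  have "(\<exists>k. w = Bd k) \<or> (\<exists>\<Delta>\<in>triangles D. vtx y \<in> \<Delta> \<and> w = Tri \<Delta>)" using d(1) unfolding darts_iff
      by auto
  hence "(deg y + N (y + 1) z \<le> pos \<sigma> \<longrightarrow> deg y + N (y + 1) z \<le> off (fst \<sigma>)) \<and>
    ((\<exists>k. snd (fst \<sigma>) = Bd k) \<and> pos \<sigma> = off (fst \<sigma>) \<and> pos \<sigma> < deg y \<or> deg y \<le> off (fst \<sigma>))"
  proof (elim disjE exE bexE conjE)
    fix k assume w: "w = Bd k"
    have "q = 0" using d(2) w by simp
    thus ?thesis using off_Wh_Bd[of y k] d(1) N_nonneg[of "y + 1" z] unfolding s w pos_def by auto
  next
    fix \<Delta> assume \<Delta>: "\<Delta> \<in> triangles D" "vtx y \<in> \<Delta>" "w = Tri \<Delta>"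
    obtain a b where T: "Tr y a b" "\<Delta> = {vtx y, vtx a, vtx b}" using triangle_lift[OF \<Delta>(1,2)]
        by metis
    note o = Tr_less[OF T(1)] E_less[OF E]
    have f: "off (Wv y, w) = deg y + N (y + 1) a" using off_Wh_Tri[OF T(1)] \<Delta>(3) T(2) by simp
    have q: "int q < N a b" using d(2) mult_Tri(1)[OF T(1)] unfolding \<Delta>(3) T(2) by simp
    have "deg y + N (y + 1) z \<le> deg y + N (y + 1) a" if "deg y + N (y + 1) z \<le> deg y + N (y + 1)
        a + int q"
    proof (rule ccontr)
      assume n: "\<not> ?thesis"
      have "\<not> z \<le> a" using n N_mono[of "y + 1" "y + 1" z a] by auto
      hence "b \<le> z" using wedge_chord[OF T(1) E] by auto
      hence "N (y + 1) b \<le> N (y + 1) z" by (intro N_mono) auto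
      moreover have "N (y + 1) b = N (y + 1) a + N a b" by (rule N_split[OF Tr_E(1)[OF T(1)]])
          (use o in auto)
      ultimately show False using that q by auto
    qed
    moreover have "deg y \<le> off (Wv y, w)" using f N_nonneg[of "y + 1" a] by simp
    ultimately show ?thesis using f unfolding s pos_def by simp
  qed
  thus "deg y + N (y + 1) z \<le> pos \<sigma> \<Longrightarrow> deg y + N (y + 1) z \<le> off (fst \<sigma>)"
    "(\<exists>k. snd (fst \<sigma>) = Bd k) \<and> pos \<sigma> = off (fst \<sigma>) \<and> pos \<sigma> < deg y \<or> deg y \<le> off (fst \<sigma>)" by blast+
qed

text \<open>The order of darts around the common corner: \<open>S'\<close> leaves before the dart on
  which it came, this one precedes the dart on which \<open>S\<close> came, and \<open>S\<close>
  leaves after its own. If the position of \<open>S\<close> wraps past \<open>r\<close>,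
  \<open>S\<close> leaves through the claw, before the dart on which \<open>S'\<close> leaves.
  Cyclically both cases agree, and the pairs do not alternate.\<close>

lemma bounce_offs:
  assumes T: "trip_segment G i S" "1 \<le> i" "i < r" and T': "trip_segment G i' S'" "1 \<le> i'" "i' < r"
    and b: "bounce S i m S' i' h"
  obtains y where "vis S ! m = Wv y" "vis S' ! h = Wv y" "0 < m" "0 < h" "m \<le> length S"
      "h \<le> length S'"
    "off (vis S' ! h, vis S' ! (h - 1)) < off (vis S ! m, vis S ! (m - 1))"
    "h < length S' \<Longrightarrow> off (fst (S' ! h)) < off (vis S' ! h, vis S' ! (h - 1))"
    "m < length S \<Longrightarrow> off (vis S ! m, vis S ! (m - 1)) < off (fst (S ! m)) \<or>
       (off (fst (S ! m)) < off (vis S' ! h, vis S' ! (h - 1)) \<and> (h < length S' \<longrightarrow> off (fst (S !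
           m)) < off (fst (S' ! h))))"
proof -
  obtain v x y y' q q' where B: "Tr v x y" "Tr v y y'" "0 < m" "0 < h"
     "vis S ! (m - 1) = Tv v x y" "vis S' ! (h - 1) = Tv v y y'" "LS S i m y x q"
         "KS S' i' h y y' q'"
    using b unfolding bounce_def by blast
  note o = Tr_less[OF B(1)] Tr_less[OF B(2)]
  have L: "m \<le> length S" "vis S ! m = Wv y" "E x y" "0 \<le> q" "q < N x y"
    "m < length S \<Longrightarrow> pos (S ! m) = (deg y + N (y - int s + 1) x + q) mod int r" using B(7)
        unfolding LS_def by auto
  have K: "h \<le> length S'" "vis S' ! h = Wv y" "E y y'" "0 \<le> q'" "q' < N y y'"
    "h < length S' \<Longrightarrow> pos (S' ! h) = deg y + N (y + 1) y' + q' - N y y'" using B(8)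
        unfolding KS_def by auto
  have T1: "Tr y y' (v + int s)" by (rule Tr_rotate(3)[OF B(2)])
  have T2: "Tr y (v + int s) (x + int s)" using Tr_rotate(3)[OF Tr_rotate(3)[OF B(1)]] by simp
  have e1: "Tv y y' (v + int s) = Tv v y y'" "Tv y (v + int s) (x + int s) = Tv v x y"
      by (simp_all add: insert_commute)
  have o2: "off (Wv y, Tv v y y') = deg y + N (y + 1) y'" using off_Wh_Tri[OF T1] unfolding e1 .
  have o1: "off (Wv y, Tv v x y) = deg y + N (y + 1) (v + int s)" using off_Wh_Tri[OF T2]
      unfolding e1 .
  have sp1: "N (y + 1) (v + int s) = N (y + 1) y' + N y' (v + int s)"
    by (rule N_split[OF K(3)]) (use o in auto)
  have p1: "1 \<le> N y' (v + int s)" by (rule N_pos) (use o in auto)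
  have Ey: "E y (v + int s)" by (rule Tr_E(1)[OF T2])
  have Eyx: "E y (x + int s)" by (rule Tr_E(3)[OF T2])
  have sp2: "N (y + 1) (x + int s) = N (y + 1) (v + int s) + N (v + int s) (x + int s)"
    by (rule N_split[OF Ey]) (use o in auto)
  have p2: "1 \<le> N (v + int s) (x + int s)" by (rule N_pos) (use o in auto)
  have 12: "off (Wv y, Tv v y y') < off (Wv y, Tv v x y)" unfolding o1 o2 using sp1 p1 by simp
  have Tout: "off (fst (S' ! h)) < off (Wv y, Tv v y y')" "fst (fst (S' ! h)) = Wv y"
      "S' ! h \<in> strands G" if "h < length S'"
  proof -
    show st: "S' ! h \<in> strands G" by (rule trip_nth(2)[OF T'(1) that])
    show ft: "fst (fst (S' ! h)) = Wv y" using vis_nth(1)[OF T'(1) that] K by simp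
    show "off (fst (S' ! h)) < off (Wv y, Tv v y y')"
      using pos_chord(2)[OF st ft K(3)] K(5) K(6)[OF that] unfolding o2 by simp
  qed
  have Sout: "off (Wv y, Tv v x y) < off (fst (S ! m)) \<or>
       (off (fst (S ! m)) < off (Wv y, Tv v y y') \<and> (h < length S' \<longrightarrow> off (fst (S ! m)) < off
           (fst (S' ! h))))" if m: "m < length S"
  proof -
    have st: "S ! m \<in> strands G" by (rule trip_nth(2)[OF T(1) m])
    have ft: "fst (fst (S ! m)) = Wv y" using vis_nth(1)[OF T(1) m] L by simp
    define V where "V = deg y + N (y + 1) (x + int s) + q"
    have NX: "N (y - int s + 1) x = N (y + 1) (x + int s)" using N_shift(1)[of "y - int s + 1"
        x] by (simp add: algebra_simps)
    have pS: "pos (S ! m) = V mod int r" using L(6)[OF m] NX unfolding V_def by simp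
    have dN: "deg y + N (y + 1) (y + int s - 1) = int r" using deg_N[of y] card_M by simp
    have sp3: "N (y + 1) (y + int s - 1) = N (y + 1) (x + int s) + N (x + int s) (y + int s - 1)"
      by (rule N_split[OF Eyx]) (use o in auto)
    have sh: "N (x + int s) (y + int s - 1) = N x (y - 1)" using N_shift(1)[of x "y - 1"]
        by (simp add: algebra_simps)
    \<comment> \<open>The claw of \<open>y\<close> has room for its strands in both regions; this
      puts the claw edge of \<open>S\<close> before the beginning of the region of
      \<open>S'\<close>.\<close>
    have dy: "N x y - N x (y - 1) + (N y y' - N (y + 1) y') \<le> deg y" by (rule N_two_sides)
        (use o in auto)
    have nd: "N y y' \<le> deg y + N (y + 1) y'" by (rule N_drop_start) (use o in auto)
    have xy1: "N x y \<le> N x (y - 1) + deg y" by (rule N_drop_end) (use o in auto)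
    have nn: "0 \<le> N (y + 1) y'" "0 \<le> N (y + 1) (x + int s)" "0 \<le> deg y"
        "0 \<le> N (y + 1) (y + int s - 1)" unfolding deg_def by simp_all
    have up: "N (y + 1) y' \<le> N y y'" by (rule N_mono) auto
    show ?thesis
    proof (cases "V < int r")
      case True
      have "0 \<le> V" unfolding V_def using nn L(4) by linarith
      hence "pos (S ! m) = V" using pS True by (simp add: mod_pos_pos_trivial)
      hence "deg y + N (y + 1) (x + int s) \<le> off (fst (S ! m))"
        using pos_chord(1)[OF st ft Eyx] L(4) unfolding V_def by simp
      thus ?thesis unfolding o1 using sp2 p2 by linarith
    next
      case False
      have "V - int r < int r" unfolding V_def using L(5) xy1 sp3 sh dN nn by linarith
      hence "V mod int r = V - int r" using False mod_pos_pos_trivial[of "V - int r" "int r"]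
          by (simp add: mod_diff_eq[symmetric])
      hence p: "pos (S ! m) = q - N x (y - 1)" using pS sp3 sh dN unfolding V_def by linarith
      have small: "pos (S ! m) < deg y - (N y y' - N (y + 1) y')" using p L(5) dy by linarith
      have lt: "off (fst (S ! m)) \<le> pos (S ! m)" using pos_chord(2)[OF st ft Eyx] .
      have "off (fst (S ! m)) < off (Wv y, Tv v y y')" unfolding o2 using lt small up nn by linarith
      moreover have "off (fst (S ! m)) < off (fst (S' ! h))" if h: "h < length S'"
      proof -
        have "deg y - (N y y' - N (y + 1) y') \<le> pos (S' ! h)" using K(6)[OF h] K(4) by linarith
        hence "pos (S ! m) < pos (S' ! h)" using small by linarith
        \<comment> \<open>A claw edge is a single strand, so its position is its offset; an
          hourglass starts after the claw.\<close>
        moreover have "pos (S' ! h) = off (fst (S' ! h)) \<or> deg y \<le> off (fst (S' ! h))"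
          using pos_chord(3)[OF Tout(3)[OF h] Tout(2)[OF h] K(3)] by blast
        ultimately show ?thesis using lt small up by linarith
      qed
      ultimately show ?thesis by blast
    qed
  qed
  show ?thesis
    by (rule that[of y]) (use L K B 12 Tout Sout in auto)
qed

section \<open>Cyclic order of darts read off from offsets\<close>

lemma cw_pow_dart: "d \<in> fraser_darts r M D \<Longrightarrow> (cw G ^^ k) d \<in> fraser_darts r M D \<and> fst ((cw G ^^
    k) d) = fst d"
  by (induction k) (use cw_dart in \<open>auto simp del: fraser_simps(7)\<close>, simp)

text \<open>The increase of \<open>off\<close> under rotation, before reduction modulo
  \<open>r\<close>.\<close>

definition steps :: "fraser_dart \<Rightarrow> nat \<Rightarrow> int" where
  "steps d k = (\<Sum>l<k. int (fraser_mult r M D ((cw G ^^ l) d)))"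

lemma off_cw_pow:
  assumes "d \<in> fraser_darts r M D" "inner (fst d)"
  shows "off ((cw G ^^ k) d) = (off d + steps d k) mod int r"
proof (induction k)
  case 0
  thus ?case using off_bounds[OF assms] mult_pos[OF assms(1)]
      by (simp add: steps_def mod_pos_pos_trivial)
next
  case (Suc k)
  have "off ((cw G ^^ Suc k) d) = (off ((cw G ^^ k) d) + int (fraser_mult r M D ((cw G ^^ k)
      d))) mod int r"
    using off_cw[of "(cw G ^^ k) d"] cw_pow_dart[OF assms(1), of k] assms(2)
        by (simp del: fraser_simps(7))
  thus ?case using Suc by (simp add: steps_def mod_add_left_eq add.assoc del: fraser_simps(7))
qed

lemma steps_mono: "d \<in> fraser_darts r M D \<Longrightarrow> a < b \<Longrightarrow> steps d a < steps d b"
proof (induction b)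
  case (Suc b)
  have "steps d b < steps d (Suc b)"
    using mult_pos[of "(cw G ^^ b) d"] cw_pow_dart[OF Suc.prems(1), of b] unfolding steps_def
        by simp
  thus ?case using Suc by (cases "a = b") auto
qed simp

lemma cw_inj: "d \<in> fraser_darts r M D \<Longrightarrow> e \<in> fraser_darts r M D \<Longrightarrow> cw G d = cw G e \<Longrightarrow> d = e"
  using wf_fraser unfolding wf_hourglass_def bij_betw_def inj_on_def fraser_simps(2) by blast

lemma cw_pow_inj:
  assumes "d \<in> fraser_darts r M D" shows "(cw G ^^ a) d = (cw G ^^ (a + b)) d \<Longrightarrow> (cw G ^^ b) d = d"
proof (induction a)
  case (Suc a)
  have "cw G ((cw G ^^ a) d) = cw G ((cw G ^^ (a + b)) d)" using Suc.prems
      by (simp del: fraser_simps(7))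
  hence "(cw G ^^ a) d = (cw G ^^ (a + b)) d" using cw_inj cw_pow_dart[OF assms] by blast
  thus ?case using Suc.IH by blast
qed simp

text \<open>Before the rotation returns, the darts are distinct, and the current one still has a
  strand to spare within the degree \<open>r\<close>.\<close>

lemma steps_less:
  assumes d: "d \<in> fraser_darts r M D" "inner (fst d)" and nr:
      "\<And>l. 0 < l \<Longrightarrow> l \<le> k \<Longrightarrow> (cw G ^^ l) d \<noteq> d"
  shows "steps d k < int r"
proof -
  have inj: "inj_on (\<lambda>l. (cw G ^^ l) d) {..<Suc k}"
  proof (rule inj_onI)
    fix a b assume ab: "a \<in> {..<Suc k}" "b \<in> {..<Suc k}" "(cw G ^^ a) d = (cw G ^^ b) d"
    have *: False if "a < b" "b \<le> k" "(cw G ^^ a) d = (cw G ^^ b) d" for a b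
      using cw_pow_inj[OF d(1), of a "b - a"] nr[of "b - a"] that by simp
    show "a = b" using *[of a b] *[of b a] ab by (cases a b rule: linorder_cases) auto
  qed
  have fv: "fst d \<in> fraser_verts r M D" using dart_nb[OF d(1)] by simp
  have "steps d k < steps d (Suc k)" using steps_mono[OF d(1)] by simp
  also have "steps d (Suc k) = (\<Sum>e\<in>(\<lambda>l. (cw G ^^ l) d) ` {..<Suc k}. int (fraser_mult r M D e))"
    unfolding steps_def by (subst sum.reindex[OF inj]) simp
  also have "\<dots> \<le> (\<Sum>e | e \<in> darts G \<and> tail G e = fst d. int (fraser_mult r M D e))"
    by (rule sum_mono2) (use finite_darts cw_pow_dart[OF d(1)] in auto)
  also have "\<dots> = int (degree G (fst d))" unfolding degree_def by simp
  also have "\<dots> = int r"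
  proof -
    have "fst d \<in> verts G - set (bdry G)" using fv d(2) unfolding set_bdry inner_def by auto
    thus ?thesis using degree_fraser by simp
  qed
  finally show ?thesis .
qed

text \<open>The condition on \<open>f\<close> describes a vertex at which nothing is contracted,
  where \<open>contracted_cw\<close> is plain rotation.\<close>

lemma cyclic_order_offs:
  assumes x: "x \<in> fraser_darts r M D" "inner (fst x)" and f: "\<And>k. (f ^^ k) x = (cw G ^^ k) x"
    and c: "in_cyclic_order f x y x' y'"
  obtains a b c where "0 < a" "a < b" "b < c" "c < int r"
    "off y = (off x + a) mod int r" "off x' = (off x + b) mod int r"
        "off y' = (off x + c) mod int r"
proof -
  obtain i j k where ijk: "0 < i" "i < j" "j < k" "(f ^^ i) x = y" "(f ^^ j) x = x'"
      "(f ^^ k) x = y'"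
    "\<And>l. 0 < l \<Longrightarrow> l \<le> k \<Longrightarrow> (f ^^ l) x \<noteq> x" using c unfolding in_cyclic_order_def by blast
  have "steps x k < int r" by (rule steps_less[OF x]) (use ijk(7) f in metis)
  moreover have "steps x 0 = 0" unfolding steps_def by simp
  ultimately show ?thesis
    using that[of "steps x i" "steps x j" "steps x k"] steps_mono[OF x(1), of 0 i]
        steps_mono[OF x(1), of i j] steps_mono[OF x(1), of j k]
      off_cw_pow[OF x] f ijk by metis
qed

lemma mod_step:
  fixes x a :: int assumes "0 \<le> x" "x < R" "0 < a" "a < R" "z = (x + a) mod R"
  shows "(z = x + a \<and> x < z) \<or> (z = x + a - R \<and> z < x)"
proof (cases "x + a < R")
  case True thus ?thesis using assms by (simp add: mod_pos_pos_trivial)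
next
  case False
  hence "(x + a) mod R = x + a - R" using assms mod_pos_pos_trivial[of "x + a - R" R]
      by (simp add: mod_diff_eq[symmetric])
  thus ?thesis using assms by simp
qed

text \<open>At a bounce nothing is contracted, and the two darts of each segment are neighbours in the cyclic order.\<close>

lemma bounce_not_essential:
  assumes T: "trip_segment G i S" "1 \<le> i" "i < r" and T': "trip_segment G i' S'" "1 \<le> i'" "i' < r"
    and bn: "bounce S i m S' i' h"
    and st: "stretch (shared G S S') S a b" "stretch (shared G S S') S' c d" "a \<le> m" "m \<le> b"
        "c \<le> h" "h \<le> d"
  shows "\<not> cross_at G S S' a b c d" "\<not> cross_at G S' S c d a b"
      "endpoints_in G S a b \<inter> endpoints_in G S' c d \<inter> set (bdry G) = {}"
proof -
  obtain y where y: "vis S ! m = Wv y" "vis S' ! h = Wv y" "0 < m" "0 < h" "m \<le> length S"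
      "h \<le> length S'"
    "off (vis S' ! h, vis S' ! (h - 1)) < off (vis S ! m, vis S ! (m - 1))"
    "h < length S' \<Longrightarrow> off (fst (S' ! h)) < off (vis S' ! h, vis S' ! (h - 1))"
    "m < length S \<Longrightarrow> off (vis S ! m, vis S ! (m - 1)) < off (fst (S ! m)) \<or>
       (off (fst (S ! m)) < off (vis S' ! h, vis S' ! (h - 1)) \<and> (h < length S' \<longrightarrow> off (fst (S !
           m)) < off (fst (S' ! h))))"
    using bounce_offs[OF T T' bn] by metis
  define X where "X = shared G S S'"
  define e1 where "e1 = (vis S ! m, vis S ! (m - 1))"
  define e2 where "e2 = (vis S' ! h, vis S' ! (h - 1))"
  have e1: "e1 = prod.swap (fst (S ! (m - 1)))" using vis_dart(1)[OF T(1), of "m - 1"] y(3,5)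
      unfolding e1_def by simp
  have e2: "e2 = prod.swap (fst (S' ! (h - 1)))" using vis_dart(1)[OF T'(1), of "h - 1"] y(4,6)
      unfolding e2_def by simp
  note offs = y(7-9)[folded e1_def e2_def]
  \<comment> \<open>A shared edge at \<open>y\<close> would be one of the two darts of
    \<open>S\<close> and one of the two darts of \<open>S'\<close>, but these have different
    offsets.\<close>
  have noX: "e \<notin> X" if "fst e = Wv y" for e
  proof
    assume "e \<in> X"
    hence et: "e \<in> traversed G S" "e \<in> traversed G S'" unfolding X_def shared_def by auto
    have "m < length S \<and> e = fst (S ! m) \<or> e = e1"
      using traversed_at[OF T et(1) _ y(5)] that y(1) unfolding e1 by auto
    moreover have "h < length S' \<and> e = fst (S' ! h) \<or> e = e2"
      using traversed_at[OF T' et(2) _ y(6)] that y(2) unfolding e2 by auto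
    ultimately show False using offs by auto
  qed
  have Xs: "prod.swap e \<in> X" if "e \<in> X" for e using shared_swap that unfolding X_def by blast
  have mS: "fst (S ! m) \<notin> X" if "m < length S" using noX vis_dart(1)[OF T(1) that] y(1) by simp
  have mS1: "fst (S ! (m - 1)) \<notin> X" using noX[of e1] Xs[of "fst (S ! (m - 1))"] y(1) e1
      unfolding e1_def by auto
  have hS: "fst (S' ! h) \<notin> X" if "h < length S'" using noX vis_dart(1)[OF T'(1) that] y(2) by simp
  have hS1: "fst (S' ! (h - 1)) \<notin> X" using noX[of e2] Xs[of "fst (S' ! (h - 1))"] y(2) e2
      unfolding e2_def by auto
  have st': "\<And>k. a \<le> k \<Longrightarrow> k < b \<Longrightarrow> fst (S ! k) \<in> X" "b \<le> length S"
      "\<And>k. c \<le> k \<Longrightarrow> k < d \<Longrightarrow> fst (S' ! k) \<in> X" "d \<le> length S'"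
    using st(1,2) unfolding stretch_def X_def by auto
  have "\<not> m < b" using st'(1)[OF st(3)] mS less_le_trans[OF _ st'(2)] by blast
  moreover have "\<not> a < m"
  proof
    assume "a < m"
    hence "a \<le> m - 1" "m - 1 < b" using y(3) st(4) by linarith+
    thus False using st'(1) mS1 by blast
  qed
  ultimately have ab: "a = m" "b = m" using st(3,4) by linarith+
  have "\<not> h < d" using st'(3)[OF st(5)] hS less_le_trans[OF _ st'(4)] by blast
  moreover have "\<not> c < h"
  proof
    assume "c < h"
    hence "c \<le> h - 1" "h - 1 < d" using y(4) st(6) by linarith+
    thus False using st'(3) hS1 by blast
  qed
  ultimately have cd: "c = h" "d = h" using st(5,6) by linarith+
  have "endpoints_in G S a b \<subseteq> {Wv y}" unfolding endpoints_in_def ab using y(1) by auto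
  thus "endpoints_in G S a b \<inter> endpoints_in G S' c d \<inter> set (bdry G) = {}" unfolding set_bdry by auto
  define f where "f = contracted_cw G X"
  have fpow: "(f ^^ k) e = (cw G ^^ k) e" if "fst e = Wv y" for e k
  proof (induction k)
    case (Suc k)
    have ft: "fst ((cw G ^^ k) e) = Wv y" using that by (induction k) auto
    have "(LEAST l. ((\<lambda>e. cw G (opp G e)) ^^ l) (cw G ((cw G ^^ k) e)) \<notin> X) = 0"
      by (rule Least_eq_0) (use noX[of "cw G ((cw G ^^ k) e)"] ft in simp)
    hence "f ((cw G ^^ k) e) = cw G ((cw G ^^ k) e)" unfolding f_def contracted_cw_def Let_def
        by simp
    thus ?case using Suc by (simp del: fraser_simps(7))
  qed simp
  have dd: "e1 \<in> fraser_darts r M D" "e2 \<in> fraser_darts r M D" "inner (fst e1)" "inner (fst e2)"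
      "fst e1 = Wv y" "fst e2 = Wv y"
    using vis_dart(2)[OF T(1), of "m - 1"] vis_dart(2)[OF T'(1), of "h - 1"] y(1-6) darts_swap
        unfolding e1_def e2_def inner_def by auto
  have bnd: "0 \<le> off e1" "off e1 < int r" "0 \<le> off e2" "off e2 < int r"
    using off_bounds[OF dd(1,3)] off_bounds[OF dd(2,4)] mult_pos[OF dd(1)] mult_pos[OF dd(2)]
        by auto
  \<comment> \<open>The two alternating orders, and the same with the segments exchanged.\<close>
  have main: False if l: "m < length S" "h < length S'"
    and "in_cyclic_order f e1 e2 (fst (S ! m)) (fst (S' ! h)) \<or> in_cyclic_order f e1 (fst (S' !
        h)) (fst (S ! m)) e2
       \<or> in_cyclic_order f e2 e1 (fst (S' ! h)) (fst (S ! m)) \<or> in_cyclic_order f e2 (fst (S !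
           m)) (fst (S' ! h)) e1"
  proof -
    have O3: "off e1 < off (fst (S ! m)) \<or> (off (fst (S ! m)) < off e2 \<and> off (fst (S ! m)) < off
        (fst (S' ! h)))"
      using offs(3)[OF l(1)] l(2) by blast
    have dS: "fst (S ! m) \<in> fraser_darts r M D" "inner (fst (fst (S ! m)))"
        "fst (S' ! h) \<in> fraser_darts r M D" "inner (fst (fst (S' ! h)))"
      using vis_dart[OF T(1) l(1)] vis_dart[OF T'(1) l(2)] y(1,2) unfolding inner_def by auto
    have oS: "0 \<le> off (fst (S ! m))" "off (fst (S ! m)) < int r" "0 \<le> off (fst (S' ! h))"
        "off (fst (S' ! h)) < int r"
      using off_bounds[OF dS(1,2)] off_bounds[OF dS(3,4)] mult_pos[OF dS(1)] mult_pos[OF dS(3)]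
          by auto
    note O = offs(1) offs(2)[OF l(2)] O3 oS bnd
    from that(3) show False
    proof (elim disjE)
      assume c: "in_cyclic_order f e1 e2 (fst (S ! m)) (fst (S' ! h))"
      obtain p q t where pq: "0 < p" "p < q" "q < t" "t < int r"
        "off e2 = (off e1 + p) mod int r" "off (fst (S ! m)) = (off e1 + q) mod int r"
            "off (fst (S' ! h)) = (off e1 + t) mod int r"
        using cyclic_order_offs[OF dd(1,3) fpow[OF dd(5)] c] by metis
      have rg: "p < int r" "q < int r" "0 < q" "0 < t" using pq by linarith+
      show False
        using mod_step[OF bnd(1,2) pq(1) rg(1) pq(5)] mod_step[OF bnd(1,2) rg(3,2) pq(6)]
            mod_step[OF bnd(1,2) rg(4) pq(4,7)] pq(2,3) O
        by smt
    next
      assume c: "in_cyclic_order f e1 (fst (S' ! h)) (fst (S ! m)) e2"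
      obtain p q t where pq: "0 < p" "p < q" "q < t" "t < int r"
        "off (fst (S' ! h)) = (off e1 + p) mod int r" "off (fst (S ! m)) = (off e1 + q) mod int
            r" "off e2 = (off e1 + t) mod int r"
        using cyclic_order_offs[OF dd(1,3) fpow[OF dd(5)] c] by metis
      have rg: "p < int r" "q < int r" "0 < q" "0 < t" using pq by linarith+
      show False
        using mod_step[OF bnd(1,2) pq(1) rg(1) pq(5)] mod_step[OF bnd(1,2) rg(3,2) pq(6)]
            mod_step[OF bnd(1,2) rg(4) pq(4,7)] pq(2,3) O
        by smt
    next
      assume c: "in_cyclic_order f e2 e1 (fst (S' ! h)) (fst (S ! m))"
      obtain p q t where pq: "0 < p" "p < q" "q < t" "t < int r"
        "off e1 = (off e2 + p) mod int r" "off (fst (S' ! h)) = (off e2 + q) mod int r"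
            "off (fst (S ! m)) = (off e2 + t) mod int r"
        using cyclic_order_offs[OF dd(2,4) fpow[OF dd(6)] c] by metis
      have rg: "p < int r" "q < int r" "0 < q" "0 < t" using pq by linarith+
      show False
        using mod_step[OF bnd(3,4) pq(1) rg(1) pq(5)] mod_step[OF bnd(3,4) rg(3,2) pq(6)]
            mod_step[OF bnd(3,4) rg(4) pq(4,7)] pq(2,3) O
        by smt
    next
      assume c: "in_cyclic_order f e2 (fst (S ! m)) (fst (S' ! h)) e1"
      obtain p q t where pq: "0 < p" "p < q" "q < t" "t < int r"
        "off (fst (S ! m)) = (off e2 + p) mod int r" "off (fst (S' ! h)) = (off e2 + q) mod int
            r" "off e1 = (off e2 + t) mod int r"
        using cyclic_order_offs[OF dd(2,4) fpow[OF dd(6)] c] by metis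
      have rg: "p < int r" "q < int r" "0 < q" "0 < t" using pq by linarith+
      show False
        using mod_step[OF bnd(3,4) pq(1) rg(1) pq(5)] mod_step[OF bnd(3,4) rg(3,2) pq(6)]
            mod_step[OF bnd(3,4) rg(4) pq(4,7)] pq(2,3) O
        by smt
    qed
  qed
  show "\<not> cross_at G S S' a b c d"
    unfolding cross_at_def ab cd Let_def X_def[symmetric] f_def[symmetric]
        fraser_simps(3) e1[symmetric] e2[symmetric] using main by blast
  show "\<not> cross_at G S' S c d a b"
    unfolding cross_at_def ab cd Let_def shared_sym[of S' S] X_def[symmetric] f_def[symmetric]
        fraser_simps(3) e1[symmetric] e2[symmetric] using main by blast
qed

text \<open>Each essential intersection provides a common white vertex. If \<open>S\<close> uses
  only edges of \<open>S'\<close> in between, then the edge right after the first stretch is shared,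
  against its maximality; otherwise the segments bounce at the second vertex, which is then not
  essential.\<close>

lemma no_double_crossing:
  assumes T: "trip_segment G i S" "1 \<le> i" "i < r" and T': "trip_segment G i' S'" "1 \<le> i'" "i' < r"
    and ii: "i' = i \<or> i' = i + 1"
  shows "\<not> oriented_double_crossing G S S'"
proof
  assume "oriented_double_crossing G S S'"
  then obtain a b c d a' b' c' d' where es: "essential_at G S S' a b c d"
      "essential_at G S S' a' b' c' d'" "b < a'" "d < c'"
    unfolding oriented_double_crossing_def by blast
  obtain m h w where mh: "a \<le> m" "m \<le> b" "c \<le> h" "h \<le> d" "vis S ! m = Wh w" "vis S' ! h = Wh w"
    using essential_meet[OF T T' es(1)] by blast
  obtain m' h' w' where mh': "a' \<le> m'" "m' \<le> b'" "c' \<le> h'" "h' \<le> d'" "vis S ! m' = Wh w'"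
      "vis S' ! h' = Wh w'"
    using essential_meet[OF T T' es(2)] by blast
  have st: "stretch (shared G S S') S a b" "stretch (shared G S S') S' c d"
      "stretch (shared G S S') S a' b'" "stretch (shared G S S') S' c' d'"
    using es unfolding essential_at_def by auto
  have len: "m' \<le> length S" "h' \<le> length S'" using st(3,4) mh' unfolding stretch_def by auto
  have "m < m'" "h < h'" using mh mh' es by auto
  from meets[OF T T' ii len(1) mh'(5) len(2) mh'(6) mh(5,6) this] show False
  proof (elim disjE)
    assume al: "\<forall>c. m \<le> c \<and> c < m' \<longrightarrow> fst (S ! c) \<in> fst ` set S'"
    have "b < m'" "b < length S" using mh' es len by auto
    hence "fst (S ! b) \<in> fst ` set S'" "fst (S ! b) \<in> fst ` set S" using al mh by auto
    hence "fst (S ! b) \<in> shared G S S'" unfolding shared_def traversed_def by auto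
    thus False using st(1) \<open>b < length S\<close> unfolding stretch_def by auto
  next
    assume b: "bounce S i m' S' i' h'"
    note nb = bounce_not_essential[OF T T' b st(3,4) mh'(1-4)]
    show False using es(2) nb unfolding essential_at_def by blast
  next
    assume b: "bounce S' i' h' S i m'"
    note st' = st(3,4)[unfolded shared_sym[of S S']]
    note nb = bounce_not_essential[OF T' T b st'(2,1) mh'(3,4,1,2)]
    show False using es(2) nb unfolding essential_at_def by blast
  qed
qed

lemma connected_boundary:
  assumes "v \<in> verts G"
  shows "\<exists>b\<in>set (bdry G). (v, b) \<in> {(tail G d, head G d) | d. d \<in> darts G}\<^sup>*"
proof -
  define R where "R = {(tail G d, head G d) | d. d \<in> darts G}"
  have R: "(u, w) \<in> R" if "(u, w) \<in> fraser_darts r M D" for u w using that unfolding R_def by force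
  have W: "\<exists>b\<in>set (bdry G). (Wh j, b) \<in> R\<^sup>*" if j: "j \<in> {1..s}" for j
  proof -
    obtain k where k: "k \<in> set (claw r M j)" using claw_ne[OF j] by (meson ex_in_conv set_empty)
    hence "k \<in> {1..n}" "cl k = j" using set_claw[OF j] by auto
    hence "(Wh j, Bd k) \<in> R" "Bd k \<in> set (bdry G)" using R darts_iff unfolding set_bdry by auto
    thus ?thesis by blast
  qed
  have "v \<in> fraser_verts r M D" using assms by simp
  hence "\<exists>b\<in>set (bdry G). (v, b) \<in> R\<^sup>*"
  proof (cases rule: verts_cases)
    case (1 k) thus ?thesis unfolding set_bdry by blast
  next
    case (2 z) thus ?thesis using W[OF vtx_range] by blast
  next
    case (3 \<Delta>)
    obtain \<delta> where d: "\<delta> \<in> \<Delta>" using 3(2) unfolding triangles_def by auto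
    have "(Tri \<Delta>, Wh \<delta>) \<in> R" using R darts_iff 3(2) d by auto
    moreover have "\<delta> \<in> {1..s}" using triangle_sub[OF 3(2)] d by auto
    ultimately show ?thesis using W 3(1) by (meson converse_rtrancl_into_rtrancl)
  qed
  thus ?thesis unfolding R_def .
qed

lemma fully_reduced_fraser: "fully_reduced r G"
  unfolding fully_reduced_def
proof (intro conjI ballI allI impI)
  fix v assume "v \<in> verts G"
  thus "\<exists>b\<in>set (bdry G). (v, b) \<in> {(tail G d, head G d) |d. d \<in> darts G}\<^sup>*"
      by (rule connected_boundary)
next
  fix i S assume "i \<in> {1..<r}" "trip_segment G i S"
  thus "distinct (vis S)" using distinct_vis by auto
next
  fix i j S S' assume "i \<in> {1..<r}" "j \<in> {1..<r}" "(j = i \<or> j = i + 1) \<and> trip_segment G i S \<and>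
      trip_segment G j S' \<and> S \<noteq> S'"
  thus "\<not> oriented_double_crossing G S S'" using no_double_crossing[of i S j S'] by auto
qed

end

section \<open>Planarity\<close>

text \<open>Vertices, edges and faces are all counted through a label that is constant on each cycle
  and separates the cycles.\<close>

lemma card_orbits:
  assumes "\<And>d. d \<in> X \<Longrightarrow> orbit f d = {e \<in> X. lab e = lab d}"
  shows "card (orbit f ` X) = card (lab ` X)"
proof -
  have "orbit f ` X = (\<lambda>l. {e \<in> X. lab e = l}) ` lab ` X" using assms by (auto simp: image_image)
  moreover have "inj_on (\<lambda>l. {e \<in> X. lab e = l}) (lab ` X)" by (rule inj_onI) blast
  ultimately show ?thesis by (simp add: card_image)
qed

context fraser
begin

section \<open>Vertices, edges and components of the collapsed map\<close>

definition pd :: "nat \<Rightarrow> nat" where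
  "pd k = (if k = 1 then 2 * r else k - 1)"

lemma pd_range: "k \<in> {1..n} \<Longrightarrow> pd k \<in> {1..n}"
  using r1 unfolding pd_def by auto

lemma pd_sc: "k \<in> {1..n} \<Longrightarrow> pd (sc k) = k"
  using r1 unfolding pd_def sc_def by auto

lemma cycle_rev_bdry:
  assumes k: "k \<in> {1..n}" shows "cycle_of_list (rev (bdry G)) (Bd k) = Bd (pd k)"
proof -
  define L where "L = rev (bdry G)"
  have len: "length L = n" unfolding L_def by simp
  have nth: "L ! j = Bd (n - j)" if "j < n" for j
    using that unfolding L_def by (simp add: rev_nth Suc_diff_Suc del: upt_Suc)
  have d: "distinct L" unfolding L_def by (simp add: distinct_map inj_on_def)
  have kk: "n - k < length L" "L ! (n - k) = Bd k" using k len nth[of "n - k"] by auto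
  have "cycle_of_list L (Bd k) = L ! (Suc (n - k) mod n)" using cycle_of_list_nth[OF d kk(1)]
      unfolding kk(2) len .
  also have "\<dots> = Bd (pd k)"
  proof (cases "k = 1")
    case True
    hence "Suc (n - k) mod n = 0" using r1 by simp
    thus ?thesis using True nth[of 0] r1 unfolding pd_def by simp
  next
    case False
    hence "Suc (n - k) < n" "n - Suc (n - k) = k - 1" using k by auto
    thus ?thesis using False nth[of "Suc (n - k)"] unfolding pd_def by simp
  qed
  finally show ?thesis unfolding L_def .
qed

abbreviation "\<kappa> \<equiv> collapsed_cw G"

lemma collapsed_Bd:
  assumes k: "k \<in> {1..n}" shows "\<kappa> (Bd k, w) = (Bd (pd k), Wh (cl (pd k)))"
proof -
  have "(THE e. e \<in> darts G \<and> tail G e = Bd (pd k)) = (Bd (pd k), Wh (cl (pd k)))"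
    using pd_range[OF k] by (intro the_equality) (auto simp: darts_iff)
  thus ?thesis unfolding collapsed_cw_def using k cycle_rev_bdry[OF k] set_bdry by simp
qed

lemma collapsed_inner: "inner (fst d) \<Longrightarrow> \<kappa> d = cw G d"
  unfolding collapsed_cw_def set_bdry inner_def by (auto simp del: fraser_simps(7))

text \<open>\<open>None\<close> stands for the collapsed boundary circle.\<close>

definition vlab :: "fraser_dart \<Rightarrow> fraser_vertex option" where
  "vlab d = (case fst d of Bd _ \<Rightarrow> None | u \<Rightarrow> Some u)"

lemma orbit_collapsed:
  assumes d: "d \<in> fraser_darts r M D" shows "orbit \<kappa> d = {e \<in> fraser_darts r M D. vlab e = vlab d}"
proof (cases "inner (fst d)")
  case True
  define Y where "Y = {e \<in> fraser_darts r M D. fst e = fst d}"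
  have "orbit \<kappa> d = orbit (cw G) d"
  proof (rule orbit_cong0[of d Y])
    show "d \<in> Y" using d unfolding Y_def by simp
    show "\<kappa> \<in> Y \<rightarrow> Y" using collapsed_inner cw_dart True unfolding Y_def by auto
    show "\<kappa> e = cw G e" if "e \<in> Y" for e using collapsed_inner that True unfolding Y_def by auto
  qed
  also have "\<dots> = Y" unfolding Y_def by (rule orbit_cw[OF d])
  also have "Y = {e \<in> fraser_darts r M D. vlab e = vlab d}"
  proof -
    have "vlab e = vlab d \<longleftrightarrow> fst e = fst d" for e
      using True unfolding vlab_def inner_def by (cases "fst d"; cases "fst e") auto
    thus ?thesis unfolding Y_def by simp
  qed
  finally show ?thesis .
next
  case False
  define L where "L = map (\<lambda>k. (Bd k, Wh (cl k))) (rev [1..<n + 1])"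
  have len: "length L = n" unfolding L_def by simp
  have nth: "L ! j = (Bd (n - j), Wh (cl (n - j)))" if "j < n" for j
    using that unfolding L_def by (simp add: rev_nth Suc_diff_Suc del: upt_Suc)
  have sL: "set L = {e \<in> fraser_darts r M D. vlab e = vlab d}"
  proof -
    obtain k0 where "fst d = Bd k0" using False unfolding inner_def by blast
    hence v: "vlab e = vlab d \<longleftrightarrow> (\<exists>k. fst e = Bd k)" for e unfolding vlab_def by (cases "fst e") auto
    have "e \<in> set L \<longleftrightarrow> (\<exists>k\<in>{1..n}. e = (Bd k, Wh (cl k)))" for e
      unfolding L_def by (auto simp del: upt_Suc simp: image_iff)
    moreover have "(\<exists>k\<in>{1..n}. e = (Bd k, Wh (cl k))) \<longleftrightarrow> e \<in> fraser_darts r M D \<and> (\<exists>k. fst e = Bd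
        k)" for e
      by (cases e) (auto simp: darts_iff)
    ultimately show ?thesis unfolding v by blast
  qed
  have "orbit \<kappa> d = set L"
  proof (rule orbit_cycle_list)
    show "d \<in> set L" using sL d by simp
    fix j assume "j < length L"
    hence j: "j < n" using len by simp
    hence "n - j \<in> {1..n}" by auto
    hence "\<kappa> (L ! j) = (Bd (pd (n - j)), Wh (cl (pd (n - j))))" using collapsed_Bd nth[OF j] by simp
    also have "pd (n - j) = n - (Suc j mod n)"
      using j unfolding pd_def by (cases "Suc j = n") auto
    also have "(Bd (n - Suc j mod n), Wh (cl (n - Suc j mod n))) = L ! (Suc j mod length L)"
      using nth[of "Suc j mod n"] j len by simp
    finally show "\<kappa> (L ! j) = L ! (Suc j mod length L)" .
  qed
  thus ?thesis using sL by simp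
qed

lemma claw_nonempty: "j \<in> {1..s} \<Longrightarrow> \<exists>k\<in>{1..n}. cl k = j"
proof -
  assume j: "j \<in> {1..s}"
  have "hd (claw r M j) \<in> set (claw r M j)" using claw_ne[OF j] by simp
  thus ?thesis unfolding set_claw[OF j] by blast
qed

lemma card_V: "card (orbit \<kappa> ` fraser_darts r M D) = 1 + s + card (triangles D)"
proof -
  have "vlab ` fraser_darts r M D = insert None (Some ` (Wh ` {1..s} \<union> Tri ` triangles D))"
  proof (intro equalityI subsetI)
    fix l assume "l \<in> vlab ` fraser_darts r M D"
    then obtain u w where uw: "(u, w) \<in> fraser_darts r M D" "l = vlab (u, w)" by auto
    have "u \<in> fraser_verts r M D" using darts_verts[OF uw(1)] by simp
    thus "l \<in> insert None (Some ` (Wh ` {1..s} \<union> Tri ` triangles D))"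
      unfolding uw(2) vlab_def fraser_verts_def by auto
  next
    fix l assume "l \<in> insert None (Some ` (Wh ` {1..s} \<union> Tri ` triangles D))"
    then consider "l = None" | j where "l = Some (Wh j)" "j \<in> {1..s}" | \<Delta> where
        "l = Some (Tri \<Delta>)" "\<Delta> \<in> triangles D" by auto
    thus "l \<in> vlab ` fraser_darts r M D"
    proof cases
      case 1
      have "(Bd 1, Wh (cl 1)) \<in> fraser_darts r M D" "vlab (Bd 1, Wh (cl 1)) = l" using 1 r1
          by (auto simp: darts_iff vlab_def)
      thus ?thesis by (metis imageI)
    next
      case (2 j)
      obtain k where "k \<in> {1..n}" "cl k = j" using claw_nonempty[OF 2(2)] by blast
      hence "(Wh j, Bd k) \<in> fraser_darts r M D" "vlab (Wh j, Bd k) = l" using 2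
          by (auto simp: darts_iff vlab_def)
      thus ?thesis by (metis imageI)
    next
      case (3 \<Delta>)
      obtain \<delta> where "\<delta> \<in> \<Delta>" using 3(2) unfolding triangles_def by auto
      hence "(Tri \<Delta>, Wh \<delta>) \<in> fraser_darts r M D" "vlab (Tri \<Delta>, Wh \<delta>) = l" using 3
          by (auto simp: darts_iff vlab_def)
      thus ?thesis by (metis imageI)
    qed
  qed
  moreover have "card (Wh ` {1..s} \<union> Tri ` triangles D) = s + card (triangles D)"
    by (subst card_Un_disjoint) (auto simp: card_image inj_on_def finite_triangles)
  moreover have "finite (Wh ` {1..s} \<union> Tri ` triangles D)" using finite_triangles by simp
  ultimately have "card (vlab ` fraser_darts r M D) = 1 + s + card (triangles D)"
    by (simp add: card_image card_insert_if image_iff)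
  thus ?thesis using card_orbits[OF orbit_collapsed] by simp
qed

lemma card_E: "card (orbit prod.swap ` fraser_darts r M D) = n + 3 * card (triangles D)"
proof -
  define lab where "lab = (\<lambda>d :: fraser_dart. {fst d, snd d})"
  have orb: "orbit prod.swap d = {e \<in> fraser_darts r M D. lab e = lab d}" if d:
      "d \<in> fraser_darts r M D" for d
  proof -
    have "orbit prod.swap d = set [d, prod.swap d]"
    proof (rule orbit_cycle_list)
      fix k assume "k < length [d, prod.swap d]"
      hence "k = 0 \<or> k = 1" by auto
      thus "prod.swap ([d, prod.swap d] ! k) = [d, prod.swap d]
          ! (Suc k mod length [d, prod.swap d])" by auto
    qed simp
    also have "\<dots> = {e \<in> fraser_darts r M D. lab e = lab d}"
      using d darts_swap[of "fst d" "snd d"] unfolding lab_def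
          by (cases d) (auto simp: doubleton_eq_iff)
    finally show ?thesis .
  qed
  define P where "P = (\<lambda>k. {Wh (cl k), Bd k}) ` {1..n}"
  define Q where "Q = (\<lambda>(\<Delta>, \<delta>). {Wh \<delta>, Tri \<Delta>}) ` Sigma (triangles D) (\<lambda>\<Delta>. \<Delta>)"
  have "lab ` fraser_darts r M D = P \<union> Q"
  proof (intro equalityI subsetI)
    fix l assume "l \<in> lab ` fraser_darts r M D"
    then obtain u w where uw: "(u, w) \<in> fraser_darts r M D" "l = {u, w}" unfolding lab_def by auto
    have pI: "{Wh (cl k), Bd k} \<in> P" "{Bd k, Wh (cl k)} \<in> P" if "k \<in> {1..n}" for k
      using that unfolding P_def by (auto simp: insert_commute)
    have qI: "{Wh \<delta>, Tri \<Delta>} \<in> Q" "{Tri \<Delta>, Wh \<delta>} \<in> Q" if "\<Delta> \<in> triangles D" "\<delta> \<in> \<Delta>" for \<Delta> \<delta>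
    proof -
      have "(\<Delta>, \<delta>) \<in> Sigma (triangles D) (\<lambda>\<Delta>. \<Delta>)" using that by simp
      thus "{Wh \<delta>, Tri \<Delta>} \<in> Q" unfolding Q_def by (rule rev_image_eqI) simp
      thus "{Tri \<Delta>, Wh \<delta>} \<in> Q" by (simp add: insert_commute)
    qed
    from uw(1) show "l \<in> P \<union> Q" unfolding uw(2) darts_iff
      by (elim disjE bexE conjE) (use pI qI in \<open>simp_all only: Un_iff simp_thms\<close>)
  next
    fix l assume "l \<in> P \<union> Q"
    then consider k where "k \<in> {1..n}" "l = lab (Wh (cl k), Bd k)" | \<Delta> \<delta> where "\<Delta> \<in> triangles D"
        "\<delta> \<in> \<Delta>" "l = lab (Wh \<delta>, Tri \<Delta>)"
      unfolding lab_def P_def Q_def by auto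
    thus "l \<in> lab ` fraser_darts r M D" by cases (auto simp: darts_iff intro!: imageI)
  qed
  moreover have "card P = n" unfolding P_def by (subst card_image) (auto simp: inj_on_def
      doubleton_eq_iff)
  moreover have "card Q = 3 * card (triangles D)"
  proof -
    have "inj_on (\<lambda>(\<Delta>, \<delta>). {Wh \<delta>, Tri \<Delta>}) (Sigma (triangles D) (\<lambda>\<Delta>. \<Delta>))"
        by (auto simp: inj_on_def doubleton_eq_iff)
    hence "card Q = card (Sigma (triangles D) (\<lambda>\<Delta>. \<Delta>))" unfolding Q_def by (rule card_image)
    also have "\<dots> = (\<Sum>\<Delta>\<in>triangles D. card \<Delta>)" using finite_triangles triangle_sub
        by (intro card_SigmaI) auto
    also have "\<dots> = 3 * card (triangles D)" using card_triangle by simp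
    finally show ?thesis .
  qed
  moreover have "P \<inter> Q = {}" unfolding P_def Q_def by (auto simp: doubleton_eq_iff)
  moreover have "finite P" "finite Q" unfolding P_def Q_def using finite_triangles triangle_sub
      by auto
  ultimately have "card (lab ` fraser_darts r M D) = n + 3 * card (triangles D)"
      by (simp add: card_Un_disjoint)
  thus ?thesis using card_orbits[OF orb] by simp
qed

text \<open>Every dart has a white end, every claw contains a boundary vertex, and the boundary has
  become one vertex.\<close>

lemma card_C: "card (map_components \<kappa> prod.swap (fraser_darts r M D)) = 1"
proof -
  define D' where "D' = fraser_darts r M D"
  define R where "R = {(x, y). x \<in> D' \<and> (y = \<kappa> x \<or> y = prod.swap x)}"
  have kD: "\<kappa> d \<in> D'" if "d \<in> D'" for d
    using orbit_collapsed[of d] orbit.base[of \<kappa> d] that unfolding D'_def by auto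
  have sD: "prod.swap d \<in> D'" if "d \<in> D'" for d using that darts_swap unfolding D'_def
      by (cases d) auto
  have sub: "e \<in> D'" if "(d, e) \<in> R\<^sup>*" "d \<in> D'" for d e
    using that
  proof (induction rule: rtrancl_induct)
    case (step y z)
    hence "z = \<kappa> y \<or> z = prod.swap y" "y \<in> D'" unfolding R_def by blast+
    thus ?case using kD sD by metis
  qed
  have orb: "(d, e) \<in> R\<^sup>*" if d: "d \<in> D'" and e: "e \<in> D'" "vlab e = vlab d" for d e
  proof -
    have "e \<in> orbit \<kappa> d" using orbit_collapsed d e unfolding D'_def by simp
    thus ?thesis
    proof (induction rule: orbit.induct)
      case base thus ?case using d unfolding R_def by auto
    next
      case (step y)
      have "y \<in> D'" using sub[OF step(2) d] .
      thus ?case using step(2) unfolding R_def by (auto intro: rtrancl_into_rtrancl)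
    qed
  qed
  have sw: "(d, prod.swap d) \<in> R\<^sup>*" if "d \<in> D'" for d using that unfolding R_def by auto
  have bd: "(Bd k, Wh (cl k)) \<in> D'" "(Wh (cl k), Bd k) \<in> D'" if "k \<in> {1..n}" for k using that
      unfolding D'_def by (auto simp: darts_iff)
  have white: "\<exists>j\<in>{1..s}. fst e = Wh j \<or> snd e = Wh j" if "e \<in> D'" for e
  proof -
    obtain u w where e: "e = (u, w)" by (cases e)
    from that[unfolded D'_def e darts_iff] show ?thesis unfolding e fst_conv snd_conv
        using cl_range triangle_sub by blast
  qed
  have toB: "\<exists>k\<in>{1..n}. (d, (Bd k, Wh (cl k))) \<in> R\<^sup>*" if h: "d \<in> D'" "fst d = Wh j" "j \<in> {1..s}"
      for d j
  proof -
    obtain k where k: "k \<in> {1..n}" "cl k = j" using claw_nonempty[OF h(3)] by blast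
    have "(d, (Wh j, Bd k)) \<in> R\<^sup>*" by (rule orb) (use h bd(2)[OF k(1)] k in \<open>auto simp: vlab_def\<close>)
    also have "((Wh j, Bd k), (Bd k, Wh j)) \<in> R\<^sup>*" using sw[OF bd(2)[OF k(1)]] k by simp
    finally show ?thesis using k by auto
  qed
  have toB2: "\<exists>k\<in>{1..n}. (d, (Bd k, Wh (cl k))) \<in> R\<^sup>*" if d: "d \<in> D'" for d
  proof -
    obtain j where j: "j \<in> {1..s}" "fst d = Wh j \<or> snd d = Wh j" using white[OF d] by blast
    from j(2) show ?thesis
    proof
      assume "snd d = Wh j"
      hence "fst (prod.swap d) = Wh j" by simp
      from toB[OF sD[OF d] this j(1)] show ?thesis using sw[OF d] by (meson rtrancl_trans)
    qed (use toB[OF d _ j(1)] in blast)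
  qed
  have fromB: "((Bd k, Wh (cl k)), e) \<in> R\<^sup>*" if k: "k \<in> {1..n}" and e: "e \<in> D'" "fst e = Wh j"
      "j \<in> {1..s}" for k e j
  proof -
    obtain k' where k': "k' \<in> {1..n}" "cl k' = j" using claw_nonempty[OF e(3)] by blast
    have "((Bd k, Wh (cl k)), (Bd k', Wh (cl k'))) \<in> R\<^sup>*" by (rule orb)
        (use bd(1) k k' in \<open>auto simp: vlab_def\<close>)
    also have "((Bd k', Wh (cl k')), (Wh j, Bd k')) \<in> R\<^sup>*" using sw[OF bd(1)[OF k'(1)]] k' by simp
    also have "((Wh j, Bd k'), e) \<in> R\<^sup>*" by (rule orb) (use bd(2)[OF k'(1)]
        k' e in \<open>auto simp: vlab_def\<close>)
    finally show ?thesis .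
  qed
  have fromB2: "((Bd k, Wh (cl k)), e) \<in> R\<^sup>*" if k: "k \<in> {1..n}" and e: "e \<in> D'" for k e
  proof -
    obtain j where j: "j \<in> {1..s}" "fst e = Wh j \<or> snd e = Wh j" using white[OF e] by blast
    from j(2) show ?thesis
    proof
      assume "snd e = Wh j"
      hence "fst (prod.swap e) = Wh j" by simp
      from fromB[OF k sD[OF e] this j(1)] show ?thesis using sw[OF sD[OF e]] by simp
    qed (use fromB[OF k e _ j(1)] in blast)
  qed
  have "R\<^sup>* `` {d} = D'" if d: "d \<in> D'" for d
  proof -
    obtain k where "k \<in> {1..n}" "(d, (Bd k, Wh (cl k))) \<in> R\<^sup>*" using toB2[OF d] by blast
    hence "(d, e) \<in> R\<^sup>*" if "e \<in> D'" for e using fromB2[OF _ that] by (meson rtrancl_trans)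
    thus ?thesis using sub[OF _ d] by auto
  qed
  moreover have "D' \<noteq> {}" using bd(1)[of 1] r1 by auto
  ultimately have "map_components \<kappa> prod.swap D' = {D'}"
      unfolding map_components_def R_def[symmetric] by auto
  thus ?thesis unfolding D'_def by simp
qed

subsection \<open>Faces\<close>

definition clen :: "int \<Rightarrow> nat" where "clen v = length (claw r M (vtx v))"

definition wlen :: "int \<Rightarrow> nat" where "wlen v = length (wedges v)"

text \<open>
  \<open>side v t\<close> is the dart at \<open>Wh v\<close> that follows, in clockwise order, the chord from \<open>v\<close> to its
  \<open>t\<close>-th neighbour; after the last neighbour this is the first dart of the claw.
\<close>

definition side :: "int \<Rightarrow> nat \<Rightarrow> fraser_dart" where
  "side v t = (Wv v, nb (Wv v) ! ((clen v + t) mod (clen v + wlen v)))"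

lemma length_nb_Wh: "length (nb (Wv v)) = clen v + wlen v"
  unfolding nb_Wh clen_def wlen_def by simp

lemma clen_pos: "0 < clen v"
  using claw_ne[OF vtx_range[of v]] unfolding clen_def by simp

lemma length_nbrs: "length (nbrs v) = Suc (wlen v)"
  using nbrs_ends(1)[of v] unfolding wlen_def length_wedges by (cases "nbrs v") auto

lemma Wv_vert: "Wv v \<in> fraser_verts r M D"
  unfolding fraser_verts_def using vtx_range[of v] by blast

lemma cw_Wh:
  assumes "k < clen v + wlen v" shows "cw G (Wv v, nb (Wv v) ! k) = (Wv v, nb (Wv v) ! (Suc k
      mod (clen v + wlen v)))"
  using cycle_of_list_nth[OF nb_props(1)[OF Wv_vert[of v]], of k] assms unfolding length_nb_Wh
      by simp

lemma nb_Wh_claw: "k < clen v \<Longrightarrow> nb (Wv v) ! k = Bd (claw r M (vtx v) ! k)"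
  unfolding nb_Wh clen_def by (simp add: nth_append)

lemma nb_Wh_wedge: "k < wlen v \<Longrightarrow> wedges v ! k = (x, y) \<Longrightarrow> nb (Wv v) ! (clen v + k) = Tv v x y"
  unfolding nb_Wh clen_def wlen_def by (simp add: nth_append)

lemma side_lt: "t < wlen v \<Longrightarrow> wedges v ! t = (x, y) \<Longrightarrow> side v t = (Wv v, Tv v x y)"
  unfolding side_def using nb_Wh_wedge by simp

lemma side_last: "side v (wlen v) = (Wv v, Bd (hd (claw r M (vtx v))))"
  unfolding side_def using nb_Wh_claw[of 0 v] clen_pos[of v] claw_ne[OF vtx_range[of v]]
      by (simp add: hd_conv_nth)

lemma claw_in: "x \<in> set (claw r M (vtx v)) \<Longrightarrow> x \<in> {1..n} \<and> cl x = vtx v"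
  using set_claw[OF vtx_range[of v]] by auto

abbreviation "\<phi> \<equiv> \<kappa> \<circ> prod.swap"

lemma inner_W [simp]: "inner (Wh j)" "inner (Tri \<Delta>)"
  unfolding inner_def by auto

lemma cw_after_wedge:
  assumes "Tr v x y"
  shows "\<exists>t\<le>wlen v. nbrs v ! t = y \<and> cw G (Wv v, Tv v x y) = side v t"
proof -
  obtain t where t: "t < wlen v" "wedges v ! t = (x, y)" using assms set_wedges[of x y v]
      unfolding wlen_def by (auto simp: in_set_conv_nth)
  have "nbrs v ! Suc t = y" using wedges_nth[of t v] t unfolding wlen_def by simp
  moreover have "cw G (Wv v, Tv v x y) = side v (Suc t)"
    using cw_Wh[of "clen v + t" v] nb_Wh_wedge[OF t] t unfolding side_def by simp
  ultimately show ?thesis using t by (intro exI[of _ "Suc t"]) auto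
qed

text \<open>Two steps along a face lead from one end of a chord to the other: through the triangle
  next to the chord or, for the last neighbour \<open>v + s - 1\<close>, through the collapsed
  boundary from the first edge of one claw to the last edge of the preceding one.\<close>

lemma face_step:
  assumes "t \<le> wlen v"
  shows "snd (\<phi> (side v t)) = Wv (nbrs v ! t)"
    "\<exists>t'\<le>wlen (nbrs v ! t). vtx (nbrs (nbrs v ! t) ! t') = vtx v \<and> \<phi> (\<phi> (side v t)) = side (nbrs
        v ! t) t'"
proof -
  define x where "x = nbrs v ! t"
  have "snd (\<phi> (side v t)) = Wv x \<and>
    (\<exists>t'\<le>wlen x. vtx (nbrs x ! t') = vtx v \<and> \<phi> (\<phi> (side v t)) = side x t')"
  proof (cases "t < wlen v")
    case True
    obtain y where w: "wedges v ! t = (x, y)" using wedges_nth[of t v] True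
        unfolding wlen_def x_def by simp
    have T: "Tr v x y" using nth_mem[of t "wedges v"] True w set_wedges unfolding wlen_def by auto
    have s: "side v t = (Wv v, Tv v x y)" by (rule side_lt[OF True w])
    have f: "\<phi> (side v t) = (Tv v x y, Wv x)" unfolding s using collapsed_inner[of
        "(Tv v x y, Wv v)"] cw_Tri[OF T] by simp
    obtain t' where t': "t' \<le> wlen x" "nbrs x ! t' = v + int s" "cw G (Wv x, Tv v x y) = side x t'"
      using cw_after_wedge[OF Tr_rotate(3)[OF T]] unfolding Tr_rotate(1)[OF T] by blast
    have "\<phi> (\<phi> (side v t)) = side x t'" unfolding f using collapsed_inner[of "(Wv x, Tv v x y)"]
        t'(3) by simp
    thus ?thesis using f t' by auto
  next
    case False
    hence t: "t = wlen v" using assms by simp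
    have x: "x = v + int s - 1" using nbrs_ends(1,3)[of v] length_nbrs[of v] unfolding x_def t
        by (simp add: last_conv_nth)
    define b where "b = hd (claw r M (vtx v))"
    define l where "l = last (claw r M (vtx x))"
    have vx: "vtx v = vtx x mod s + 1" using vtx_Suc[of x] unfolding x by simp
    have b: "b = sc l" using hd_claw_next[OF vtx_range[of x]] unfolding vx[symmetric] b_def l_def .
    have bl: "b \<in> {1..n}" "l \<in> {1..n}" "cl l = vtx x"
      using claw_in[of b v] claw_in[of l x] claw_ne[OF vtx_range[of v]]
          claw_ne[OF vtx_range[of x]] unfolding b_def l_def by auto
    have s: "side v t = (Wv v, Bd b)" unfolding t b_def by (rule side_last)
    have f: "\<phi> (side v t) = (Bd l, Wv x)" unfolding s using collapsed_Bd[OF bl(1)]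
        pd_sc[OF bl(2)] bl(3) unfolding b by simp
    have ll: "nb (Wv x) ! (clen x - 1) = Bd l"
      using nb_Wh_claw[of "clen x - 1" x] clen_pos[of x] claw_ne[OF vtx_range[of x]]
          unfolding l_def clen_def by (simp add: last_conv_nth)
    have "\<phi> (\<phi> (side v t)) = cw G (Wv x, Bd l)" unfolding f using collapsed_inner[of
        "(Wv x, Bd l)"] by simp
    also have "\<dots> = side x 0" using cw_Wh[of "clen x - 1" x] clen_pos[of x] unfolding ll side_def
        by simp
    finally have "\<phi> (\<phi> (side v t)) = side x 0" .
    moreover have "nbrs x ! 0 = v + int s" using nbrs_ends(2)[of x] x by simp
    ultimately show ?thesis using f by (auto simp: inner_def)
  qed
  thus "snd (\<phi> (side v t)) = Wv (nbrs v ! t)"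
    "\<exists>t'\<le>wlen (nbrs v ! t). vtx (nbrs (nbrs v ! t) ! t') = vtx v \<and> \<phi> (\<phi> (side v t)) = side (nbrs
        v ! t) t'"
    unfolding x_def by blast+
qed

text \<open>The first edge of a claw and the edges to triangles each follow a chord; any other claw
  edge bounds the gap between it and the edge before it, a face with two darts.\<close>

lemma white_dart_cases:
  assumes "(Wv v, w) \<in> fraser_darts r M D"
  shows "(\<exists>t\<le>wlen v. (Wv v, w) = side v t) \<or>
    (\<exists>b\<in>{1..n}. w = Bd b \<and> cl b = vtx v \<and> cl (pd b) = vtx v \<and> \<phi> (Wv v, w) = (Bd (pd b), Wv v) \<and>
        \<phi> (\<phi> (Wv v, w)) = (Wv v, w))"
proof -
  have "w \<in> set (nb (Wv v))" using assms nb_props(2)[OF Wv_vert[of v]] by simp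
  then obtain k where k: "k < clen v + wlen v" "w = nb (Wv v) ! k"
      unfolding in_set_conv_nth length_nb_Wh by auto
  consider "k = 0" | "0 < k" "k < clen v" | "clen v \<le> k" by linarith
  thus ?thesis
  proof cases
    case 1
    hence "(Wv v, w) = side v (wlen v)" unfolding side_def k(2) by simp
    thus ?thesis by blast
  next
    case 2
    define b where "b = claw r M (vtx v) ! k"
    define a where "a = claw r M (vtx v) ! (k - 1)"
    have w: "w = Bd b" unfolding k(2) b_def by (rule nb_Wh_claw[OF 2(2)])
    have ab: "a \<in> {1..n}" "cl a = vtx v" "b \<in> {1..n}" "cl b = vtx v"
      using claw_in[of a v] claw_in[of b v] 2 unfolding a_def b_def clen_def by auto
    have "b = sc a" using claw_Suc[OF vtx_range[of v], of "k - 1"] 2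
        unfolding a_def b_def clen_def by simp
    hence pa: "pd b = a" using pd_sc[OF ab(1)] by simp
    have f: "\<phi> (Wv v, w) = (Bd a, Wv v)" unfolding w using collapsed_Bd[OF ab(3)] pa ab by simp
    have na: "nb (Wv v) ! (k - 1) = Bd a" unfolding a_def by (rule nb_Wh_claw) (use 2 in auto)
    have "\<phi> (Bd a, Wv v) = cw G (Wv v, Bd a)" using collapsed_inner[of "(Wv v, Bd a)"] by simp
    also have "\<dots> = (Wv v, w)" using cw_Wh[of "k - 1" v] k 2 unfolding na by simp
    finally have "\<phi> (\<phi> (Wv v, w)) = (Wv v, w)" unfolding f .
    thus ?thesis using f w ab pa by blast
  next
    case 3
    hence "(Wv v, w) = side v (k - clen v)" "k - clen v \<le> wlen v" using k unfolding side_def by auto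
    thus ?thesis by blast
  qed
qed

lemma side_dart: "side v t \<in> fraser_darts r M D"
proof -
  have "(clen v + t) mod (clen v + wlen v) < length (nb (Wv v))" unfolding length_nb_Wh
      using clen_pos[of v] by (intro mod_less_divisor) simp
  hence "nb (Wv v) ! ((clen v + t) mod (clen v + wlen v)) \<in> set (nb (Wv v))" by simp
  thus ?thesis using nb_props(2)[OF Wv_vert[of v]] unfolding side_def by blast
qed

lemma nbrs_E: "t \<le> wlen v \<Longrightarrow> E v (nbrs v ! t)"
  using nbrs_nth_E[of t v] length_nbrs[of v] by simp

text \<open>Following a face around returns to a shifted lift of the starting chord, while the dart
  depends only on the residues of its ends.\<close>

lemma side_unique: assumes "t \<le> wlen v" "t' \<le> wlen v'" "vtx v = vtx v'"
    "vtx (nbrs v ! t) = vtx (nbrs v' ! t')"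
  shows "side v t = side v' t'"
proof -
  have nb': "nb (Wv v) = nb (Wv v')" using assms(3) by simp
  obtain q where q: "v' = v + q * int s"
  proof -
    have "int s dvd v' - v" using assms(3) vtx_eq_iff[of v' v] by simp
    then obtain q where "v' - v = int s * q" by blast
    thus ?thesis using that[of q] by (simp add: algebra_simps)
  qed
  have e1: "nbrs v' = map (\<lambda>x. x + q * int s) (nbrs v)"
  proof -
    have "[v' + 1..v' + int s - 1] = map (\<lambda>x. x + q * int s) [v + 1..v + int s - 1]"
      unfolding q by (rule nth_equalityI) (auto simp: nth_upto)
    thus ?thesis unfolding nbrs_def q by (simp add: filter_map o_def E_shift_mult del: upto.simps)
  qed
  have wl: "wlen v' = wlen v" using e1 unfolding wlen_def length_wedges by simp
  have t'l: "t' < length (nbrs v)" "t < length (nbrs v)" using assms(1,2) wl length_nbrs[of v]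
      by auto
  have "vtx (nbrs v ! t) = vtx (nbrs v ! t')" using assms(4) e1 t'l by simp
  moreover have "E v (nbrs v ! t)" "E v (nbrs v ! t')" using nbrs_E assms(1,2) wl by auto
  ultimately have "nbrs v ! t = nbrs v ! t'"
    using vtx_close[of "nbrs v ! t" "nbrs v ! t'"] E_less[of v "nbrs v ! t"] E_less[of v
        "nbrs v ! t'"] by auto
  hence "t = t'" using nbrs_nth_mono[of t t' v] nbrs_nth_mono[of t' t v] t'l
      by (cases t t' rule: linorder_cases) auto
  thus ?thesis using assms(3) wl unfolding side_def clen_def by simp
qed

text \<open>A gap in a claw meets one white vertex and is named by a boundary vertex; any other face
  lies along a chord and is named by its two white ends.\<close>

definition flab0 :: "fraser_dart \<Rightarrow> fraser_vertex set + fraser_vertex" where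
  "flab0 e = (if snd (\<phi> e) = fst e then Inr (snd e) else Inl {fst e, snd (\<phi> e)})"

text \<open>White and black tails alternate along a face, so a dart with black tail takes the label
  of its successor.\<close>

definition flab :: "fraser_dart \<Rightarrow> fraser_vertex set + fraser_vertex" where
  "flab e = (if \<exists>j. fst e = Wh j then flab0 e else flab0 (\<phi> e))"

lemma collapsed_dart: "d \<in> fraser_darts r M D \<Longrightarrow> \<kappa> d \<in> fraser_darts r M D \<and> vlab (\<kappa> d) = vlab d"
  using orbit_collapsed[of d] orbit.base[of \<kappa> d] by auto

lemma collapsed_inj:
  assumes d: "d \<in> fraser_darts r M D" "e \<in> fraser_darts r M D" "\<kappa> d = \<kappa> e" shows "d = e"
proof -
  have v: "vlab d = vlab e" using collapsed_dart[OF d(1)] collapsed_dart[OF d(2)] d(3) by simp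
  show ?thesis
  proof (cases "inner (fst d)")
    case True
    hence "inner (fst e)" using v unfolding vlab_def inner_def by (cases "fst d"; cases
        "fst e") auto
    thus ?thesis using collapsed_inner True cw_inj d by metis
  next
    case False
    hence "\<not> inner (fst e)" using v unfolding vlab_def inner_def by (cases "fst d"; cases
        "fst e") auto
    then obtain k k' where k: "fst d = Bd k" "fst e = Bd k'" using False unfolding inner_def by auto
    have kk: "k \<in> {1..n}" "k' \<in> {1..n}" "snd d = Wh (cl k)" "snd e = Wh (cl k')"
      using d(1,2) k by (cases d; cases e; auto simp: darts_iff)+
    have "d = (Bd k, Wh (cl k))" "e = (Bd k', Wh (cl k'))" using k kk by (simp_all add: prod_eq_iff)
    moreover from this have "pd k = pd k'" using d(3) collapsed_Bd[OF kk(1)]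
        collapsed_Bd[OF kk(2)] by simp
    hence "k = k'" using kk(1,2) unfolding pd_def by (auto split: if_splits)
    ultimately show ?thesis by simp
  qed
qed

lemma face_dart: "d \<in> fraser_darts r M D \<Longrightarrow> \<phi> d \<in> fraser_darts r M D"
  using collapsed_dart[of "prod.swap d"] darts_swap[of "fst d" "snd d"] by (cases d) auto

lemma face_inj: "d \<in> fraser_darts r M D \<Longrightarrow> e \<in> fraser_darts r M D \<Longrightarrow> \<phi> d = \<phi> e \<Longrightarrow> d = e"
  using collapsed_inj[of "prod.swap d" "prod.swap e"] darts_swap[of "fst d" "snd d"]
      darts_swap[of "fst e" "snd e"]
  by (cases d; cases e) auto

lemma face_white:
  assumes "d \<in> fraser_darts r M D"
  shows "(\<exists>j. fst (\<phi> d) = Wh j) \<longleftrightarrow> \<not> (\<exists>j. fst d = Wh j)"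
proof -
  have sw: "prod.swap d \<in> fraser_darts r M D" using assms darts_swap[of "fst d" "snd d"]
      by (cases d) auto
  have "vlab (\<phi> d) = vlab (prod.swap d)" using collapsed_dart[OF sw] by simp
  hence "(\<exists>j. fst (\<phi> d) = Wh j) \<longleftrightarrow> (\<exists>j. snd d = Wh j)"
    unfolding vlab_def by (cases "fst (\<phi> d)"; cases "snd d") (simp_all del: o_apply)
  also have "\<dots> \<longleftrightarrow> \<not> (\<exists>j. fst d = Wh j)" using assms by (cases d) (auto simp: darts_iff)
  finally show ?thesis .
qed

definition gap :: "fraser_dart \<Rightarrow> bool" where
  "gap e \<longleftrightarrow> (\<exists>b\<in>{1..n}. e = (Wh (cl b), Bd b) \<and> cl (pd b) = cl b \<and> \<phi> (\<phi> e) = e \<and> flab0 e = Inr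
      (Bd b))"

lemma white_faces:
  assumes "e \<in> fraser_darts r M D" "fst e = Wh j"
  shows "gap e \<or> (\<exists>v t. t \<le> wlen v \<and> e = side v t)"
proof -
  have "Wh j \<in> fraser_verts r M D" using darts_verts[of "fst e" "snd e"] assms
      by (metis prod.collapse)
  hence "j \<in> {1..s}" unfolding fraser_verts_def by auto
  then obtain v where v: "j = vtx v" using vtx_ex by blast
  have e: "e = (Wv v, snd e)" using assms(2) v by (simp add: prod_eq_iff)
  have "(Wv v, snd e) \<in> fraser_darts r M D" using assms(1) e by simp
  from white_dart_cases[OF this] show ?thesis
  proof (elim disjE exE conjE bexE)
    fix t assume "t \<le> wlen v" "(Wv v, snd e) = side v t"
    thus ?thesis using e by metis
  next
    fix b assume b: "b \<in> {1..n}" "snd e = Bd b" "cl b = vtx v" "cl (pd b) = vtx v"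
      "\<phi> (Wv v, snd e) = (Bd (pd b), Wv v)" "\<phi> (\<phi> (Wv v, snd e)) = (Wv v, snd e)"
    have e': "e = (Wh (cl b), Bd b)" using e b by simp
    have "\<phi> (\<phi> e) = e" using b(6) e by simp
    moreover have "flab0 e = Inr (Bd b)" using b(5) unfolding flab0_def e[symmetric]
        by (simp add: e' b(3) del: o_apply)
    ultimately have "gap e" unfolding gap_def using b(1,3,4) e'
        by (intro bexI[of _ b]) (simp_all del: o_apply)
    thus ?thesis by blast
  qed
qed

lemma flab0_side:
  assumes "t \<le> wlen v" shows "flab0 (side v t) = Inl {Wv v, Wv (nbrs v ! t)}"
proof -
  have "vtx (nbrs v ! t) \<noteq> vtx v"
    using vtx_close[of "nbrs v ! t" v] E_less[OF nbrs_E[OF assms]] by auto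
  moreover have "fst (side v t) = Wv v" unfolding side_def by simp
  ultimately show ?thesis using face_step(1)[OF assms] unfolding flab0_def by (simp del: o_apply)
qed

lemma side_step:
  assumes "t \<le> wlen v"
  obtains x t' where "t' \<le> wlen x" "vtx x = vtx (nbrs v ! t)" "vtx (nbrs x ! t') = vtx v"
      "\<phi> (\<phi> (side v t)) = side x t'"
    "\<phi> (\<phi> (side x t')) = side v t"
proof -
  obtain t' where t': "t' \<le> wlen (nbrs v ! t)" "vtx (nbrs (nbrs v ! t) ! t') = vtx v"
      "\<phi> (\<phi> (side v t)) = side (nbrs v ! t) t'"
    using face_step(2)[OF assms] by blast
  obtain t'' where t'': "t'' \<le> wlen (nbrs (nbrs v ! t) ! t')"
      "vtx (nbrs (nbrs (nbrs v ! t) ! t') ! t'') = vtx (nbrs v ! t)"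
    "\<phi> (\<phi> (side (nbrs v ! t) t')) = side (nbrs (nbrs v ! t) ! t') t''"
    using face_step(2)[OF t'(1)] by blast
  have "side (nbrs (nbrs v ! t) ! t') t'' = side v t" by (rule side_unique)
      (use t' t'' assms in auto)
  thus ?thesis using that[of t' "nbrs v ! t"] t' t'' by simp
qed

lemma orbit2: "f (f x) \<in> orbit f x"
  by (intro orbit.step orbit.base)

text \<open>A gap has one white dart; the face of a chord has two, namely the \<open>side\<close>
  darts at its two ends, and two steps of \<open>\<phi>\<close> exchange them.\<close>

lemma white_same_face:
  assumes e: "e \<in> fraser_darts r M D" "fst e = Wh j" and e': "e' \<in> fraser_darts r M D"
      "fst e' = Wh j'" and l: "flab0 e = flab0 e'"
  shows "e' \<in> orbit \<phi> e"
proof (cases "gap e")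
  case True
  then obtain b where b: "e = (Wh (cl b), Bd b)" "\<phi> (\<phi> e) = e" "flab0 e = Inr (Bd b)"
      unfolding gap_def by blast
  have "gap e'"
    using white_faces[OF e'] flab0_side l b(3) by auto
  then obtain b' where b': "e' = (Wh (cl b'), Bd b')" "flab0 e' = Inr (Bd b')" unfolding gap_def
      by blast
  have "e' = e" using b b' l by simp
  thus ?thesis using orbit2[of \<phi> e] b(2) by simp
next
  case False
  then obtain v t where v: "t \<le> wlen v" "e = side v t" using white_faces[OF e] by blast
  have "\<not> gap e'" using l flab0_side[OF v(1)] v(2) unfolding gap_def by auto
  then obtain v' t' where v': "t' \<le> wlen v'" "e' = side v' t'" using white_faces[OF e'] by blast
  obtain x u where x: "u \<le> wlen x" "vtx x = vtx (nbrs v ! t)" "vtx (nbrs x ! u) = vtx v"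
      "\<phi> (\<phi> (side v t)) = side x u"
    "\<phi> (\<phi> (side x u)) = side v t" using side_step[OF v(1)] by metis
  have o2: "side x u \<in> orbit \<phi> e" using orbit2[of \<phi> e] x(4) v(2) by simp
  have "side v t \<in> orbit \<phi> (side x u)" using orbit2[of \<phi> "side x u"] x(5) by simp
  hence o1: "side v t \<in> orbit \<phi> e" using orbit_trans o2 by metis
  have "{Wv v, Wv (nbrs v ! t)} = {Wv v', Wv (nbrs v' ! t')}"
    using l flab0_side[OF v(1)] flab0_side[OF v'(1)] v(2) v'(2) by simp
  hence "vtx v = vtx v' \<and> vtx (nbrs v ! t) = vtx (nbrs v' ! t') \<or> vtx v = vtx (nbrs v' ! t') \<and>
      vtx (nbrs v ! t) = vtx v'"
    by (auto simp: doubleton_eq_iff)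
  thus ?thesis
  proof (elim disjE conjE)
    assume "vtx v = vtx v'" "vtx (nbrs v ! t) = vtx (nbrs v' ! t')"
    hence "e' = side v t" unfolding v'(2) by (intro side_unique) (use v v' in auto)
    thus ?thesis using o1 by simp
  next
    assume "vtx v = vtx (nbrs v' ! t')" "vtx (nbrs v ! t) = vtx v'"
    hence "e' = side x u" unfolding v'(2) by (intro side_unique) (use v v' x in auto)
    thus ?thesis using o2 by simp
  qed
qed

lemma flab0_double:
  assumes "e \<in> fraser_darts r M D" "fst e = Wh j" shows "flab0 (\<phi> (\<phi> e)) = flab0 e"
  using white_faces[OF assms]
proof (elim disjE exE conjE)
  assume "gap e" thus ?thesis unfolding gap_def by auto
next
  fix v t assume v: "t \<le> wlen v" "e = side v t"
  obtain x u where x: "u \<le> wlen x" "vtx x = vtx (nbrs v ! t)" "vtx (nbrs x ! u) = vtx v"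
      "\<phi> (\<phi> (side v t)) = side x u"
    using side_step[OF v(1)] by metis
  show ?thesis unfolding v(2) x(4) flab0_side[OF v(1)] flab0_side[OF x(1)] using x
      by (simp add: insert_commute)
qed

lemma flab_face: assumes "e \<in> fraser_darts r M D" shows "flab (\<phi> e) = flab e"
proof (cases "\<exists>j. fst e = Wh j")
  case True
  thus ?thesis using face_white[OF assms] flab0_double[OF assms] unfolding flab_def
      by (auto simp del: o_apply)
next
  case False
  thus ?thesis using face_white[OF assms] unfolding flab_def by (auto simp del: o_apply)
qed

lemma orbit_face:
  assumes d: "d \<in> fraser_darts r M D" shows "orbit \<phi> d = {e \<in> fraser_darts r M D. flab e = flab d}"
proof (intro equalityI subsetI)
  fix e assume "e \<in> orbit \<phi> d"
  thus "e \<in> {e \<in> fraser_darts r M D. flab e = flab d}"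
    by (induction rule: orbit.induct) (use d face_dart flab_face in \<open>auto simp del: o_apply\<close>)
next
  fix e assume "e \<in> {e \<in> fraser_darts r M D. flab e = flab d}"
  hence e: "e \<in> fraser_darts r M D" "flab e = flab d" by auto
  define wh where "wh = (\<lambda>a. if \<exists>j. fst a = Wh j then a else \<phi> a)"
  have wh: "wh a \<in> fraser_darts r M D" "\<exists>j. fst (wh a) = Wh j" "flab0 (wh a) = flab a" if
      "a \<in> fraser_darts r M D" for a
    using face_dart[OF that] face_white[OF that] that unfolding wh_def flab_def
        by (auto simp del: o_apply)
  have 1: "a' \<in> orbit \<phi> a" if "a \<in> fraser_darts r M D" "\<exists>j. fst a = Wh j"
      "a' \<in> fraser_darts r M D" "\<exists>j. fst a' = Wh j" "flab0 a = flab0 a'" for a a'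
    using white_same_face that by blast
  have "wh e \<in> orbit \<phi> (wh d)" using 1[OF wh(1,2)[OF d] wh(1,2)[OF e(1)]] wh(3)[OF d]
      wh(3)[OF e(1)] e(2) by simp
  hence we: "wh e \<in> orbit \<phi> d"
  proof (cases "\<exists>j. fst d = Wh j")
    case False
    hence "wh d \<in> orbit \<phi> d" unfolding wh_def using orbit.base[of \<phi> d] by simp
    thus ?thesis using \<open>wh e \<in> orbit \<phi> (wh d)\<close> orbit_trans by metis
  qed (simp add: wh_def)
  show "e \<in> orbit \<phi> d"
  proof (cases "\<exists>j. fst e = Wh j")
    case True thus ?thesis using we unfolding wh_def by simp
  next
    case False
    hence w: "wh e = \<phi> e" unfolding wh_def by simp
    \<comment> \<open>It remains to go back from \<open>\<phi> e\<close> to \<open>e\<close>: the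
      orbit of \<open>\<phi> e\<close> is periodic, and by injectivity the dart just before the
      return is \<open>e\<close>.\<close>
    have "wh e \<in> orbit \<phi> (wh e)" using 1[OF wh(1,2)[OF e(1)] wh(1,2)[OF e(1)]] by simp
    then obtain m where m: "0 < m" "(\<phi> ^^ m) (wh e) = wh e" unfolding orbit_altdef by auto
    obtain m' where m': "m = Suc m'" using m(1) by (cases m) auto
    have pS: "(f ^^ Suc i) x = f ((f ^^ i) x)" for f :: "fraser_dart \<Rightarrow> fraser_dart" and i x by simp
    have pw: "(\<phi> ^^ i) (wh e) \<in> fraser_darts r M D \<and> (\<phi> ^^ i) (wh e) \<in> orbit \<phi> d" for i
    proof (induction i)
      case 0 thus ?case using wh(1)[OF e(1)] we by (simp del: o_apply)
    next
      case (Suc i)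
      thus ?case unfolding pS using face_dart orbit.step by metis
    qed
    have "\<phi> ((\<phi> ^^ m') (wh e)) = \<phi> e" using m(2) w unfolding m' pS by metis
    hence "(\<phi> ^^ m') (wh e) = e" using face_inj[OF _ e(1)] pw by blast
    thus ?thesis using pw by metis
  qed
qed

lemma claw_heads: "{b \<in> {1..n}. cl (pd b) \<noteq> cl b} = (\<lambda>j. hd (claw r M j)) ` {1..s}"
proof (intro equalityI subsetI)
  fix b assume "b \<in> {b \<in> {1..n}. cl (pd b) \<noteq> cl b}"
  hence b: "b \<in> {1..n}" "cl (pd b) \<noteq> cl b" by auto
  have "b \<in> set (claw r M (cl b))" using in_claw[OF cl_range b(1)] by simp
  then obtain k where k: "k < length (claw r M (cl b))" "claw r M (cl b) ! k = b"
      by (auto simp: in_set_conv_nth)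
  have "k = 0"
  proof (rule ccontr)
    assume "k \<noteq> 0"
    then obtain k' where k': "k = Suc k'" by (cases k) auto
    define a where "a = claw r M (cl b) ! k'"
    have "a \<in> set (claw r M (cl b))" unfolding a_def using k k' by simp
    hence a: "a \<in> {1..n}" "cl a = cl b" using set_claw[OF cl_range] by auto
    have "b = sc a" using claw_Suc[OF cl_range, of k' b] k k' unfolding a_def by simp
    hence "pd b = a" using pd_sc[OF a(1)] by simp
    thus False using a(2) b(2) by simp
  qed
  hence "b = hd (claw r M (cl b))" using k claw_ne[OF cl_range[of b]] by (simp add: hd_conv_nth)
  thus "b \<in> (\<lambda>j. hd (claw r M j)) ` {1..s}" using cl_range[of b] by blast
next
  fix b assume "b \<in> (\<lambda>j. hd (claw r M j)) ` {1..s}"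
  then obtain j where j: "j \<in> {1..s}" "b = hd (claw r M j)" by blast
  obtain v where v: "j = vtx v" using vtx_ex[OF j(1)] by blast
  define l where "l = last (claw r M (vtx (v - 1)))"
  have vv: "vtx v = vtx (v - 1) mod s + 1" using vtx_Suc[of "v - 1"] by simp
  have "b = sc l" using hd_claw_next[OF vtx_range[of "v - 1"]] unfolding vv[symmetric]
      l_def j(2) v .
  moreover have l: "l \<in> {1..n}" "cl l = vtx (v - 1)" using claw_in[of l "v - 1"]
      claw_ne[OF vtx_range[of "v - 1"]] unfolding l_def by auto
  ultimately have "pd b = l" using pd_sc by simp
  moreover have "b \<in> {1..n}" "cl b = vtx v" using claw_in[of b v] claw_ne[OF vtx_range[of v]]
      unfolding j(2) v by auto
  moreover have "vtx (v - 1) \<noteq> vtx v" using vtx_close[of "v - 1" v] s2 by auto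
  ultimately show "b \<in> {b \<in> {1..n}. cl (pd b) \<noteq> cl b}" using l by simp
qed

text \<open>A claw with \<open>c\<close> edges has \<open>c - 1\<close> gaps; the boundary vertices
  that open no gap are the first elements of the claws.\<close>

lemma card_gaps: "card {b \<in> {1..n}. cl (pd b) = cl b} + s = n"
proof -
  have "inj_on (\<lambda>j. hd (claw r M j)) {1..s}"
  proof (rule inj_onI)
    fix i j assume ij: "i \<in> {1..s}" "j \<in> {1..s}" "hd (claw r M i) = hd (claw r M j)"
    have 1: "cl (hd (claw r M i)) = i" by (rule in_claw_imp[OF ij(1) hd_in_set[OF claw_ne[OF
        ij(1)]]])
    have 2: "cl (hd (claw r M j)) = j" by (rule in_claw_imp[OF ij(2) hd_in_set[OF claw_ne[OF
        ij(2)]]])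
    show "i = j" using arg_cong[OF ij(3), of cl] unfolding 1 2 .
  qed
  hence "card {b \<in> {1..n}. cl (pd b) \<noteq> cl b} = s" unfolding claw_heads by (simp add: card_image)
  moreover have "{b \<in> {1..n}. cl (pd b) = cl b} \<union> {b \<in> {1..n}. cl (pd b) \<noteq> cl b} = {1..n}" by blast
  moreover have "{b \<in> {1..n}. cl (pd b) = cl b} \<inter> {b \<in> {1..n}. cl (pd b) \<noteq> cl b} = {}" by blast
  ultimately show ?thesis
    using card_Un_disjoint[of "{b \<in> {1..n}. cl (pd b) = cl b}" "{b \<in> {1..n}. cl (pd b) \<noteq> cl b}"]
        by simp
qed

text \<open>One face for each gap in a claw and one for each chord, sides of the polygon
  included.\<close>

lemma card_F: "card (orbit \<phi> ` fraser_darts r M D) + s = n + card D"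
proof -
  define P :: "(fraser_vertex set + fraser_vertex) set" where
      "P = (\<lambda>b. Inr (Bd b)) ` {b \<in> {1..n}. cl (pd b) = cl b}"
  define Q :: "(fraser_vertex set + fraser_vertex) set" where "Q = (\<lambda>(a, b). Inl {Wh a, Wh b}) ` D"
  have white: "flab0 e \<in> P \<union> Q" if e: "e \<in> fraser_darts r M D" "\<exists>j. fst e = Wh j" for e
  proof -
    obtain j where "fst e = Wh j" using e(2) by blast
    from white_faces[OF e(1) this] show ?thesis
    proof (elim disjE exE conjE)
      assume "gap e" thus ?thesis unfolding gap_def P_def by auto
    next
      fix v t assume v: "t \<le> wlen v" "e = side v t"
      have "joined D (vtx v) (vtx (nbrs v ! t))" using nbrs_E[OF v(1)] unfolding E_def by simp
      hence "Inl {Wv v, Wv (nbrs v ! t)} \<in> Q" unfolding joined_def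
      proof
        assume "(vtx v, vtx (nbrs v ! t)) \<in> D" thus ?thesis unfolding Q_def by force
      next
        assume "(vtx (nbrs v ! t), vtx v) \<in> D"
        thus ?thesis unfolding Q_def by (rule rev_image_eqI) (auto simp: insert_commute)
      qed
      thus ?thesis using flab0_side[OF v(1)] v(2) by simp
    qed
  qed
  have "flab ` fraser_darts r M D = P \<union> Q"
  proof (intro equalityI subsetI)
    fix l assume "l \<in> flab ` fraser_darts r M D"
    then obtain e where e: "e \<in> fraser_darts r M D" "l = flab e" by blast
    show "l \<in> P \<union> Q"
    proof (cases "\<exists>j. fst e = Wh j")
      case True thus ?thesis using white[OF e(1)] e(2) unfolding flab_def by simp
    next
      case False
      hence "\<exists>j. fst (\<phi> e) = Wh j" using face_white[OF e(1)] by blast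
      from white[OF face_dart[OF e(1)] this] show ?thesis using e(2) False unfolding flab_def
          by (simp del: o_apply)
    qed
  next
    fix l assume "l \<in> P \<union> Q"
    thus "l \<in> flab ` fraser_darts r M D"
    proof
      assume "l \<in> P"
      then obtain b where b: "b \<in> {1..n}" "cl (pd b) = cl b" "l = Inr (Bd b)" unfolding P_def
          by blast
      have "\<phi> (Wh (cl b), Bd b) = (Bd (pd b), Wh (cl (pd b)))" using collapsed_Bd[OF b(1)] by simp
      hence "flab (Wh (cl b), Bd b) = l" using b unfolding flab_def flab0_def by (simp del: o_apply)
      moreover have "(Wh (cl b), Bd b) \<in> fraser_darts r M D" using b by (auto simp: darts_iff)
      ultimately show ?thesis by blast
    next
      assume "l \<in> Q"
      then obtain a b where ab: "(a, b) \<in> D" "l = Inl {Wh a, Wh b}" unfolding Q_def by auto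
      have abs: "a \<in> {1..s}" "b \<in> {1..s}" using ab Dchords unfolding chords_def by auto
      hence "int b \<in> set (nbrs (int a))" using E_int ab(1) unfolding set_nbrs by simp
      then obtain t where t: "t < length (nbrs (int a))" "nbrs (int a) ! t = int b"
          by (auto simp: in_set_conv_nth)
      hence tw: "t \<le> wlen (int a)" using length_nbrs[of "int a"] by simp
      have "flab0 (side (int a) t) = l" using flab0_side[OF tw] t(2) vtx_of_nat abs ab(2) by simp
      moreover have "fst (side (int a) t) = Wv (int a)" unfolding side_def by simp
      ultimately have "flab (side (int a) t) = l" unfolding flab_def by simp
      thus ?thesis using side_dart by blast
    qed
  qed
  moreover have "card P = card {b \<in> {1..n}. cl (pd b) = cl b}" unfolding P_def
      by (rule card_image) (auto simp: inj_on_def)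
  moreover have "card Q = card D"
    unfolding Q_def
  proof (rule card_image, rule inj_onI)
    fix p q assume pq: "p \<in> D" "q \<in> D" "(case p of (a, b) \<Rightarrow> Inl {Wh a, Wh b}) = (case q of (a,
        b) \<Rightarrow> Inl {Wh a, Wh b})"
    have "fst p < snd p" "fst q < snd q" using pq Dchords unfolding chords_def by auto
    thus "p = q" using pq(3) by (cases p; cases q) (auto simp: doubleton_eq_iff)
  qed
  moreover have "P \<inter> Q = {}" "finite P" "finite Q" unfolding P_def Q_def using finite_D by auto
  ultimately have "card (flab ` fraser_darts r M D) = card {b \<in> {1..n}. cl (pd b) = cl b} + card
      D" by (simp add: card_Un_disjoint)
  thus ?thesis using card_orbits[OF orbit_face] card_gaps by simp
qed

text \<open>With \<open>t\<close> triangles the counts are \<open>V = 1 + s + t\<close>,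
  \<open>E = n + 3 * t\<close>, \<open>F = n - s + 2 * t + 1\<close> and
  \<open>C = 1\<close>.\<close>

lemma drawn_fraser: "drawn_in_disk G"
  using card_V card_E card_F card_C card_chords unfolding drawn_in_disk_def Let_def
      fraser_simps(2,3) by linarith

lemma hourglass_plabic_fraser: "hourglass_plabic r G"
  unfolding hourglass_plabic_def
  using wf_fraser coloured_fraser simple_degree_fraser degree_fraser drawn_fraser by blast

end

theorem theorem4p6:
  fixes r :: nat and T :: "nat \<times> nat \<Rightarrow> nat"
    and G :: "(fraser_vertex, fraser_dart) hourglass"
  assumes "r \<ge> 1"
    and "standard_tableau r T"
    and "fraser_graph_of r T G"
  shows "hourglass_plabic r G \<and> fully_reduced r G"
proof -
  obtain M D where MD: "matching_of_tableau r T M" "fraser_triangulation r M D"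
      "G = fraser_graph r M D"
    using assms(3) unfolding fraser_graph_of_def by blast
  interpret fraser r M D
    using assms(1) MD(1,2) unfolding matching_of_tableau_def by unfold_locales auto
  show ?thesis unfolding MD(3) using hourglass_plabic_fraser fully_reduced_fraser by blast
qed

end
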